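(* Let $n\ge2$ and let $F(\mathbf{x})=\sum_{i=1}^n a_ix_i^{k_i}\in\mathbb{Z}[x_1,\dots,x_n]$ with $k_i\ge2$ and $a_i\ne0$ for all $1\le i\le n$, and put $k_*=\min_{1\le i\le n}k_i$. There exist constants $p_0$ and $c>0$ depending only on $F$ such that for every prime $p>p_0$, every integer $r\ge1$ and all subsets $E_1,E_2\subseteq(\mathbb{Z}/p^r\mathbb{Z})^n$, $$|\Delta_{n,r}(E_1,E_2)|\ \ge\ c\min\Big\{p^r,\ \frac{|E_1||E_2|}{p^{r(2n-2/k_* )-n+1}}\Big\},$$ where $\Delta_{n,r}(E_1,E_2)=\{F(\mathbf{x}-\mathbf{y}) \bmod p^r:\ \mathbf{x}\in E_1,\ \mathbf{y}\in E_2\}$. In particular, for every constant $K>0$ there is $c'>0$ depending only on $F$ and $K$ such that, for $p>p_0$, $|\Delta_{n,r}(E_1,E_2)|\ge c'p^r$ whenever $$\frac{\sqrt{|E_1||E_2|}}{p^{rn}}\ge K\,p^{r\left(\frac12-\frac1{k_*}\right)-\frac{n-1}{2}}.$$ *)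

theory Defs
  imports Complex_Main "HOL-Library.FuncSet" "HOL-Number_Theory.Number_Theory"
begin

definition diag_poly :: "nat \<Rightarrow> (nat \<Rightarrow> int) \<Rightarrow> (nat \<Rightarrow> nat) \<Rightarrow> (nat \<Rightarrow> int) \<Rightarrow> int" where
  "diag_poly n a k x = (\<Sum>i\<in>{1..n}. a i * x i ^ k i)"

definition min_exponent :: "nat \<Rightarrow> (nat \<Rightarrow> nat) \<Rightarrow> nat" where
  "min_exponent n k = Min (k ` {1..n})"

text \<open>The module \<open>(\<int>/m\<int>)\<^sup>n\<close>: coordinates are indexed by \<open>{1..n}\<close>, and each residue class is
  represented by its unique representative in \<open>{0..m - 1}\<close>, the carrier of \<open>residue_ring m\<close>.
  Functions are extensional so that distinct functions are distinct vectors.\<close>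

definition residue_vectors :: "nat \<Rightarrow> int \<Rightarrow> (nat \<Rightarrow> int) set" where
  "residue_vectors n m = {1..n} \<rightarrow>\<^sub>E carrier (residue_ring m)"

text \<open>The difference \<open>x - y\<close> is taken on integer representatives; by \<open>diag_poly_cong\<close> below the
  residue of \<open>F(x - y)\<close> does not depend on their choice.\<close>

definition distance_set ::
  "nat \<Rightarrow> (nat \<Rightarrow> int) \<Rightarrow> (nat \<Rightarrow> nat) \<Rightarrow> int \<Rightarrow> (nat \<Rightarrow> int) set \<Rightarrow> (nat \<Rightarrow> int) set \<Rightarrow> int set" where
  "distance_set n a k m E1 E2 =
     {diag_poly n a k (\<lambda>i. x i - y i) mod m | x y. x \<in> E1 \<and> y \<in> E2}"

lemma diag_poly_cong:
  assumes "\<And>i. i \<in> {1..n} \<Longrightarrow> [x i = x' i] (mod m)"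
  shows "[diag_poly n a k x = diag_poly n a k x'] (mod m)"
  unfolding diag_poly_def using assms by (intro cong_sum cong_mult cong_pow cong_refl) auto

end

(* A Cauchy-Schwarz argument bounds the number of values of F(x - y) from below by the second moment
   of their counting function, and Fourier analysis on (Z/q)^n, q = p^r, bounds that moment by products
   of one-variable sums of e((a z^k + b z)/q). Modulo p^l such a sum is O(p^(l - max(l/k, 1/2))):
   for k = 2 by squaring, for l > 1 by stationary phase and the recursion l -> l - k, and for l = 1 by
   Weil's bound (k - 1) sqrt p. Summed over l with this saving, the moment has the claimed size: one
   variable with the smallest exponent contributes its 2l/k, every other one at least 1.

   Weil's bound is proved by Bombieri's version of Stepanov's method. The sum is a power sum of the
   inverse zeros of the L-function of the character h |-> e((sum of f over the roots of h)/p) on monic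
   polynomials over F_p, which is a polynomial of degree k - 1. The power sums of order 2m count points
   (x, y) on y^p - y = f(x) with Frob^(2m) (x, y) = (x, y + t); an auxiliary function on the curve that
   vanishes at all these points bounds their number by p^(2m) + O(p^m), and letting m grow forces the
   inverse zeros to have absolute value at most sqrt p. *)

theory Submission
  imports Defs "HOL-Analysis.Analysis" "HOL-Computational_Algebra.Computational_Algebra"
begin

subsection \<open>Congruences modulo an ideal\<close>

text \<open>No finite field or function field is constructed: its equations are congruences between
  integer polynomials. Modulo (p, P) in Z[x] stands for the field F_p[x]/(P), in which x is a root
  of P; modulo (p, E) in Z[x][y] stands for the ring of the curve y^p - y = f(x). Points are seen
  only through the irreducible P below them, and all points with a given t are handled at once
  modulo the product G of these P. With q = p^m, even order comes from the shape of the auxiliary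
  monomials x^(a1 + q b1) y^(a2 + q b2): at the points, x^(q^2) = x and y^(q^2) = y + t, so their
  q-th powers become functions of much smaller pole order than expected. The ideal (p, E, G) need
  not be prime, so a vanishing q-th power does not at once give a vanishing function; instead a high
  iterate of Frobenius that is the identity modulo the ideal is used. Stepanov's method bounds the
  number of points with given t only from above; the bound becomes two-sided because the total over
  t is known exactly. In the final summation over l every constant has to be free of p and r. This
  needs geometric decay in l even when the smallest exponent is 2, and the second variable supplies
  it.\<close>

locale ring_ideal =
  fixes I :: "'a::comm_ring_1 set"
  assumes zero_mem: "0 \<in> I"
    and add_mem: "u \<in> I \<Longrightarrow> v \<in> I \<Longrightarrow> u + v \<in> I"
    and mult_mem: "u \<in> I \<Longrightarrow> w * u \<in> I"
begin

lemma mult_mem': "u \<in> I \<Longrightarrow> u * w \<in> I"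
  using mult_mem[of u w] by (simp add: mult.commute)

lemma uminus_mem: "u \<in> I \<Longrightarrow> - u \<in> I"
  using mult_mem[of u "-1"] by simp

lemma diff_mem: "u \<in> I \<Longrightarrow> v \<in> I \<Longrightarrow> u - v \<in> I"
  using add_mem[of u "- v"] uminus_mem[of v] by simp

lemma sum_mem: "(\<And>x. x \<in> S \<Longrightarrow> u x \<in> I) \<Longrightarrow> sum u S \<in> I"
  by (induction S rule: infinite_finite_induct) (auto intro: zero_mem add_mem)

definition cg :: "'a \<Rightarrow> 'a \<Rightarrow> bool" (infix "\<simeq>" 50)
  where "u \<simeq> v \<longleftrightarrow> u - v \<in> I"

lemma cg_refl [simp, intro]: "u \<simeq> u"
  by (simp add: cg_def zero_mem)

lemma cg_sym: "u \<simeq> v \<Longrightarrow> v \<simeq> u"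
  using uminus_mem[of "u - v"] by (simp add: cg_def)

lemma cg_trans [trans]: "u \<simeq> v \<Longrightarrow> v \<simeq> w \<Longrightarrow> u \<simeq> w"
  using add_mem[of "u - v" "v - w"] by (simp add: cg_def)

lemma cg_eq_trans [trans]: "u \<simeq> v \<Longrightarrow> v = w \<Longrightarrow> u \<simeq> w"
  and eq_cg_trans [trans]: "u = v \<Longrightarrow> v \<simeq> w \<Longrightarrow> u \<simeq> w"
  by auto

lemma cg_add: "u \<simeq> u' \<Longrightarrow> v \<simeq> v' \<Longrightarrow> u + v \<simeq> u' + v'"
  using add_mem[of "u - u'" "v - v'"] by (simp add: cg_def algebra_simps)

lemma cg_diff: "u \<simeq> u' \<Longrightarrow> v \<simeq> v' \<Longrightarrow> u - v \<simeq> u' - v'"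
  using diff_mem[of "u - u'" "v - v'"] by (simp add: cg_def algebra_simps)

lemma cg_mult:
  assumes "u \<simeq> u'" "v \<simeq> v'"
  shows "u * v \<simeq> u' * v'"
proof -
  have "u * v - u' * v' = v * (u - u') + u' * (v - v')"
    by (simp add: algebra_simps)
  then show ?thesis
    using assms by (auto simp: cg_def intro: add_mem mult_mem)
qed

lemma cg_power: "u \<simeq> v \<Longrightarrow> u ^ i \<simeq> v ^ i"
  by (induction i) (auto intro: cg_mult)

lemma cg_sum: "(\<And>x. x \<in> S \<Longrightarrow> u x \<simeq> v x) \<Longrightarrow> sum u S \<simeq> sum v S"
  by (induction S rule: infinite_finite_induct) (auto intro: cg_add)

lemma cg_0_iff: "u \<simeq> 0 \<longleftrightarrow> u \<in> I"
  by (simp add: cg_def)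

lemma cg_mem: "u \<simeq> v \<Longrightarrow> v \<in> I \<Longrightarrow> u \<in> I"
  using add_mem[of "u - v" v] by (simp add: cg_def)

end

section \<open>Frobenius modulo an ideal that contains a prime number\<close>

locale char_ideal = ring_ideal I for I :: "'a::comm_ring_1 set" +
  fixes p :: nat
  assumes p_prime: "prime p" and p_mem: "of_nat p \<in> I"
begin

lemma of_int_mem: "int p dvd c \<Longrightarrow> of_int c \<in> I"
  by (metis dvdE mult_mem' of_int_mult of_int_of_nat_eq p_mem)

lemma of_int_cg: "[c = d] (mod int p) \<Longrightarrow> of_int c \<simeq> of_int d"
  using of_int_mem[of "c - d"] by (simp add: cg_def cong_iff_dvd_diff)

lemma frob_add1: "(u + v) ^ p \<simeq> u ^ p + v ^ p"
proof -
  have p1: "p > 1" using p_prime by (rule prime_gt_1_nat)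
  have split: "{..p} = insert 0 (insert p {1..<p})" using p1 by auto
  have "(u + v) ^ p = (\<Sum>i\<le>p. of_nat (p choose i) * u ^ i * v ^ (p - i))"
    by (rule binomial_ring)
  also have "\<dots> = u ^ p + v ^ p + (\<Sum>i\<in>{1..<p}. of_nat (p choose i) * u ^ i * v ^ (p - i))"
    unfolding split using p1 by simp
  finally have *: "(u + v) ^ p - (u ^ p + v ^ p) = (\<Sum>i\<in>{1..<p}. of_nat (p choose i) * u ^ i * v ^ (p - i))"
    by simp
  have "of_nat (p choose i) * u ^ i * v ^ (p - i) \<in> I" if "i \<in> {1..<p}" for i
  proof -
    have "p dvd (p choose i)" using that p_prime by (intro dvd_choose_prime) auto
    then obtain c where "p choose i = p * c" by (elim dvdE)
    then have "of_nat (p choose i) * u ^ i * v ^ (p - i) = of_nat p * (of_nat c * u ^ i * v ^ (p - i))"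
      by (simp add: mult.assoc)
    then show ?thesis using mult_mem'[OF p_mem] by metis
  qed
  then show ?thesis unfolding cg_def * by (rule sum_mem)
qed

lemma frob_add: "(u + v) ^ p ^ m \<simeq> u ^ p ^ m + v ^ p ^ m"
proof (induction m)
  case (Suc m)
  have "(u + v) ^ p ^ Suc m = ((u + v) ^ p ^ m) ^ p"
    by (simp add: power_mult[symmetric] mult.commute)
  also have "\<dots> \<simeq> (u ^ p ^ m + v ^ p ^ m) ^ p"
    by (intro cg_power Suc.IH)
  also have "\<dots> \<simeq> (u ^ p ^ m) ^ p + (v ^ p ^ m) ^ p"
    by (rule frob_add1)
  also have "\<dots> = u ^ p ^ Suc m + v ^ p ^ Suc m"
    by (simp add: power_mult[symmetric] mult.commute)
  finally show ?case .
qed auto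

lemma frob_sum: "(\<Sum>x\<in>S. u x) ^ p ^ m \<simeq> (\<Sum>x\<in>S. u x ^ p ^ m)"
proof (induction S rule: infinite_finite_induct)
  case (insert x S)
  have "(\<Sum>x\<in>insert x S. u x) ^ p ^ m = (u x + (\<Sum>x\<in>S. u x)) ^ p ^ m"
    using insert by simp
  also have "\<dots> \<simeq> u x ^ p ^ m + (\<Sum>x\<in>S. u x) ^ p ^ m"
    by (rule frob_add)
  also have "\<dots> \<simeq> u x ^ p ^ m + (\<Sum>x\<in>S. u x ^ p ^ m)"
    by (intro cg_add cg_refl insert.IH)
  finally show ?case using insert by simp
qed (use p_prime prime_gt_0_nat[of p] in \<open>auto simp: power_0_left\<close>)

lemma frob_of_nat: "of_nat c ^ p ^ m \<simeq> of_nat c"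
proof (induction c)
  case (Suc c)
  have "of_nat (Suc c) ^ p ^ m = (of_nat c + 1 :: 'a) ^ p ^ m" by (simp add: add.commute)
  also have "\<dots> \<simeq> of_nat c ^ p ^ m + 1 ^ p ^ m" by (rule frob_add)
  also have "\<dots> \<simeq> of_nat c + 1" by (intro cg_add Suc.IH) auto
  finally show ?case by (simp add: add.commute)
qed (use p_prime prime_gt_0_nat[of p] in \<open>auto simp: power_0_left\<close>)

lemma frob_of_int: "of_int c ^ p ^ m \<simeq> of_int c"
proof -
  have "of_int c \<simeq> (of_int (c mod int p) :: 'a)"
    by (intro of_int_cg) auto
  moreover have "of_int (c mod int p) = (of_nat (nat (c mod int p)) :: 'a)"
    using p_prime prime_gt_0_nat[of p] by (simp add: of_nat_nat)
  ultimately have *: "of_int c \<simeq> of_nat (nat (c mod int p))" by metis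
  then have "of_int c ^ p ^ m \<simeq> of_nat (nat (c mod int p)) ^ p ^ m" by (rule cg_power)
  also have "\<dots> \<simeq> of_nat (nat (c mod int p))" by (rule frob_of_nat)
  also have "\<dots> \<simeq> of_int c" using * by (rule cg_sym)
  finally show ?thesis .
qed

text \<open>By Fermat's little theorem Frobenius fixes the integer coefficients and acts on the
  argument alone. At z = x this makes \<open>u ^ p ^ m\<close> the value of u at a conjugate of
  x.\<close>

lemma frob_poly: "poly (map_poly of_int u) z ^ p ^ m \<simeq> poly (map_poly of_int u) (z ^ p ^ m)"
proof -
  have *: "poly (map_poly of_int u) w = (\<Sum>i\<le>degree u. of_int (coeff u i) * w ^ i)" for w :: 'a
  proof -
    have deg: "degree (map_poly of_int u :: 'a poly) \<le> degree u"
      by (rule degree_le) (auto simp: coeff_map_poly coeff_eq_0)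
    have "of_int (coeff u i) = (0 :: 'a)" if "i > degree (map_poly of_int u :: 'a poly)" for i
      using coeff_eq_0[OF that] by (simp add: coeff_map_poly)
    then show ?thesis
      unfolding poly_altdef using deg by (intro sum.mono_neutral_cong_left) (auto simp: coeff_map_poly)
  qed
  have "poly (map_poly of_int u) z ^ p ^ m \<simeq> (\<Sum>i\<le>degree u. (of_int (coeff u i) * z ^ i) ^ p ^ m)"
    unfolding * by (rule frob_sum)
  also have "\<dots> \<simeq> (\<Sum>i\<le>degree u. of_int (coeff u i) * (z ^ p ^ m) ^ i)"
  proof (intro cg_sum)
    fix i
    have "(of_int (coeff u i) * z ^ i) ^ p ^ m = of_int (coeff u i) ^ p ^ m * (z ^ p ^ m) ^ i"
      by (simp add: power_mult_distrib power_mult[symmetric] mult.commute)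
    also have "\<dots> \<simeq> of_int (coeff u i) * (z ^ p ^ m) ^ i"
      by (intro cg_mult frob_of_int cg_refl)
    finally show "(of_int (coeff u i) * z ^ i) ^ p ^ m \<simeq> of_int (coeff u i) * (z ^ p ^ m) ^ i" .
  qed
  also have "\<dots> = poly (map_poly of_int u) (z ^ p ^ m)" unfolding * ..
  finally show ?thesis .
qed

end

locale prime_ring_ideal = ring_ideal I for I :: "'a::comm_ring_1 set" +
  assumes one_nmem: "1 \<notin> I" and prime_mem: "u * v \<in> I \<Longrightarrow> u \<in> I \<or> v \<in> I"
begin

lemma power_mem: "u ^ m \<in> I \<Longrightarrow> u \<in> I"
  by (induction m) (use one_nmem prime_mem in auto)

lemma prod_mem: "finite S \<Longrightarrow> prod u S \<in> I \<Longrightarrow> \<exists>x\<in>S. u x \<in> I"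
  by (induction S rule: finite_induct) (use one_nmem prime_mem in auto)

text \<open>The quotient by a prime ideal is a domain, so roots that differ modulo \<open>I\<close>
  can be split off one after the other. The case \<open>u = 0\<close> is listed separately because
  the zero polynomial has degree 0 and the empty set of roots must still force it.\<close>

lemma poly_many_roots:
  assumes "finite Z" "\<And>z. z \<in> Z \<Longrightarrow> poly u z \<in> I"
    and "\<And>z z'. z \<in> Z \<Longrightarrow> z' \<in> Z \<Longrightarrow> z \<noteq> z' \<Longrightarrow> z - z' \<notin> I"
    and "u = 0 \<or> degree u < card Z"
  shows "coeff u i \<in> I"
  using assms
proof (induction Z arbitrary: u i rule: finite_induct)
  case empty
  then show ?case by (auto simp: zero_mem)
next
  case (insert z Z)
  define q where "q = synthetic_div u z"
  have u: "u = [:- z, 1:] * q + [:poly u z:]"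
    unfolding q_def by (simp only: synthetic_div_correct')
  have "poly q w \<in> I" if "w \<in> Z" for w
  proof -
    have "poly u w = (w - z) * poly q w + poly u z"
      by (subst u) (simp add: algebra_simps)
    then have "(w - z) * poly q w = poly u w - poly u z" by simp
    also have "\<dots> \<in> I" using insert.prems that by (intro diff_mem) auto
    finally show ?thesis
      using prime_mem insert.prems(2)[of w z] insert.hyps that by blast
  qed
  moreover have "q = 0 \<or> degree q < card Z"
  proof (cases "degree u = 0")
    case True
    then show ?thesis by (simp add: q_def synthetic_div_eq_0_iff)
  next
    case False
    then show ?thesis using insert.prems(3) insert.hyps by (auto simp: q_def degree_synthetic_div)
  qed
  ultimately have q: "coeff q j \<in> I" for j
    using insert.prems(2) by (intro insert.IH) auto
  have "coeff u i = coeff ([:- z, 1:] * q + [:poly u z:]) i"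
    using u by simp
  also have "\<dots> = - z * coeff q i + coeff (pCons 0 q) i + coeff [:poly u z:] i"
    by (simp add: coeff_pCons split: nat.splits)
  also have "\<dots> \<in> I"
    using q insert.prems(1)[of z]
    by (intro add_mem mult_mem) (auto simp: coeff_pCons zero_mem split: nat.splits)
  finally show ?case .
qed

end

subsection \<open>Integer polynomials modulo a prime\<close>

text \<open>Polynomials over \<open>\<int>/p\<close> are represented by integer polynomials, and \<open>u \<in> pid p g\<close> says that
  \<open>g\<close> divides \<open>u\<close> modulo \<open>p\<close>.\<close>

definition pid :: "nat \<Rightarrow> 'a::comm_ring_1 \<Rightarrow> 'a set"
  where "pid p g = {of_nat p * a + g * b | a b. True}"

lemma pidI: "u = of_nat p * a + g * b \<Longrightarrow> u \<in> pid p g"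
  by (auto simp: pid_def)

lemma pidE:
  assumes "u \<in> pid p g"
  obtains a b where "u = of_nat p * a + g * b"
  using assms by (auto simp: pid_def)

lemma ring_ideal_pid: "ring_ideal (pid p g)"
proof
  show "0 \<in> pid p g" by (rule pidI[of _ _ 0 _ 0]) simp
next
  fix u v assume "u \<in> pid p g" "v \<in> pid p g"
  then obtain a b a' b' where "u = of_nat p * a + g * b" "v = of_nat p * a' + g * b'"
    by (auto elim!: pidE)
  then show "u + v \<in> pid p g"
    by (intro pidI[of _ _ "a + a'" _ "b + b'"]) (simp add: algebra_simps)
next
  fix u w assume "u \<in> pid p g"
  then obtain a b where "u = of_nat p * a + g * b" by (elim pidE)
  then show "w * u \<in> pid p g"
    by (intro pidI[of _ _ "w * a" _ "w * b"]) (simp add: algebra_simps)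
qed

interpretation pid: ring_ideal "pid p g" for p :: nat and g :: "'a::comm_ring_1"
  by (rule ring_ideal_pid)

lemma p_mem_pid [simp, intro]: "of_nat p \<in> pid p g"
  by (rule pidI[of _ _ 1 _ 0]) simp

lemma g_mem_pid [simp, intro]: "g \<in> pid p g"
  by (rule pidI[of _ _ 0 _ 1]) simp

lemma char_ideal_pid: "prime p \<Longrightarrow> char_ideal (pid p g) p"
  by unfold_locales auto

lemma pid_trans: "h \<in> pid p g \<Longrightarrow> u \<in> pid p h \<Longrightarrow> u \<in> pid p g"
  by (metis pidE pid.add_mem pid.mult_mem' p_mem_pid)

definition dz :: "nat \<Rightarrow> int poly \<Rightarrow> bool"
  where "dz p u \<longleftrightarrow> (\<forall>i. int p dvd coeff u i)"

lemma dz_iff: "dz p u \<longleftrightarrow> of_nat p dvd u"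
  by (simp add: dz_def of_nat_poly const_poly_dvd_iff)

lemma dz_mem_pid: "dz p u \<Longrightarrow> u \<in> pid p g"
  by (auto simp: dz_iff intro!: pid.mult_mem' elim!: dvdE)

lemma dz_add: "dz p u \<Longrightarrow> dz p v \<Longrightarrow> dz p (u + v)"
  and dz_diff: "dz p u \<Longrightarrow> dz p v \<Longrightarrow> dz p (u - v)"
  and dz_mult: "dz p u \<Longrightarrow> dz p (w * u)"
  and dz_mult': "dz p u \<Longrightarrow> dz p (u * w)"
  by (auto simp: dz_iff)

lemma dz_prime:
  assumes "prime p" "dz p (u * v)"
  shows "dz p u \<or> dz p v"
proof -
  have "prime_elem [:int p:]"
    using assms(1) by (subst prime_elem_const_poly_iff) auto
  then show ?thesis
    using assms(2) by (simp add: dz_iff of_nat_poly prime_elem_dvd_mult_iff)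
qed

lemma not_dz_monic: "prime p \<Longrightarrow> lead_coeff g = 1 \<Longrightarrow> \<not> dz p g"
  unfolding dz_def using not_prime_unit[of "int p"] by (metis prime_nat_int_transfer)

definition red :: "nat \<Rightarrow> int poly \<Rightarrow> int poly"
  where "red p u = map_poly (\<lambda>c. c mod int p) u"

lemma coeff_red [simp]: "coeff (red p u) i = coeff u i mod int p"
  by (simp add: red_def coeff_map_poly)

lemma dz_red: "dz p (u - red p u)" "dz p (red p u - u)"
  by (auto simp: dz_def mod_eq_dvd_iff[symmetric])

lemma red_eq_iff: "red p u = red p v \<longleftrightarrow> dz p (u - v)"
  by (auto simp: poly_eq_iff dz_def mod_eq_dvd_iff)

lemma degree_red_le: "degree (red p u) \<le> degree u"
  by (intro degree_le) (auto simp: coeff_eq_0)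

lemma red_mem_pid: "u \<in> pid p g \<longleftrightarrow> red p u \<in> pid p g"
  using dz_mem_pid[OF dz_red(1)[of p u]] dz_mem_pid[OF dz_red(2)[of p u]]
  by (metis pid.add_mem diff_add_cancel)

lemma monic_divmod:
  fixes g u :: "'a::idom poly"
  assumes "lead_coeff g = 1"
  shows "\<exists>q r. u = g * q + r \<and> (r = 0 \<or> degree r < degree g)"
proof -
  obtain q r where "pseudo_divmod u g = (q, r)" by force
  from pseudo_divmod[OF _ this] assms show ?thesis by force
qed

text \<open>Uniqueness of the remainder modulo p: once the cofactor has reduced coefficients, p
  cannot divide its leading one, and the monic \<open>g\<close> passes this coefficient on to a
  degree in which \<open>u\<close> has none.\<close>

lemma pid_small:
  assumes p: "prime p" and g: "lead_coeff g = 1" and u: "u \<in> pid p g" "u = 0 \<or> degree u < degree g"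
  shows "dz p u"
proof -
  obtain a b where ab: "u = of_nat p * a + g * b" using u by (elim pidE)
  define b' where "b' = red p b"
  have "dz p (of_nat p * a + g * (b - b'))"
    unfolding b'_def by (rule dz_add[OF _ dz_mult[OF dz_red(1)]]) (simp add: dz_iff)
  then have *: "dz p (u - g * b')" by (simp add: ab algebra_simps)
  have "b' = 0"
  proof (rule ccontr)
    assume "b' \<noteq> 0"
    define m where "m = degree g + degree b'"
    have "coeff (g * b') m = lead_coeff b'"
      unfolding m_def using g by (simp add: coeff_mult_degree_sum)
    moreover have "coeff u m = 0" using u(2) by (auto simp: m_def coeff_eq_0)
    ultimately have "int p dvd lead_coeff b'"
      using * unfolding dz_def by (metis coeff_diff diff_0 dvd_minus_iff)
    moreover have "lead_coeff b' = lead_coeff b' mod int p" by (simp add: b'_def)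
    ultimately show False using \<open>b' \<noteq> 0\<close> by (metis dvd_imp_mod_0 leading_coeff_0_iff)
  qed
  then show ?thesis using * by simp
qed

section \<open>Monic and irreducible polynomials over F_p\<close>

definition mon :: "nat \<Rightarrow> nat \<Rightarrow> int poly set"
  where "mon p d = {h. degree h = d \<and> lead_coeff h = 1 \<and> (\<forall>i. coeff h i \<in> {0..<int p})}"

lemma monD:
  assumes "h \<in> mon p d"
  shows "degree h = d" "lead_coeff h = 1" "coeff h d = 1" "0 \<le> coeff h i" "coeff h i < int p" "red p h = h"
proof -
  show "degree h = d" "lead_coeff h = 1" using assms by (auto simp: mon_def)
  then show "coeff h d = 1" by simp
  have *: "0 \<le> coeff h i \<and> coeff h i < int p" for i using assms by (auto simp: mon_def)
  show "0 \<le> coeff h i" "coeff h i < int p" using * by auto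
  show "red p h = h" using * by (auto simp: poly_eq_iff)
qed

lemma mon_eqI: "g \<in> mon p a \<Longrightarrow> h \<in> mon p b \<Longrightarrow> dz p (g - h) \<Longrightarrow> g = h"
  by (metis monD(6) red_eq_iff)

lemma red_mon:
  assumes "prime p" "lead_coeff h = 1"
  shows "red p h \<in> mon p (degree h)"
proof -
  have "int p > 1" using assms prime_gt_1_nat by auto
  then have "coeff (red p h) (degree h) = 1" using assms by simp
  then have "degree (red p h) = degree h"
    using degree_red_le[of p h] le_degree[of "red p h" "degree h"] by auto
  then show ?thesis using assms \<open>int p > 1\<close> by (auto simp: mon_def)
qed

lemma mon_0: "prime p \<Longrightarrow> mon p 0 = {1}"
  using prime_gt_1_nat[of p] by (auto simp: mon_def elim!: degree_eq_zeroE split: nat.splits)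

lemma mon_mult:
  assumes "prime p" "g \<in> mon p a" "h \<in> mon p b"
  shows "red p (g * h) \<in> mon p (a + b)"
proof -
  have "lead_coeff (g * h) = 1" using monD[OF assms(2)] monD[OF assms(3)] by (simp add: lead_coeff_mult)
  moreover have "degree (g * h) = a + b"
    using monD[OF assms(2)] monD[OF assms(3)] by (subst degree_mult_eq) auto
  ultimately show ?thesis using red_mon[OF assms(1), of "g * h"] by simp
qed

lemma bij_betw_mon_mult:
  assumes p: "prime p" and g: "g \<in> mon p a" and "a \<le> d"
  shows "bij_betw (\<lambda>h. red p (g * h)) (mon p (d - a)) {h \<in> mon p d. h \<in> pid p g}"
proof (rule bij_betwI')
  fix x y assume xy: "x \<in> mon p (d - a)" "y \<in> mon p (d - a)"
  show "(red p (g * x) = red p (g * y)) = (x = y)"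
  proof
    assume "red p (g * x) = red p (g * y)"
    then have "dz p (g * (x - y))" by (simp add: red_eq_iff algebra_simps)
    then have "dz p (x - y)"
      using dz_prime[OF p] not_dz_monic[OF p] monD(2)[OF g] by blast
    then show "x = y" using xy mon_eqI by blast
  qed auto
next
  fix x assume x: "x \<in> mon p (d - a)"
  show "red p (g * x) \<in> {h \<in> mon p d. h \<in> pid p g}"
    using mon_mult[OF p g x] \<open>a \<le> d\<close> by (auto simp flip: red_mem_pid intro: pid.mult_mem')
next
  fix h assume "h \<in> {h \<in> mon p d. h \<in> pid p g}"
  then have h: "h \<in> mon p d" "h \<in> pid p g" by auto
  obtain q r where qr: "h = g * q + r" "r = 0 \<or> degree r < degree g"
    using monic_divmod monD(2)[OF g] by blast
  have "r = h - g * q" using qr by simp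
  then have "r \<in> pid p g" using h by (auto intro!: pid.diff_mem pid.mult_mem')
  then have r: "dz p r" using pid_small[OF p] monD(2)[OF g] qr(2) by blast
  have "r = 0 \<or> degree r < a" using qr(2) monD(1)[OF g] by simp
  then have "coeff h d = coeff (g * q) d" using \<open>a \<le> d\<close> by (auto simp: qr(1) coeff_eq_0)
  have "degree (g * q) = d"
  proof -
    have "degree (g * q) \<le> max (degree h) (degree r)"
      using degree_diff_le_max[of h r] qr(1) by simp
    moreover have "degree (g * q) \<ge> d"
      using \<open>coeff h d = coeff (g * q) d\<close> monD[OF h(1)] by (intro le_degree) auto
    ultimately show ?thesis
      using \<open>r = 0 \<or> degree r < a\<close> \<open>a \<le> d\<close> monD(1)[OF h(1)] by auto
  qed
  then have lc: "lead_coeff (g * q) = 1" using \<open>coeff h d = coeff (g * q) d\<close> monD[OF h(1)] by simp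
  then have "lead_coeff q = 1" using monD[OF g] by (simp add: lead_coeff_mult)
  moreover have "degree q = d - a"
    using \<open>degree (g * q) = d\<close> lc monD(1)[OF g] by (subst (asm) degree_mult_eq) auto
  ultimately have q: "red p q \<in> mon p (d - a)" using red_mon[OF p] by metis
  have "red p (g * red p q) = red p h"
    unfolding red_eq_iff qr(1) using dz_diff[OF dz_mult[OF dz_red(2)[of p q], of g] r]
    by (simp add: algebra_simps)
  then show "\<exists>x\<in>mon p (d - a). h = red p (g * x)"
    using q monD(6)[OF h(1)] by metis
qed

text \<open>Irreducibility is encoded as primality of the ideal (p, P), the form in which it is
  applied; the existence of enough such P is \<open>ex_irr_factor\<close>.\<close>

definition irr :: "nat \<Rightarrow> int poly set"
  where "irr p = {P. (\<exists>d\<ge>1. P \<in> mon p d) \<and> prime_ring_ideal (pid p P)}"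

text \<open>A leading coefficient that p does not divide is invertible modulo p, and reduction
  modulo p stays inside \<open>J\<close>.\<close>

lemma ex_monic_in_ideal:
  assumes p: "prime p" and J: "ring_ideal J" "of_nat p \<in> J" and r: "r \<in> J" "\<not> dz p r"
  shows "\<exists>d \<le> degree r. \<exists>g. g \<in> mon p d \<and> g \<in> J"
proof -
  interpret J: ring_ideal J by fact
  have dzJ: "u \<in> J" if "dz p u" for u
    using that J(2) by (auto simp: dz_iff elim!: dvdE intro: J.mult_mem')
  define b where "b = red p r"
  have b: "b \<in> J"
    using J.add_mem[OF dzJ[OF dz_red(2)[of p r]] r(1)] by (simp add: b_def)
  have b0: "b \<noteq> 0" using r(2) red_eq_iff[of p r 0] by (auto simp: b_def red_def)
  define c where "c = lead_coeff b"
  have "c = c mod int p" by (simp add: c_def b_def)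
  moreover have "c \<noteq> 0" using b0 by (simp add: c_def)
  ultimately have "\<not> int p dvd c" by (metis dvd_imp_mod_0)
  then have "coprime c (int p)"
    using p by (metis prime_imp_coprime prime_nat_int_transfer coprime_commute)
  then obtain c' where c': "[c * c' = 1] (mod int p)"
    using cong_solve_coprime_int by blast
  define w where "w = red p (smult c' b)"
  have p1: "int p > 1" using p prime_gt_1_nat by auto
  have "coeff w (degree b) = (c * c') mod int p" by (simp add: w_def c_def mult.commute)
  also have "\<dots> = 1 mod int p" using c' by (simp only: Cong.cong_def)
  also have "\<dots> = 1" using p1 by (intro mod_pos_pos_trivial) auto
  finally have w1: "coeff w (degree b) = 1" .
  have "degree w \<le> degree b" unfolding w_def using degree_red_le[of p "smult c' b"] by (simp add: le_trans[OF _ degree_smult_le])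
  then have "degree w = degree b" using w1 le_degree[of w "degree b"] by auto
  then have "w \<in> mon p (degree b)" using w1 p1 by (auto simp: mon_def w_def)
  moreover have "smult c' b \<in> J" using J.mult_mem[OF b, of "[:c':]"] by simp
  then have "w \<in> J"
    using J.add_mem[OF dzJ[OF dz_red(2)[of p "smult c' b"]], of "smult c' b"] by (simp add: w_def)
  moreover have "degree b \<le> degree r" by (simp add: b_def degree_red_le)
  ultimately show ?thesis by blast
qed

text \<open>A divisor P of h of least positive degree works. If u is not in (p, P), let
  \<open>g\<close> be a monic member of least degree of J = (p, P, u). It divides P and hence h, so
  by minimality it is 1 or P. The second case would put u into (p, P); the first gives a Bezout
  relation, which puts v there.\<close>

lemma ex_irr_factor:
  assumes p: "prime p" and h: "h \<in> mon p d" and d: "d \<ge> 1"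
  shows "\<exists>P\<in>irr p. h \<in> pid p P"
proof -
  define Q where "Q = (\<lambda>e. e \<ge> 1 \<and> (\<exists>g\<in>mon p e. h \<in> pid p g))"
  have "Q d" unfolding Q_def using h d by auto
  then have Qe: "Q (LEAST e. Q e)" by (rule LeastI)
  define e where "e = (LEAST e. Q e)"
  have e1: "e \<ge> 1" using Qe by (simp add: Q_def e_def)
  obtain P where P: "P \<in> mon p e" "h \<in> pid p P" using Qe by (auto simp: Q_def e_def)
  note P' = monD[OF P(1)]
  have "prime_ring_ideal (pid p P)"
  proof
    show "1 \<notin> pid p P"
      using pid_small[OF p P'(2), of 1] not_dz_monic[OF p, of 1] P'(1) e1 by auto
  next
    fix u v assume uv: "u * v \<in> pid p P"
    have "v \<in> pid p P" if u: "u \<notin> pid p P"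
    proof -
      define J where "J = {w + u * c | w c. w \<in> pid p P}"
      have J: "ring_ideal J"
      proof
        show "0 \<in> J" unfolding J_def using pid.zero_mem[of p P] by force
      next
        fix x y assume "x \<in> J" "y \<in> J"
        then obtain w c w' c' where "x = w + u * c" "y = w' + u * c'" "w \<in> pid p P" "w' \<in> pid p P"
          by (auto simp: J_def)
        then have "x + y = (w + w') + u * (c + c')" "w + w' \<in> pid p P"
          by (auto simp: algebra_simps pid.add_mem)
        then show "x + y \<in> J" unfolding J_def by blast
      next
        fix x y assume "x \<in> J"
        then obtain w c where "x = w + u * c" "w \<in> pid p P" by (auto simp: J_def)
        then have "y * x = y * w + u * (y * c)" "y * w \<in> pid p P"
          by (auto simp: algebra_simps pid.mult_mem pid.mult_mem')
        then show "y * x \<in> J" unfolding J_def by blast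
      qed
      interpret J: ring_ideal J by fact
      have PJ: "w \<in> J" if "w \<in> pid p P" for w
        using that unfolding J_def by (intro CollectI exI[of _ w] exI[of _ 0]) auto
      have uJ: "u \<in> J"
        unfolding J_def using pid.zero_mem[of p P] by (intro CollectI exI[of _ 0] exI[of _ 1]) auto
      define R where "R = (\<lambda>e. \<exists>g. g \<in> mon p e \<and> g \<in> J)"
      have "R e" unfolding R_def using P(1) PJ by auto
      define f where "f = (LEAST e. R e)"
      have "R f" unfolding f_def using \<open>R e\<close> by (rule LeastI)
      then obtain g where g: "g \<in> mon p f" "g \<in> J" by (auto simp: R_def)
      have Jg: "w \<in> pid p g" if w: "w \<in> J" for w
      proof -
        obtain q r where qr: "w = g * q + r" "r = 0 \<or> degree r < degree g"
          using monic_divmod monD(2)[OF g(1)] by blast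
        have "r = w - g * q" using qr by simp
        then have rJ: "r \<in> J" using w g by (auto intro!: J.diff_mem J.mult_mem')
        have "dz p r"
        proof (rule ccontr)
          assume ndz: "\<not> dz p r"
          from ex_monic_in_ideal[OF p J PJ[OF p_mem_pid] rJ ndz] obtain d' where "d' \<le> degree r" "R d'"
            by (auto simp: R_def)
          moreover have "degree r < f" using qr(2) ndz monD(1)[OF g(1)] by (auto simp: dz_def)
          ultimately show False using Least_le[of R d'] by (simp add: f_def)
        qed
        then show ?thesis unfolding qr(1) by (intro pid.add_mem pid.mult_mem' dz_mem_pid g_mem_pid)
      qed
      have Pg: "P \<in> pid p g" using Jg PJ by auto
      then have hg: "h \<in> pid p g" using P(2) pid_trans by blast
      have "f \<le> e" unfolding f_def using \<open>R e\<close> by (rule Least_le)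
      show "v \<in> pid p P"
      proof (cases "f = 0")
        case True
        then have "g = 1" using g(1) mon_0[OF p] by auto
        then have "1 \<in> J" using g(2) by simp
        then obtain w c where "1 = w + u * c" "w \<in> pid p P" by (auto simp: J_def)
        then have "v = w * v + (u * v) * c" by (metis mult.commute mult.left_commute distrib_left mult_1_right)
        then show ?thesis using uv \<open>w \<in> pid p P\<close> by (metis pid.add_mem pid.mult_mem')
      next
        case False
        then have "Q f" unfolding Q_def using g(1) hg by auto
        then have "e \<le> f" unfolding e_def by (rule Least_le)
        then have "e = f" using \<open>f \<le> e\<close> by simp
        have "P - g = 0 \<or> degree (P - g) < degree g"
        proof (cases "P - g = 0")
          case False
          have "coeff (P - g) f = 0" using monD(3)[OF g(1)] P'(3) \<open>e = f\<close> by simp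
          moreover have "degree (P - g) \<le> f"
            using degree_diff_le_max[of P g] monD(1)[OF g(1)] P'(1) \<open>e = f\<close> by simp
          ultimately show ?thesis
            using False monD(1)[OF g(1)] by (metis leading_coeff_0_iff le_neq_implies_less)
        qed auto
        moreover have "P - g \<in> pid p g" using Pg by (auto intro: pid.diff_mem)
        ultimately have "dz p (P - g)" using pid_small[OF p monD(2)[OF g(1)]] by blast
        then have "P = g" using mon_eqI P(1) g(1) by blast
        then show ?thesis using u uJ Jg by blast
      qed
    qed
    then show "u \<in> pid p P \<or> v \<in> pid p P" by blast
  qed
  then show ?thesis using P e1 by (auto simp: irr_def)
qed

lemma finite_mon: "finite (mon p d)"
proof -
  have "mon p d \<subseteq> (\<lambda>c. \<Sum>i\<le>d. monom (c i) i) ` ({..d} \<rightarrow>\<^sub>E {0..<int p})"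
  proof
    fix h assume h: "h \<in> mon p d"
    have "h = (\<Sum>i\<le>d. monom (restrict (coeff h) {..d} i) i)"
      using poly_as_sum_of_monoms[of h] monD(1)[OF h] by simp
    moreover have "restrict (coeff h) {..d} \<in> {..d} \<rightarrow>\<^sub>E {0..<int p}"
      using monD(4,5)[OF h] by auto
    ultimately show "h \<in> (\<lambda>c. \<Sum>i\<le>d. monom (c i) i) ` ({..d} \<rightarrow>\<^sub>E {0..<int p})" by blast
  qed
  then show ?thesis by (rule finite_subset) (auto intro: finite_PiE)
qed

lemma irrD:
  assumes "P \<in> irr p"
  shows "P \<in> mon p (degree P)" "degree P \<ge> 1" "lead_coeff P = 1" "prime_ring_ideal (pid p P)"
  using assms by (auto simp: irr_def dest: monD)

lemma finite_irr_le: "finite {P \<in> irr p. degree P \<le> D}"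
  by (rule finite_subset[of _ "\<Union>d\<le>D. mon p d"]) (auto intro: finite_mon irrD)

lemma lead_coeff_power_1: "lead_coeff (g :: int poly) = 1 \<Longrightarrow> lead_coeff (g ^ j) = 1"
  by (simp add: lead_coeff_power)

lemma monic_mem_pid_degree:
  fixes g h :: "int poly"
  assumes "prime p" "lead_coeff g = 1" "lead_coeff h = 1" "h \<in> pid p g"
  shows "degree g \<le> degree h"
  using pid_small[OF assms(1,2,4)] not_dz_monic[OF assms(1,3)] by force

lemma mon_factor:
  assumes "prime p" "g \<in> mon p a" "h \<in> mon p d" "h \<in> pid p g" "a \<le> d"
  obtains q where "q \<in> mon p (d - a)" "h = red p (g * q)"
proof -
  have "h \<in> (\<lambda>q. red p (g * q)) ` mon p (d - a)"
    using bij_betw_mon_mult[OF assms(1,2,5)] assms(3,4) by (auto simp: bij_betw_def)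
  then show ?thesis using that by blast
qed

lemma irr_mem_pid_irr:
  assumes p: "prime p" and P: "P \<in> irr p" and P0: "P0 \<in> irr p" and "P0 \<in> pid p P"
  shows "P0 = P"
proof -
  note P' = irrD[OF P] and P0' = irrD[OF P0]
  interpret P0: prime_ring_ideal "pid p P0" by (rule P0'(4))
  have le: "degree P \<le> degree P0" by (rule monic_mem_pid_degree) fact+
  obtain q where q: "q \<in> mon p (degree P0 - degree P)" "P0 = red p (P * q)"
    using mon_factor[OF p P'(1) P0'(1) assms(4) le] .
  have "P * q \<in> pid p P0"
    using q(2) g_mem_pid[of P0 p] red_mem_pid by metis
  then consider "P \<in> pid p P0" | "q \<in> pid p P0" using P0.prime_mem by blast
  then show ?thesis
  proof cases
    case 1
    have "degree P0 \<le> degree P"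
      by (rule monic_mem_pid_degree[OF p P0'(3) P'(3) 1])
    then have "q = 1" using q(1) le mon_0[OF p] by simp
    then show ?thesis using q(2) monD(6)[OF P'(1)] by simp
  next
    case 2
    have "degree P0 \<le> degree q"
      by (rule monic_mem_pid_degree[OF p P0'(3) monD(2)[OF q(1)] 2])
    then show ?thesis using monD(1)[OF q(1)] P'(2) le by auto
  qed
qed

lemma pid_cancel:
  fixes a u g :: "int poly"
  assumes p: "prime p" and a: "lead_coeff a = 1" and "a * u \<in> pid p (a * g)"
  shows "u \<in> pid p g"
proof -
  obtain w b where *: "a * u = of_nat p * w + a * g * b" using assms(3) by (elim pidE)
  then have "a * (u - g * b) = of_nat p * w" by (simp add: algebra_simps)
  then have "dz p (a * (u - g * b))" by (simp add: dz_iff)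
  then have "dz p (u - g * b)" using dz_prime[OF p] not_dz_monic[OF p a] by blast
  then obtain c where "u - g * b = of_nat p * c" by (auto simp: dz_iff elim: dvdE)
  then show ?thesis by (intro pidI[of _ _ c _ b]) (simp add: algebra_simps)
qed

text \<open>Euclid's lemma for prime powers: \<open>u\<close> loses one factor P at a time, and
  \<open>pid_cancel\<close> removes it from both sides.\<close>

lemma pid_mult_cancel_irr:
  assumes p: "prime p" and P: "P \<in> irr p" and a: "a \<notin> pid p P" and "a * u \<in> pid p (P ^ j)"
  shows "u \<in> pid p (P ^ j)"
  using assms(4)
proof (induction j arbitrary: u)
  case 0
  then show ?case using pid.mult_mem[OF g_mem_pid[of 1 p], of u] by simp
next
  case (Suc j)
  interpret P: prime_ring_ideal "pid p P" using irrD[OF P] by simp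
  have sub: "w \<in> pid p P" if "w \<in> pid p (P ^ Suc j)" for w
    by (rule pid_trans[OF _ that]) (simp add: pid.mult_mem')
  have "u \<in> pid p P" using P.prime_mem[OF sub[OF Suc.prems]] a by blast
  then obtain c d where u: "u = of_nat p * c + P * d" by (elim pidE)
  have "a * (P * d) = a * u - of_nat p * (a * c)" by (simp add: u algebra_simps)
  also have "\<dots> \<in> pid p (P ^ Suc j)" by (rule pid.diff_mem[OF Suc.prems pid.mult_mem'[OF p_mem_pid]])
  finally have "P * (a * d) \<in> pid p (P * P ^ j)" by (simp add: mult_ac)
  then have "a * d \<in> pid p (P ^ j)" using pid_cancel[OF p irrD(3)[OF P]] by blast
  then have "d \<in> pid p (P ^ j)" by (rule Suc.IH)
  then obtain c' d' where d: "d = of_nat p * c' + P ^ j * d'" by (elim pidE)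
  show ?case unfolding u d
    by (rule pidI[of _ _ "c + P * c'" _ d']) (simp add: algebra_simps)
qed

text \<open>The multiplicity of P in h modulo p. Counting the powers that divide h lets a sum over
  multiplicities unfold into a double sum over P and j.\<close>

definition vl :: "nat \<Rightarrow> int poly \<Rightarrow> int poly \<Rightarrow> nat"
  where "vl p P h = card {j. j \<ge> 1 \<and> h \<in> pid p (P ^ j)}"

lemma vl_subset:
  assumes p: "prime p" and P: "P \<in> irr p" and h: "h \<in> mon p d"
  shows "{j. j \<ge> 1 \<and> h \<in> pid p (P ^ j)} \<subseteq> {1..d}"
proof safe
  fix j :: nat assume j: "j \<ge> 1" "h \<in> pid p (P ^ j)"
  have "degree (P ^ j) \<le> d"
    using monic_mem_pid_degree[OF p lead_coeff_power_1[OF irrD(3)[OF P]] _ j(2)] monD[OF h] by auto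
  moreover have "degree (P ^ j) = j * degree P"
    using irrD(3)[OF P] by (subst degree_power_eq) auto
  moreover have "j \<le> j * degree P" using irrD(2)[OF P] by simp
  ultimately show "j \<in> {1..d}" using j(1) by (metis atLeastAtMost_iff le_trans)
qed

lemma vl_mult:
  assumes p: "prime p" and P: "P \<in> irr p" and P0: "P0 \<in> irr p" and g: "g \<in> mon p b"
  shows "vl p P (red p (P0 * g)) = vl p P g + (if P = P0 then 1 else 0)"
proof (cases "P = P0")
  case False
  have "P0 \<notin> pid p P" using irr_mem_pid_irr[OF p P P0] False by blast
  then have "{j. j \<ge> 1 \<and> red p (P0 * g) \<in> pid p (P ^ j)} = {j. j \<ge> 1 \<and> g \<in> pid p (P ^ j)}"
    using pid_mult_cancel_irr[OF p P] by (auto simp flip: red_mem_pid intro: pid.mult_mem)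
  then show ?thesis using False by (simp add: vl_def)
next
  case True
  let ?A = "{j. j \<ge> 1 \<and> g \<in> pid p (P ^ j)}"
  have "finite ?A" using vl_subset[OF p P g] by (rule finite_subset) auto
  \<comment> \<open>P^(i+1) divides P g exactly when P^i divides g, and the exponent 1 comes for
    free.\<close>
  have "{j. j \<ge> 1 \<and> red p (P0 * g) \<in> pid p (P ^ j)} = insert 1 (Suc ` ?A)"
  proof (rule Set.set_eqI)
    fix j
    show "j \<in> {j. j \<ge> 1 \<and> red p (P0 * g) \<in> pid p (P ^ j)} \<longleftrightarrow> j \<in> insert 1 (Suc ` ?A)"
    proof (cases j)
      case (Suc i)
      have eq: "P * g \<in> pid p (P * P ^ i) \<longleftrightarrow> g \<in> pid p (P ^ i)"
      proof
        assume "g \<in> pid p (P ^ i)"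
        then obtain a b where "g = of_nat p * a + P ^ i * b" by (elim pidE)
        then show "P * g \<in> pid p (P * P ^ i)"
          by (intro pidI[of _ _ "P * a" _ b]) (simp add: algebra_simps)
      qed (use pid_cancel[OF p irrD(3)[OF P]] in blast)
      show ?thesis
      proof (cases "i = 0")
        case True
        then show ?thesis using Suc \<open>P = P0\<close> by (auto simp flip: red_mem_pid intro: pid.mult_mem')
      next
        case False
        then show ?thesis using Suc \<open>P = P0\<close> eq by (auto simp flip: red_mem_pid)
      qed
    qed auto
  qed
  moreover have "1 \<notin> Suc ` ?A" by auto
  ultimately show ?thesis using True \<open>finite ?A\<close> by (simp add: vl_def card_image)
qed

text \<open>The degree count of unique factorisation, by splitting off one irreducible factor. The
  separate bound \<open>D\<close> keeps the index set fixed during the induction.\<close>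

lemma sum_vl:
  assumes p: "prime p" and "h \<in> mon p d" "d \<le> D"
  shows "(\<Sum>P\<in>{P\<in>irr p. degree P \<le> D}. degree P * vl p P h) = d"
  using assms(2,3)
proof (induction d arbitrary: h rule: less_induct)
  case (less d)
  show ?case
  proof (cases "d = 0")
    case True
    have "vl p P h = 0" if "P \<in> irr p" for P
    proof -
      have "{j. j \<ge> 1 \<and> h \<in> pid p (P ^ j)} = {}"
        using vl_subset[OF p that less.prems(1)] True by auto
      then show ?thesis by (simp only: vl_def card.empty)
    qed
    then show ?thesis using True by simp
  next
    case False
    then obtain P0 where P0: "P0 \<in> irr p" "h \<in> pid p P0"
      using ex_irr_factor[OF p less.prems(1)] by auto
    note P0' = irrD[OF P0(1)]
    have le: "degree P0 \<le> d"
      using monic_mem_pid_degree[OF p P0'(3) monD(2)[OF less.prems(1)] P0(2)] monD(1)[OF less.prems(1)] by simp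
    obtain g where g: "g \<in> mon p (d - degree P0)" "h = red p (P0 * g)"
      using mon_factor[OF p P0'(1) less.prems(1) P0(2) le] .
    have "(\<Sum>P\<in>{P\<in>irr p. degree P \<le> D}. degree P * vl p P h) =
          (\<Sum>P\<in>{P\<in>irr p. degree P \<le> D}. degree P * vl p P g + (if P = P0 then degree P else 0))"
      using vl_mult[OF p _ P0(1) g(1)] by (intro sum.cong) (auto simp: g(2) algebra_simps)
    also have "\<dots> = (d - degree P0) + degree P0"
      using less.IH[OF _ g(1)] P0'(2) False less.prems(2) le P0(1)
      by (simp add: sum.distrib sum.delta[OF finite_irr_le] del: sum.delta)
    finally show ?thesis using le by simp
  qed
qed

text \<open>The coefficients of the L-function of \<open>\<xi>\<close> and, up to sign, the power sums of its inverse zeros.\<close>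

definition Lcoeff :: "nat \<Rightarrow> (int poly \<Rightarrow> complex) \<Rightarrow> nat \<Rightarrow> complex"
  where "Lcoeff p \<xi> d = (\<Sum>h\<in>mon p d. \<xi> h)"

definition Spow :: "nat \<Rightarrow> (int poly \<Rightarrow> complex) \<Rightarrow> nat \<Rightarrow> complex"
  where "Spow p \<xi> \<nu> = (\<Sum>P\<in>{P\<in>irr p. degree P dvd \<nu>}. of_nat (degree P) * \<xi> P ^ (\<nu> div degree P))"

lemma finite_irr_dvd: "\<nu> > 0 \<Longrightarrow> finite {P\<in>irr p. degree P dvd \<nu>}"
  by (rule finite_subset[OF _ finite_irr_le[of p \<nu>]]) (auto dest: dvd_imp_le)

text \<open>The logarithmic derivative of the Euler product, T L'(T) = L(T) * (sum of S_\<nu>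
  T^\<nu>), read off in degree d. Each h is weighted by d, written as the sum of deg P * v_P(h);
  v_P(h) unfolds into the powers P^j dividing h, and the sum over the cofactors of P^j is an earlier
  coefficient.\<close>

lemma Lcoeff_recurrence:
  assumes p: "prime p" and \<xi>1: "\<xi> 1 = 1"
    and \<xi>: "\<And>a b g h. g \<in> mon p a \<Longrightarrow> h \<in> mon p b \<Longrightarrow> \<xi> (red p (g * h)) = \<xi> g * \<xi> h"
  shows "of_nat d * Lcoeff p \<xi> d = (\<Sum>\<nu>=1..d. Spow p \<xi> \<nu> * Lcoeff p \<xi> (d - \<nu>))"
proof -
  let ?I = "{P\<in>irr p. degree P \<le> d}"
  define F where "F = (\<lambda>P \<nu>. of_nat (degree P) * \<xi> P ^ (\<nu> div degree P) * Lcoeff p \<xi> (d - \<nu>))"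
  have pw: "red p (P ^ j) \<in> mon p (j * degree P) \<and> \<xi> (red p (P ^ j)) = \<xi> P ^ j" if P: "P \<in> irr p" for P j
  proof (induction j)
    case 0
    then show ?case using mon_0[OF p] monD(6)[of 1 p 0] \<xi>1 by simp
  next
    case (Suc j)
    have "red p (P ^ Suc j) = red p (P * red p (P ^ j))"
      unfolding red_eq_iff power_Suc right_diff_distrib[symmetric] by (intro dz_mult dz_red)
    then show ?case
      using mon_mult[OF p irrD(1)[OF P] conjunct1[OF Suc.IH]] \<xi>[OF irrD(1)[OF P] conjunct1[OF Suc.IH]] Suc.IH
      by simp
  qed
  have inner: "(\<Sum>h\<in>{h\<in>mon p d. h \<in> pid p (P ^ j)}. \<xi> h) =
      (if j * degree P \<le> d then \<xi> P ^ j * Lcoeff p \<xi> (d - j * degree P) else 0)" if P: "P \<in> irr p" for P j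
  proof (cases "j * degree P \<le> d")
    case True
    let ?g = "red p (P ^ j)"
    have eq: "pid p (P ^ j) = pid p ?g"
    proof -
      have "?g \<in> pid p (P ^ j)" "P ^ j \<in> pid p ?g" using red_mem_pid by auto
      then show ?thesis using pid_trans by blast
    qed
    have "(\<Sum>h\<in>{h\<in>mon p d. h \<in> pid p (P ^ j)}. \<xi> h) = (\<Sum>h\<in>mon p (d - j * degree P). \<xi> (red p (?g * h)))"
      unfolding eq using bij_betw_mon_mult[OF p conjunct1[OF pw[OF P]] True]
      by (rule sum.reindex_bij_betw[symmetric])
    also have "\<dots> = (\<Sum>h\<in>mon p (d - j * degree P). \<xi> P ^ j * \<xi> h)"
      using pw[OF P] \<xi>[OF conjunct1[OF pw[OF P]]] by (intro sum.cong) auto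
    finally show ?thesis using True by (simp add: Lcoeff_def sum_distrib_left)
  next
    case False
    have "h \<notin> pid p (P ^ j)" if h: "h \<in> mon p d" for h
    proof
      assume "h \<in> pid p (P ^ j)"
      then have "degree (P ^ j) \<le> d"
        using monic_mem_pid_degree[OF p lead_coeff_power_1[OF irrD(3)[OF P]]] monD[OF h] by metis
      moreover have "degree (P ^ j) = j * degree P"
        using irrD(3)[OF P] by (subst degree_power_eq) auto
      ultimately show False using False by simp
    qed
    then have "{h\<in>mon p d. h \<in> pid p (P ^ j)} = {}" by blast
    then show ?thesis using False by (simp only: sum.empty if_False)
  qed
  have "of_nat d * Lcoeff p \<xi> d = (\<Sum>h\<in>mon p d. of_nat (\<Sum>P\<in>?I. degree P * vl p P h) * \<xi> h)"
    using sum_vl[OF p] by (simp add: Lcoeff_def sum_distrib_left)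
  also have "\<dots> = (\<Sum>h\<in>mon p d. \<Sum>P\<in>?I. \<Sum>j=1..d. of_nat (degree P) * (if h \<in> pid p (P ^ j) then \<xi> h else 0))"
  proof (intro sum.cong refl)
    fix h assume h: "h \<in> mon p d"
    have "of_nat (vl p P h) * \<xi> h = (\<Sum>j=1..d. if h \<in> pid p (P ^ j) then \<xi> h else 0)" if "P \<in> ?I" for P
    proof -
      have "vl p P h = card {j\<in>{1..d}. h \<in> pid p (P ^ j)}"
        unfolding vl_def using vl_subset[OF p _ h, of P] that by (intro arg_cong[of _ _ card]) auto
      moreover have "(\<Sum>j=1..d. if h \<in> pid p (P ^ j) then \<xi> h else 0) = (\<Sum>j\<in>{j\<in>{1..d}. h \<in> pid p (P ^ j)}. \<xi> h)"
        by (intro sum.inter_filter[symmetric]) auto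
      ultimately show ?thesis by simp
    qed
    then show "of_nat (\<Sum>P\<in>?I. degree P * vl p P h) * \<xi> h =
        (\<Sum>P\<in>?I. \<Sum>j=1..d. of_nat (degree P) * (if h \<in> pid p (P ^ j) then \<xi> h else 0))"
      by (simp add: sum_distrib_right sum_distrib_left[symmetric] mult.assoc)
  qed
  also have "\<dots> = (\<Sum>P\<in>?I. \<Sum>j=1..d. of_nat (degree P) * (\<Sum>h\<in>mon p d. if h \<in> pid p (P ^ j) then \<xi> h else 0))"
    by (subst sum.swap, intro sum.cong refl, subst sum.swap) (simp add: sum_distrib_left)
  also have "\<dots> = (\<Sum>P\<in>?I. \<Sum>j=1..d. if j * degree P \<le> d then F P (j * degree P) else 0)"
    using inner irrD(2) by (intro sum.cong refl) (auto simp: F_def finite_mon sum.inter_filter[symmetric])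
  also have "\<dots> = (\<Sum>P\<in>?I. \<Sum>\<nu>=1..d. if degree P dvd \<nu> then F P \<nu> else 0)"
  proof (rule sum.cong[OF refl])
    fix P assume P: "P \<in> ?I"
    then have e: "degree P \<ge> 1" by (auto dest: irrD)
    have "(\<Sum>j=1..d. if j * degree P \<le> d then F P (j * degree P) else 0) =
          (\<Sum>j\<in>{j\<in>{1..d}. j * degree P \<le> d}. F P (j * degree P))"
      by (intro sum.inter_filter[symmetric]) auto
    also have "\<dots> = (\<Sum>\<nu>\<in>{\<nu>\<in>{1..d}. degree P dvd \<nu>}. F P \<nu>)"
    proof (rule sum.reindex_bij_witness[of _ "\<lambda>\<nu>. \<nu> div degree P" "\<lambda>j. j * degree P"])
      fix j assume j: "j \<in> {j\<in>{1..d}. j * degree P \<le> d}"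
      show "j * degree P \<in> {\<nu>\<in>{1..d}. degree P dvd \<nu>}" "j * degree P div degree P = j"
        using j e by auto
    next
      fix \<nu> assume \<nu>: "\<nu> \<in> {\<nu>\<in>{1..d}. degree P dvd \<nu>}"
      then obtain i where i: "\<nu> = degree P * i" by (auto elim: dvdE)
      then have "i \<le> \<nu>" "i \<ge> 1" using e \<nu> by (auto simp: Suc_le_eq)
      have "i \<le> d" using \<open>i \<le> \<nu>\<close> \<nu> by auto
      then show "\<nu> div degree P \<in> {j\<in>{1..d}. j * degree P \<le> d}" "\<nu> div degree P * degree P = \<nu>"
        using i \<nu> e \<open>i \<le> d\<close> by (auto simp: mult.commute)
    qed auto
    also have "\<dots> = (\<Sum>\<nu>=1..d. if degree P dvd \<nu> then F P \<nu> else 0)"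
      by (intro sum.inter_filter) auto
    finally show "(\<Sum>j=1..d. if j * degree P \<le> d then F P (j * degree P) else 0) =
        (\<Sum>\<nu>=1..d. if degree P dvd \<nu> then F P \<nu> else 0)" .
  qed
  also have "\<dots> = (\<Sum>\<nu>=1..d. \<Sum>P\<in>?I. if degree P dvd \<nu> then F P \<nu> else 0)"
    by (rule sum.swap)
  also have "\<dots> = (\<Sum>\<nu>=1..d. Spow p \<xi> \<nu> * Lcoeff p \<xi> (d - \<nu>))"
  proof (intro sum.cong refl)
    fix \<nu> assume \<nu>: "\<nu> \<in> {1..d}"
    have "{P\<in>irr p. degree P dvd \<nu>} = {P\<in>?I. degree P dvd \<nu>}"
      using \<nu> by (auto dest: dvd_imp_le)
    then have "Spow p \<xi> \<nu> * Lcoeff p \<xi> (d - \<nu>) = (\<Sum>P\<in>{P\<in>?I. degree P dvd \<nu>}. F P \<nu>)"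
      by (simp add: Spow_def F_def sum_distrib_right)
    also have "\<dots> = (\<Sum>P\<in>?I. if degree P dvd \<nu> then F P \<nu> else 0)"
      by (intro sum.inter_filter finite_irr_le)
    finally show "(\<Sum>P\<in>?I. if degree P dvd \<nu> then F P \<nu> else 0) = Spow p \<xi> \<nu> * Lcoeff p \<xi> (d - \<nu>)" ..
  qed
  finally show ?thesis .
qed

subsection \<open>Newton power sums\<close>

text \<open>Newton's identities solved for the power sums of the roots of a monic h. Roots and
  divisions are avoided, so that the values exist over the integers and can be compared modulo p.
  The value at 0 is 0, not the degree.\<close>

fun psum :: "'a::comm_ring_1 poly \<Rightarrow> nat \<Rightarrow> 'a" where
  "psum h j = - (of_nat j * coeff (reflect_poly h) j + (\<Sum>i=1..<j. coeff (reflect_poly h) i * psum h (j - i)))"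

declare psum.simps [simp del]

lemma psum_0 [simp]: "psum h 0 = 0"
  by (subst psum.simps) simp

text \<open>If R is the product of the (1 - r X) over the roots r, the power sums are the
  coefficients of - X R' / R. Monicity makes the constant term of R equal to 1, so the recursion is
  this identity with R cleared.\<close>

lemma psum_fps:
  assumes "lead_coeff (h :: 'a::comm_ring_1 poly) = 1"
  shows "Abs_fps (psum h) * fps_of_poly (reflect_poly h) = - (fps_X * fps_deriv (fps_of_poly (reflect_poly h)))"
proof (rule fps_ext)
  fix j
  let ?r = "coeff (reflect_poly h)"
  have "fps_nth (fps_of_poly (reflect_poly h) * Abs_fps (psum h)) j = (\<Sum>i=0..j. ?r i * psum h (j - i))"
    by (simp add: fps_mult_nth)
  also have "\<dots> = - (of_nat j * ?r j)"
  proof (cases "j = 0")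
    case False
    then have "{0..j} = insert 0 (insert j {1..<j})" by auto
    then have "(\<Sum>i=0..j. ?r i * psum h (j - i)) = psum h j + (\<Sum>i=1..<j. ?r i * psum h (j - i))"
      using False assms by (simp add: coeff_reflect_poly)
    then show ?thesis by (subst (asm) psum.simps) simp
  qed auto
  also have "\<dots> = fps_nth (- (fps_X * fps_deriv (fps_of_poly (reflect_poly h)))) j"
    by (cases j) (auto simp: fps_X_mult_nth)
  finally show "fps_nth (Abs_fps (psum h) * fps_of_poly (reflect_poly h)) j =
      fps_nth (- (fps_X * fps_deriv (fps_of_poly (reflect_poly h)))) j"
    by (simp add: mult.commute)
qed

text \<open>Logarithmic derivatives add under multiplication. This additivity is what will make the
  character on monic polynomials multiplicative.\<close>

lemma psum_mult:
  fixes g h :: "'a::idom poly"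
  assumes g: "lead_coeff g = 1" and h: "lead_coeff h = 1"
  shows "psum (g * h) j = psum g j + psum h j"
proof -
  let ?G = "fps_of_poly (reflect_poly g)" and ?H = "fps_of_poly (reflect_poly h)"
  have lc: "lead_coeff (g * h) = 1" using g h by (simp add: lead_coeff_mult)
  have "Abs_fps (psum (g * h)) * (?G * ?H) = - (fps_X * fps_deriv (?G * ?H))"
    using psum_fps[OF lc] by (simp add: reflect_poly_mult fps_of_poly_mult)
  also have "\<dots> = (- (fps_X * fps_deriv ?G)) * ?H + (- (fps_X * fps_deriv ?H)) * ?G"
    by (simp add: algebra_simps)
  also have "\<dots> = (Abs_fps (psum g) + Abs_fps (psum h)) * (?G * ?H)"
    unfolding psum_fps[OF g, symmetric] psum_fps[OF h, symmetric] by (simp add: algebra_simps)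
  finally have *: "Abs_fps (psum (g * h)) * (?G * ?H) = (Abs_fps (psum g) + Abs_fps (psum h)) * (?G * ?H)" .
  have "fps_of_poly (reflect_poly u) \<noteq> 0" if "lead_coeff u = 1" for u :: "'a poly"
    using that fps_of_poly_eq_iff[of "reflect_poly u" 0] by auto
  then have "?G * ?H \<noteq> 0" using g h by simp
  then have "Abs_fps (psum (g * h)) = Abs_fps (psum g) + Abs_fps (psum h)"
    using * by (metis mult_cancel_right)
  then show ?thesis by (metis fps_add_nth Abs_fps_inverse UNIV_I fps_nth_Abs_fps)
qed

lemma psum_1 [simp]: "psum 1 j = (0 :: 'a::comm_ring_1)"
proof (induction j rule: less_induct)
  case (less j)
  have "of_nat j * coeff (1 :: 'a poly) j = 0" by (cases "j = 0") auto
  moreover have "(\<Sum>i=1..<j. coeff (1 :: 'a poly) i * psum 1 (j - i)) = 0"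
    by (rule sum.neutral) auto
  ultimately show ?case by (subst psum.simps) simp
qed

lemma psum_linear: "j \<ge> 1 \<Longrightarrow> psum [:- r, 1:] j = (r :: 'a::comm_ring_1) ^ j"
proof (induction j rule: less_induct)
  case (less j)
  have refl: "reflect_poly [:- r, 1:] = [:1, - r:]"
    by (simp add: reflect_poly_def)
  show ?case
  proof (cases "j = 1")
    case True
    then show ?thesis by (subst psum.simps) (simp add: refl)
  next
    case False
    then have "{1..<j} = insert 1 {2..<j}" using less.prems by auto
    moreover have "(\<Sum>i=2..<j. coeff [:1, - r:] i * psum [:- r, 1:] (j - i)) = 0"
      by (rule sum.neutral) (auto simp: coeff_pCons split: nat.splits)
    ultimately have "psum [:- r, 1:] j = r * psum [:- r, 1:] (j - 1)"
      using False less.prems by (subst psum.simps) (simp add: refl coeff_pCons split: nat.splits)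
    also have "\<dots> = r * r ^ (j - 1)" using less False by simp
    finally show ?thesis using less.prems by (simp add: power_eq_if)
  qed
qed

lemma psum_prod_linear:
  fixes x :: "'b \<Rightarrow> 'a::idom"
  assumes "finite S" "j \<ge> 1"
  shows "psum (\<Prod>i\<in>S. [:- x i, 1:]) j = (\<Sum>i\<in>S. x i ^ j)"
  using assms(1)
proof (induction S rule: finite_induct)
  case (insert i S)
  have "lead_coeff (\<Prod>i\<in>S. [:- x i, 1:]) = 1" by (simp add: lead_coeff_prod)
  then have "psum ([:- x i, 1:] * (\<Prod>i\<in>S. [:- x i, 1:])) j = x i ^ j + (\<Sum>i\<in>S. x i ^ j)"
    using insert.IH assms(2) by (subst psum_mult) (auto simp: psum_linear)
  then show ?case using insert.hyps by simp
qed auto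

lemma (in ring_ideal) psum_cg:
  assumes "\<And>i. i \<le> j \<Longrightarrow> coeff (reflect_poly g) i \<simeq> coeff (reflect_poly h) i"
  shows "psum g j \<simeq> psum h j"
  using assms
proof (induction j rule: less_induct)
  case (less j)
  have "0 - (of_nat j * coeff (reflect_poly g) j + (\<Sum>i=1..<j. coeff (reflect_poly g) i * psum g (j - i))) \<simeq>
        0 - (of_nat j * coeff (reflect_poly h) j + (\<Sum>i=1..<j. coeff (reflect_poly h) i * psum h (j - i)))"
    using less by (intro cg_diff cg_refl cg_add cg_mult cg_sum) auto
  then show ?case by (subst (1 2) psum.simps) simp
qed

lemma psum_map_of_int: "psum (map_poly of_int h) j = (of_int (psum h j) :: 'a::{ring_char_0,idom})"
proof (induction j rule: less_induct)
  case (less j)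
  have "coeff (reflect_poly (map_poly of_int h :: 'a poly)) i = of_int (coeff (reflect_poly h) i)" for i
    by (auto simp: coeff_reflect_poly coeff_map_poly degree_map_poly)
  then show ?case using less by (subst (1 2) psum.simps) auto
qed

lemma mem_pid_int: "c \<in> pid p (0 :: int) \<longleftrightarrow> int p dvd c"
  by (auto simp: pid_def dvd_def)

lemma pid_int_cg: "pid.cg p (0 :: int) c d \<longleftrightarrow> [c = d] (mod int p)"
  by (simp add: pid.cg_def mem_pid_int cong_iff_dvd_diff)

lemma psum_red:
  assumes "prime p" "lead_coeff h = 1"
  shows "[psum (red p h) j = psum h j] (mod int p)"
proof -
  have "degree (red p h) = degree h" using red_mon[OF assms] by (auto dest: monD)
  then have "pid.cg p (0 :: int) (psum (red p h) j) (psum h j)"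
    by (intro pid.psum_cg) (auto simp: pid_int_cg coeff_reflect_poly Cong.cong_def)
  then show ?thesis by (simp add: pid_int_cg)
qed

subsection \<open>Traces modulo an irreducible polynomial\<close>

lemma poly_map_of_int_X: "poly (map_poly of_int u) [:0, 1:] = (u :: int poly)"
proof -
  have "poly (map_poly of_int u) [:0, 1:] = (\<Sum>i\<le>degree u. monom (coeff u i) i)"
    by (simp add: poly_altdef degree_map_poly coeff_map_poly monom_altdef of_int_poly)
  then show ?thesis by (simp add: poly_as_sum_of_monoms)
qed

text \<open>For e = deg P these represent the p^e elements of F_p[x]/(P). The same set serves to
  count reduced functions on the curve.\<close>

definition small_polys :: "nat \<Rightarrow> nat \<Rightarrow> int poly set"
  where "small_polys p e = {u. \<forall>i. coeff u i \<in> {0..<int p} \<and> (i \<ge> e \<longrightarrow> coeff u i = 0)}"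

lemma small_polys_card:
  assumes "p > 0"
  shows "finite (small_polys p e)" "card (small_polys p e) = p ^ e"
proof -
  have "bij_betw (\<lambda>c. \<Sum>i<e. monom (c i) i) ({..<e} \<rightarrow>\<^sub>E {0..<int p}) (small_polys p e)"
  proof (rule bij_betwI[where g = "\<lambda>u. restrict (coeff u) {..<e}"])
    have *: "coeff (\<Sum>i<e. monom (c i) i) j = (if j < e then c j else 0)" for c :: "nat \<Rightarrow> int" and j
      by (simp add: coeff_sum)
    show "(\<lambda>c. \<Sum>i<e. monom (c i) i) \<in> ({..<e} \<rightarrow>\<^sub>E {0..<int p}) \<rightarrow> small_polys p e"
      using assms by (auto simp: small_polys_def * PiE_iff)
    show "(\<lambda>u. restrict (coeff u) {..<e}) \<in> small_polys p e \<rightarrow> ({..<e} \<rightarrow>\<^sub>E {0..<int p})"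
      by (auto simp: small_polys_def)
    show "restrict (coeff (\<Sum>i<e. monom (c i) i)) {..<e} = c" if "c \<in> {..<e} \<rightarrow>\<^sub>E {0..<int p}" for c
      using that by (auto simp: * fun_eq_iff PiE_iff extensional_def)
    show "(\<Sum>i<e. monom (restrict (coeff u) {..<e} i) i) = u" if "u \<in> small_polys p e" for u
      using that by (auto simp: poly_eq_iff * small_polys_def)
  qed
  then show "finite (small_polys p e)" "card (small_polys p e) = p ^ e"
    using bij_betw_finite bij_betw_same_card by (force simp: finite_PiE, fastforce simp: card_PiE)
qed

section \<open>Conjugates and traces in the field F_p[x]/(P)\<close>

locale irreducible_mod =
  fixes p :: nat and P :: "int poly"
  assumes p: "prime p" and P: "P \<in> irr p"
begin

sublocale prime_ring_ideal "pid p P" by (rule irrD(4)[OF P])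
sublocale char_ideal "pid p P" p by (rule char_ideal_pid[OF p])

abbreviation cgP (infix "\<simeq>" 50) where "u \<simeq> v \<equiv> pid.cg p P u v"

abbreviation X :: "int poly" where "X \<equiv> [:0, 1:]"

lemma pow_eq_subst: "u ^ p ^ m \<simeq> poly (map_poly of_int u) (X ^ p ^ m)"
  using frob_poly[of u X m] by (simp only: poly_map_of_int_X)

lemma poly_cg: "z \<simeq> w \<Longrightarrow> poly u z \<simeq> poly u w"
  unfolding poly_altdef by (intro pid.cg_sum pid.cg_mult pid.cg_power pid.cg_refl)

lemma lc_lift: "lead_coeff (map_poly of_int P :: int poly poly) = 1" "degree (map_poly of_int P :: int poly poly) = degree P"
  using irrD(3)[OF P] by (auto simp: degree_map_poly coeff_map_poly)

text \<open>Since x generates the field, fixing x would mean fixing all p^(deg P) elements, which is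
  more than the p^s roots that Y^(p^s) - Y can have.\<close>

lemma X_frob_not_fixed:
  assumes s: "0 < s" "s < degree P"
  shows "\<not> X ^ p ^ s \<simeq> X"
proof
  assume *: "X ^ p ^ s \<simeq> X"
  have p1: "p > 1" using p by (rule prime_gt_1_nat)
  have fixd: "u ^ p ^ s \<simeq> u" for u
    using pid.cg_trans[OF pow_eq_subst poly_cg[OF *]] by (simp only: poly_map_of_int_X)
  have ps: "p ^ s > 1" using p1 s(1) by (metis one_less_power)
  define w :: "int poly poly" where "w = monom 1 (p ^ s) - monom 1 1"
  have cw: "coeff w (p ^ s) = 1" using ps by (simp add: w_def)
  have dw: "degree w \<le> p ^ s" unfolding w_def using ps by (intro degree_diff_le) (auto simp: degree_monom_le order_trans[OF degree_monom_le])
  have "coeff w (p ^ s) \<in> pid p P"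
  proof (rule poly_many_roots)
    show "finite (small_polys p (degree P))" using small_polys_card p1 by simp
    show "poly w z \<in> pid p P" for z
      using fixd[of z] by (simp add: w_def poly_monom pid.cg_def)
    show "z - z' \<notin> pid p P" if z: "z \<in> small_polys p (degree P)" "z' \<in> small_polys p (degree P)" "z \<noteq> z'" for z z'
    proof
      assume "z - z' \<in> pid p P"
      moreover have "z - z' = 0 \<or> degree (z - z') < degree P"
        using irrD(2)[OF P] z(1,2) by (auto simp: small_polys_def intro!: degree_lessI)
      ultimately have "dz p (z - z')" using pid_small[OF p irrD(3)[OF P]] by blast
      then have "red p z = red p z'" by (simp add: red_eq_iff)
      moreover have "red p z = z" "red p z' = z'" using z by (auto simp: small_polys_def poly_eq_iff)
      ultimately show False using z(3) by simp
    qed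
    show "w = 0 \<or> degree w < card (small_polys p (degree P))"
      using dw small_polys_card(2)[of p "degree P"] p1 power_strict_increasing[OF s(2) p1] by linarith
  qed
  then show False using one_nmem cw by simp
qed

text \<open>The difference is the p^i-th power of x^(p^(j-i)) - x, and a prime ideal allows the
  root. Fermat turns the sign (-1)^(p^i) into -1, for p = 2 as well.\<close>

lemma X_frob_distinct:
  assumes "i < j" "j < degree P + i"
  shows "X ^ p ^ j - X ^ p ^ i \<notin> pid p P"
proof
  assume *: "X ^ p ^ j - X ^ p ^ i \<in> pid p P"
  have "(X ^ p ^ (j - i) + (- X)) ^ p ^ i \<simeq> (X ^ p ^ (j - i)) ^ p ^ i + (- X) ^ p ^ i"
    by (rule frob_add)
  also have "(- X) ^ p ^ i = (-1) ^ p ^ i * X ^ p ^ i" by (subst power_mult_distrib[symmetric]) simp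
  also have "(X ^ p ^ (j - i)) ^ p ^ i = X ^ p ^ j"
    using assms by (simp only: power_mult[symmetric] power_add[symmetric]) simp
  also have "X ^ p ^ j + (-1) ^ p ^ i * X ^ p ^ i \<simeq> X ^ p ^ j + (-1) * X ^ p ^ i"
    using frob_of_int[of "-1" i] by (intro pid.cg_add pid.cg_mult pid.cg_refl) simp
  also have "\<dots> = X ^ p ^ j - X ^ p ^ i" by (simp only: mult_minus1 add_uminus_conv_diff)
  finally have "(X ^ p ^ (j - i) + (- X)) ^ p ^ i \<in> pid p P" using * pid.cg_mem by blast
  then have "X ^ p ^ (j - i) + (- X) \<in> pid p P" by (rule power_mem)
  then have "X ^ p ^ (j - i) \<simeq> X" by (simp only: pid.cg_def add_uminus_conv_diff)
  then show False using X_frob_not_fixed[of "j - i"] assms by linarith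
qed

lemma lift_root: "poly (map_poly of_int P) (X ^ p ^ i) \<in> pid p P"
proof -
  have "P ^ p ^ i \<in> pid p P"
    using p prime_gt_0_nat[of p] by (metis g_mem_pid pid.mult_mem' power_eq_if power_eq_0_iff not_gr0 mult.commute)
  then show ?thesis using pid.cg_mem[OF pid.cg_sym[OF pow_eq_subst]] by blast
qed

text \<open>Otherwise x and its first deg P iterates under Frobenius would be deg P + 1 different
  roots of P.\<close>

lemma X_frob_degree: "X ^ p ^ degree P \<simeq> X"
proof (rule ccontr)
  assume *: "\<not> X ^ p ^ degree P \<simeq> X"
  have dist: "X ^ p ^ j - X ^ p ^ i \<notin> pid p P" if "i < j" "j \<le> degree P" for i j
  proof (cases "i = 0 \<and> j = degree P")
    case True
    then show ?thesis using * by (simp add: pid.cg_def)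
  next
    case False
    then show ?thesis using X_frob_distinct[of i j] that by auto
  qed
  define Z where "Z = (\<lambda>i. X ^ p ^ i) ` {..degree P}"
  have inj: "inj_on (\<lambda>i. X ^ p ^ i) {..degree P}"
  proof (rule inj_onI, rule ccontr)
    fix i j assume ij: "i \<in> {..degree P}" "j \<in> {..degree P}" "X ^ p ^ i = X ^ p ^ j" "i \<noteq> j"
    then have "X ^ p ^ j - X ^ p ^ i = 0" "X ^ p ^ i - X ^ p ^ j = 0" by (simp_all only: diff_self)
    then show False using dist[of i j] dist[of j i] ij pid.zero_mem[of p P] by (metis atMost_iff linorder_neqE_nat)
  qed
  have "coeff (map_poly of_int P) (degree P) \<in> pid p P"
  proof (rule poly_many_roots[of Z])
    show "z - z' \<notin> pid p P" if "z \<in> Z" "z' \<in> Z" "z \<noteq> z'" for z z'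
    proof -
      from that obtain i j where ij: "z = X ^ p ^ i" "z' = X ^ p ^ j" "i \<le> degree P" "j \<le> degree P" "i \<noteq> j"
        by (auto simp: Z_def)
      then consider "i < j" | "j < i" by linarith
      then show ?thesis
      proof cases
        case 1
        show ?thesis using dist[OF 1 ij(4)] pid.uminus_mem[of "z - z'"] ij by auto
      next
        case 2
        show ?thesis using dist[OF 2 ij(3)] ij by auto
      qed
    qed
    show "map_poly of_int P = (0 :: int poly poly) \<or> degree (map_poly of_int P :: int poly poly) < card Z"
      using lc_lift by (simp add: Z_def card_image[OF inj])
  qed (auto simp: Z_def lift_root)
  then show False using one_nmem lc_lift by simp
qed

text \<open>P has the deg P distinct conjugates of x as roots, hence splits as the product of the Y
  - x^(p^i); its power sums are therefore traces of powers of x.\<close>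

lemma psum_trace:
  assumes "j \<ge> 1"
  shows "of_int (psum P j) \<simeq> (\<Sum>i<degree P. (X ^ p ^ i) ^ j)"
proof -
  let ?L = "map_poly of_int P :: int poly poly"
  let ?R = "\<Prod>i<degree P. [:- (X ^ p ^ i), 1:]"
  have dR: "degree ?R = degree P" by (simp add: degree_prod_eq_sum_degree)
  have lR: "lead_coeff ?R = 1" by (simp add: lead_coeff_prod)
  have dist: "X ^ p ^ j - X ^ p ^ i \<notin> pid p P" if "i < degree P" "j < degree P" "i \<noteq> j" for i j
  proof (cases "i < j")
    case True
    then show ?thesis using X_frob_distinct[of i j] that by auto
  next
    case False
    then show ?thesis using X_frob_distinct[of j i] that pid.uminus_mem[of "X ^ p ^ j - X ^ p ^ i"] by auto
  qed
  have inj: "inj_on (\<lambda>i. X ^ p ^ i) {..<degree P}"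
  proof (rule inj_onI, rule ccontr)
    fix i j assume ij: "i \<in> {..<degree P}" "j \<in> {..<degree P}" "X ^ p ^ i = X ^ p ^ j" "i \<noteq> j"
    then have "X ^ p ^ j - X ^ p ^ i = 0" by (simp only: diff_self)
    then show False using dist[of i j] ij pid.zero_mem[of p P] by (metis lessThan_iff)
  qed
  have "coeff (?L - ?R) i \<in> pid p P" for i
  proof (rule poly_many_roots[of "(\<lambda>i. X ^ p ^ i) ` {..<degree P}"])
    fix z assume "z \<in> (\<lambda>i. X ^ p ^ i) ` {..<degree P}"
    then obtain i where i: "i < degree P" "z = X ^ p ^ i" by auto
    then have "poly ?R z = 0" by (auto simp: poly_prod prod_zero_iff)
    then show "poly (?L - ?R) z \<in> pid p P" using lift_root[of i] i by simp
  next
    have "coeff (?L - ?R) (degree P) = 0" using lc_lift dR lR by simp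
    moreover have "degree (?L - ?R) \<le> degree P" using lc_lift dR by (intro degree_diff_le) auto
    ultimately have "?L - ?R = 0 \<or> degree (?L - ?R) < degree P"
      by (metis leading_coeff_0_iff le_neq_implies_less)
    then show "?L - ?R = 0 \<or> degree (?L - ?R) < card ((\<lambda>i. X ^ p ^ i) ` {..<degree P})"
      by (simp add: card_image[OF inj])
  qed (use dist in auto)
  then have "coeff ?L i \<simeq> coeff ?R i" for i by (simp add: pid.cg_def)
  then have "psum ?L j \<simeq> psum ?R j"
    using lc_lift(2) dR by (intro pid.psum_cg) (auto simp: coeff_reflect_poly)
  then show ?thesis using assms by (simp add: psum_map_of_int psum_prod_linear)
qed

lemma frob_degree_fixed: "u ^ p ^ (degree P * m) \<simeq> u"
proof (induction m)
  case (Suc m)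
  have "u ^ p ^ (degree P * Suc m) = (u ^ p ^ (degree P * m)) ^ p ^ degree P"
    by (simp add: power_mult[symmetric] power_add[symmetric] mult.commute add.commute)
  also have "\<dots> \<simeq> u ^ p ^ degree P" by (intro pid.cg_power Suc.IH)
  also have "\<dots> \<simeq> poly (map_poly of_int u) (X ^ p ^ degree P)" by (rule pow_eq_subst)
  also have "\<dots> \<simeq> poly (map_poly of_int u) X" by (rule poly_cg[OF X_frob_degree])
  also have "\<dots> = u" by (rule poly_map_of_int_X)
  finally show ?case .
qed auto

text \<open>The left side is the trace of f(x) from F_(p^\<nu>) to F_p for \<nu> = m deg P. It runs
  m times through the conjugates over F_p[x]/(P).\<close>

lemma trace_psum:
  assumes "k \<ge> 1"
  shows "(\<Sum>i<degree P * m. (monom a k + monom b 1) ^ p ^ i) \<simeq> of_int (int m * (a * psum P k + b * psum P 1))"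
proof (induction m)
  case (Suc m)
  let ?f = "monom a k + monom b 1 :: int poly" and ?e = "degree P"
  have "map_poly of_int ?f = (monom (of_int a) k + monom (of_int b) 1 :: int poly poly)"
    by (auto simp: poly_eq_iff coeff_map_poly)
  then have ev: "?f ^ p ^ i \<simeq> of_int a * (X ^ p ^ i) ^ k + of_int b * (X ^ p ^ i) ^ 1" for i
    using pow_eq_subst[of ?f i] by (simp only: poly_monom poly_add)
  have split: "sum g {..<A + B} = sum g {..<A} + (\<Sum>i<B. g (A + i))" for g :: "nat \<Rightarrow> int poly" and A B
    by (induction B) (simp_all add: add.assoc)
  have "(\<Sum>i<?e * Suc m. ?f ^ p ^ i) = (\<Sum>i<?e * m. ?f ^ p ^ i) + (\<Sum>i<?e. ?f ^ p ^ (?e * m + i))"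
    using split[of "\<lambda>i. ?f ^ p ^ i" "?e * m" ?e] by (simp only: mult_Suc_right add.commute[of ?e "?e * m"])
  moreover have "(\<Sum>i<?e. ?f ^ p ^ (?e * m + i)) \<simeq> (\<Sum>i<?e. ?f ^ p ^ i)"
  proof (intro pid.cg_sum)
    fix i
    have "?f ^ p ^ (?e * m + i) = (?f ^ p ^ (?e * m)) ^ p ^ i"
      by (simp only: power_mult[symmetric] power_add[symmetric])
    also have "\<dots> \<simeq> ?f ^ p ^ i" by (intro pid.cg_power frob_degree_fixed)
    finally show "?f ^ p ^ (?e * m + i) \<simeq> ?f ^ p ^ i" .
  qed
  moreover have "(\<Sum>i<?e. ?f ^ p ^ i) \<simeq> (\<Sum>i<?e. of_int a * (X ^ p ^ i) ^ k + of_int b * (X ^ p ^ i) ^ 1)"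
    by (intro pid.cg_sum ev)
  moreover have "(\<Sum>i<?e. of_int a * (X ^ p ^ i) ^ k + of_int b * (X ^ p ^ i) ^ 1) =
      of_int a * (\<Sum>i<?e. (X ^ p ^ i) ^ k) + of_int b * (\<Sum>i<?e. (X ^ p ^ i) ^ 1)"
    by (simp only: sum.distrib sum_distrib_left)
  moreover have "of_int a * (\<Sum>i<?e. (X ^ p ^ i) ^ k) + of_int b * (\<Sum>i<?e. (X ^ p ^ i) ^ 1) \<simeq>
      of_int a * of_int (psum P k) + of_int b * of_int (psum P 1)"
    using assms by (intro pid.cg_add pid.cg_mult pid.cg_refl pid.cg_sym[OF psum_trace]) auto
  ultimately have "(\<Sum>i<?e * Suc m. ?f ^ p ^ i) \<simeq>
      (\<Sum>i<?e * m. ?f ^ p ^ i) + (of_int a * of_int (psum P k) + of_int b * of_int (psum P 1))"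
    by (metis (no_types, lifting) pid.cg_add pid.cg_refl pid.cg_trans)
  also have "\<dots> \<simeq> of_int (int m * (a * psum P k + b * psum P 1)) + (of_int a * of_int (psum P k) + of_int b * of_int (psum P 1))"
    by (intro pid.cg_add Suc.IH pid.cg_refl)
  also have "\<dots> = of_int (int (Suc m) * (a * psum P k + b * psum P 1))"
    by (simp add: algebra_simps)
  finally show ?case .
qed auto

end

text \<open>Different irreducibles are coprime modulo p, so congruences modulo the single P combine.
  This is how all points with one value t are treated by one polynomial.\<close>

lemma pid_prod_irr:
  assumes p: "prime p" and "finite S" "S \<subseteq> irr p" "\<And>P. P \<in> S \<Longrightarrow> u \<in> pid p P"
  shows "u \<in> pid p (\<Prod>S)"
  using assms(2-4)
proof (induction S arbitrary: u rule: finite_induct)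
  case empty
  then show ?case using pid.mult_mem[OF g_mem_pid[of 1 p], of u] by simp
next
  case (insert P S)
  interpret P: prime_ring_ideal "pid p P" using insert.prems irrD by auto
  have "u \<in> pid p (\<Prod>S)" using insert by auto
  then obtain a b where u: "u = of_nat p * a + \<Prod>S * b" by (elim pidE)
  have "\<Prod>S \<notin> pid p P"
    using P.prod_mem[OF insert.hyps(1), of id] irr_mem_pid_irr[OF p] insert by (auto simp: subset_iff)
  moreover have "u - of_nat p * a \<in> pid p P" using insert.prems(2) by (intro pid.diff_mem pid.mult_mem') auto
  then have "\<Prod>S * b \<in> pid p P" by (simp add: u)
  ultimately have "b \<in> pid p P" using P.prime_mem by blast
  then obtain c d where "b = of_nat p * c + P * d" by (elim pidE)
  then have "u = of_nat p * (a + \<Prod>S * c) + \<Prod>(insert P S) * d"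
    using insert.hyps by (simp add: u algebra_simps)
  then show ?case by (rule pidI)
qed

subsection \<open>The Stepanov--Bombieri bound\<close>

locale artin_schreier =
  fixes p k :: nat and a b :: int
  assumes p: "prime p" and k: "k \<ge> 2" and kp: "coprime k p" and a: "\<not> int p dvd a"
begin

lemma p_gt_1: "p > 1"
  using p by (rule prime_gt_1_nat)

definition f :: "int poly" where "f = monom a k + monom b 1"

definition mo :: "nat \<Rightarrow> nat \<Rightarrow> int poly poly" where "mo i j = monom (monom 1 i) j"

abbreviation cc :: "int poly poly \<Rightarrow> nat \<Rightarrow> nat \<Rightarrow> int" where "cc u i j \<equiv> coeff (coeff u j) i"

abbreviation y :: "int poly poly" where "y \<equiv> mo 0 1"

definition E :: "int poly poly" where "E = y ^ p - y - [:f:]"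

text \<open>The weight of a monomial is its pole order at the point at infinity of the curve \<open>E = 0\<close>.\<close>

definition wl :: "nat \<Rightarrow> int poly poly \<Rightarrow> bool"
  where "wl D u \<longleftrightarrow> (\<forall>i j. cc u i j \<noteq> 0 \<longrightarrow> p * i + k * j < D)"

lemma mo_mult: "mo i j * mo i' j' = mo (i + i') (j + j')"
  by (simp add: mo_def mult_monom)

lemma mo_power: "mo i j ^ n = mo (i * n) (j * n)"
  by (simp add: mo_def monom_power)

lemma cc_mo: "cc (mo i j) i' j' = (if i = i' \<and> j = j' then 1 else 0)"
  by (auto simp: mo_def)

lemma of_int_poly_poly: "of_int c = ([:[:c:]:] :: int poly poly)"
  by (simp add: of_int_poly)

lemma cc_of_int_mult: "cc (of_int c * u) i j = c * cc u i j"
  by (simp add: of_int_poly_poly)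

lemma y_power: "y ^ j = mo 0 j"
  by (simp add: mo_power)

lemma const_f: "[:f:] = of_int a * mo k 0 + of_int b * mo 1 0"
  by (simp add: f_def mo_def of_int_poly_poly monom_0 smult_monom)

lemma coeff_E: "coeff E j = (if j = p then 1 else if j = 1 then -1 else if j = 0 then - f else 0)"
  using p_gt_1 unfolding E_def y_power by (auto simp: mo_def monom_0[symmetric] coeff_pCons split: nat.splits)

lemma degree_E: "degree E = p"
proof (rule antisym)
  show "degree E \<le> p" using p_gt_1 by (intro degree_le) (auto simp: coeff_E)
  show "p \<le> degree E" by (rule le_degree) (simp add: coeff_E)
qed

lemma monic_E: "lead_coeff E = 1"
  by (simp add: degree_E coeff_E)

lemma wl_mono: "wl D u \<Longrightarrow> D \<le> D' \<Longrightarrow> wl D' u"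
  by (force simp: wl_def)

lemma wl_0 [simp]: "wl D 0"
  by (simp add: wl_def)

lemma wl_mo: "p * i + k * j < D \<Longrightarrow> wl D (mo i j)"
  by (auto simp: wl_def cc_mo split: if_splits)

lemma wl_of_int: "wl (Suc 0) (of_int c)"
  by (auto simp: wl_def of_int_poly_poly coeff_pCons split: nat.splits)

lemma wl_add: "wl D u \<Longrightarrow> wl D v \<Longrightarrow> wl D (u + v)"
  and wl_diff: "wl D u \<Longrightarrow> wl D v \<Longrightarrow> wl D (u - v)"
  unfolding wl_def by (metis add_0 coeff_add, metis coeff_diff diff_0_right)

lemma wl_sum: "(\<And>x. x \<in> S \<Longrightarrow> wl D (u x)) \<Longrightarrow> wl D (sum u S)"
  by (induction S rule: infinite_finite_induct) (auto intro: wl_add)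

text \<open>\<open>wl D\<close> is a strict bound and \<open>wl (Suc D)\<close> therefore means
  weight at most D; in this mixed form the bounds add without loss.\<close>

lemma wl_mult:
  assumes u: "wl (Suc D) u" and v: "wl D' v"
  shows "wl (D + D') (u * v)"
  unfolding wl_def
proof (intro allI impI)
  fix i j assume nz: "cc (u * v) i j \<noteq> 0"
  have "cc (u * v) i j = (\<Sum>j'\<le>j. \<Sum>i'\<le>i. cc u i' j' * cc v (i - i') (j - j'))"
    by (simp add: coeff_mult coeff_sum)
  then obtain i' j' where ij: "i' \<le> i" "j' \<le> j" "cc u i' j' * cc v (i - i') (j - j') \<noteq> 0"
    using nz by (metis (no_types, lifting) atMost_iff sum.neutral)
  then have 1: "p * i' + k * j' \<le> D" and 2: "p * (i - i') + k * (j - j') < D'"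
    using u v by (auto simp: wl_def less_Suc_eq_le)
  have "p * i + k * j = (p * i' + k * j') + (p * (i - i') + k * (j - j'))"
  proof -
    have "(p * i' + k * j') + (p * (i - i') + k * (j - j')) = p * (i' + (i - i')) + k * (j' + (j - j'))"
      by (simp only: distrib_left add_ac)
    then show ?thesis using ij(1,2) by simp
  qed
  then show "p * i + k * j < D + D'" using 1 2 by linarith
qed

lemma wl_of_int_mult: "wl D u \<Longrightarrow> wl D (of_int c * u)"
  using wl_mult[OF wl_of_int] by fastforce

lemma wl_power: "wl (Suc D) u \<Longrightarrow> wl (Suc (n * D)) (u ^ n)"
proof (induction n)
  case 0
  then show ?case using wl_of_int[of 1] by simp
next
  case (Suc n)
  then show ?case using wl_mult[of D u "Suc (n * D)" "u ^ n"] by simp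
qed

lemma wl_const_iff: "wl D [:u:] \<longleftrightarrow> u = 0 \<or> p * degree u < D"
proof
  assume "wl D [:u:]"
  then show "u = 0 \<or> p * degree u < D"
    unfolding wl_def using leading_coeff_neq_0[of u] by (metis add.right_neutral coeff_pCons_0 mult_0_right)
next
  assume *: "u = 0 \<or> p * degree u < D"
  show "wl D [:u:]" unfolding wl_def
  proof (intro allI impI)
    fix i j assume "cc [:u:] i j \<noteq> 0"
    then have "j = 0" "coeff u i \<noteq> 0" by (auto simp: coeff_pCons split: nat.splits)
    then have "i \<le> degree u" "u \<noteq> 0" by (auto intro: le_degree)
    then have "p * i \<le> p * degree u" "p * degree u < D" using * by auto
    then have "p * i < D" by (rule le_less_trans)
    then show "p * i + k * j < D" using \<open>j = 0\<close> by simp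
  qed
qed

lemma wl_E: "wl (Suc (k * p)) E"
proof -
  have "k \<le> k * p" "p \<le> k * p" using p_gt_1 k by auto
  then show ?thesis
    unfolding E_def y_power const_f
    by (intro wl_diff wl_add wl_of_int_mult wl_mo) (auto simp: less_Suc_eq_le mult.commute)
qed

text \<open>Division by E in the variable y does not raise the weight, because y^p already carries
  the top weight k p of E.\<close>

lemma reduce:
  assumes "wl D u"
  shows "\<exists>v q. u = v + E * q \<and> wl D v \<and> (\<forall>j\<ge>p. coeff v j = 0)"
proof -
  have "\<exists>v q. u = v + E * q \<and> wl D v \<and> (\<forall>j\<ge>p. coeff v j = 0)"
    if "wl D u" "\<forall>j\<ge>n. coeff u j = 0" for n u
    using that
  proof (induction n arbitrary: u)
    case 0
    then have "u = 0" by (simp add: poly_eq_iff)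
    then show ?case by (intro exI[of _ 0]) auto
  next
    case (Suc n)
    show ?case
    proof (cases "n < p")
      case True
      then show ?thesis using Suc.prems by (intro exI[of _ u] exI[of _ 0]) auto
    next
      case False
      define c where "c = monom (coeff u n) (n - p)"
      have "wl D (E * c)"
      proof (cases "coeff u n = 0")
        case False
        have D: "p * i + k * n < D" if "cc u i n \<noteq> 0" for i using Suc.prems(1) that by (auto simp: wl_def)
        obtain i where "cc u i n \<noteq> 0" using False by (metis leading_coeff_0_iff)
        then have kD: "k * p \<le> D" using D[of i] \<open>\<not> n < p\<close> mult_le_mono2[of p n k] by linarith
        have "wl (D - k * p) c"
          unfolding wl_def
        proof (intro allI impI)
          fix i j assume "cc c i j \<noteq> 0"
          then have j: "j = n - p" "cc u i n \<noteq> 0" by (auto simp: c_def split: if_splits)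
          have "k * j + k * p = k * n" using j \<open>\<not> n < p\<close> by (simp flip: distrib_left)
          then show "p * i + k * j < D - k * p" using D[OF j(2)] by linarith
        qed
        from wl_mult[OF wl_E this] show ?thesis using kD by simp
      qed (simp add: c_def)
      then have w: "wl D (u - E * c)" by (intro wl_diff Suc.prems)
      have "coeff (u - E * c) j = 0" if "j \<ge> n" for j
      proof -
        have "coeff (E * c) j = (if j = n then coeff u n else 0)"
        proof (cases "j = n")
          case True
          have "coeff (c * E) n = coeff u n * coeff E p"
            using False coeff_monom_mult[of "coeff u n" "n - p" E n] by (simp add: c_def)
          then show ?thesis using True by (simp add: mult.commute coeff_E)
        next
          case False
          have "coeff (c * E) j = coeff u n * coeff E (j - (n - p))"
            using that coeff_monom_mult[of "coeff u n" "n - p" E j] by (simp add: c_def)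
          also have "coeff E (j - (n - p)) = 0"
            using that False \<open>\<not> n < p\<close> by (intro coeff_eq_0) (auto simp: degree_E)
          finally show ?thesis using False by (simp add: mult.commute)
        qed
        then show ?thesis using Suc.prems(2) that by (cases "j = n") auto
      qed
      then obtain v q where "u - E * c = v + E * q" "wl D v" "\<forall>j\<ge>p. coeff v j = 0"
        using Suc.IH[OF w] by blast
      then show ?thesis by (intro exI[of _ v] exI[of _ "q + c"]) (auto simp: algebra_simps)
    qed
  qed
  from this[OF assms, of "Suc (degree u)"] show ?thesis by (auto simp: coeff_eq_0)
qed

abbreviation cgE (infix "\<simeq>" 50) where "u \<simeq> v \<equiv> pid.cg p E u v"

interpretation E: char_ideal "pid p E" p by (rule char_ideal_pid[OF p])

lemma E_cg: "y ^ p \<simeq> y + [:f:]"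
  using g_mem_pid[of E p] by (simp add: pid.cg_def E_def algebra_simps)

lemma mult_E_cg: "v + E * q \<simeq> v"
  by (simp add: pid.cg_def pid.mult_mem')

text \<open>On the curve y^p becomes a x^k, of the same weight k p, plus the lighter terms y and b
  x. As p does not divide a, the leading coefficient stays a unit modulo p.\<close>

lemma leading_monomial:
  "\<exists>c i' j' r. mo i j \<simeq> of_int c * mo i' j' + r \<and> \<not> int p dvd c \<and> j' < p \<and>
     p * i' + k * j' = p * i + k * j \<and> wl (p * i + k * j) r"
proof (induction j arbitrary: i rule: less_induct)
  case (less j)
  show ?case
  proof (cases "j < p")
    case True
    then show ?thesis using p_gt_1
      by (intro exI[of _ 1] exI[of _ i] exI[of _ j] exI[of _ 0]) auto
  next
    case False
    define r0 where "r0 = mo i (Suc (j - p)) + of_int b * mo (i + 1) (j - p)"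
    have "mo i j = mo i (j - p) * y ^ p" using False by (simp only: y_power mo_mult) simp
    also have "\<dots> \<simeq> mo i (j - p) * (y + [:f:])" by (intro pid.cg_mult pid.cg_refl E_cg)
    also have "\<dots> = of_int a * mo (i + k) (j - p) + r0"
      unfolding const_f r0_def by (simp add: algebra_simps mo_mult)
    finally have 1: "mo i j \<simeq> of_int a * mo (i + k) (j - p) + r0" .
    have kj: "k * (j - p) + k * p = k * j" using False by (simp flip: distrib_left)
    then have eq: "p * (i + k) + k * (j - p) = p * i + k * j" by (simp add: algebra_simps)
    have "k < k * p" "p < k * p" using p_gt_1 k by auto
    then have "p * i + k * Suc (j - p) < p * i + k * j"
      using kj unfolding mult_Suc_right by linarith
    moreover have "p * (i + 1) + k * (j - p) < p * i + k * j"
      using kj \<open>p < k * p\<close> unfolding distrib_left mult_1_right by linarith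
    ultimately have r0: "wl (p * i + k * j) r0"
      unfolding r0_def by (intro wl_add wl_of_int_mult wl_mo)
    obtain c i' j' r where IH: "mo (i + k) (j - p) \<simeq> of_int c * mo i' j' + r" "\<not> int p dvd c" "j' < p"
        "p * i' + k * j' = p * i + k * j" "wl (p * i + k * j) r"
      using less[of "j - p" "i + k"] False p_gt_1 unfolding eq by auto
    have "mo i j \<simeq> of_int a * (of_int c * mo i' j' + r) + r0"
      by (rule pid.cg_trans[OF 1]) (intro pid.cg_add pid.cg_mult pid.cg_refl IH)
    also have "\<dots> = of_int (a * c) * mo i' j' + (of_int a * r + r0)" by (simp add: algebra_simps)
    finally have "mo i j \<simeq> of_int (a * c) * mo i' j' + (of_int a * r + r0)" .
    moreover have "\<not> int p dvd a * c"
      using a IH(2) p by (metis prime_dvd_mult_iff prime_nat_int_transfer)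
    moreover have "wl (p * i + k * j) (of_int a * r + r0)"
      using r0 IH by (intro wl_add wl_of_int_mult)
    ultimately show ?thesis using IH by blast
  qed
qed

text \<open>The ring modulo E is free over Z[x] with basis 1, y, ..., y^(p-1), so membership in (p,
  E, G) is decided coefficient by coefficient.\<close>

lemma reduced_mem:
  assumes v: "\<forall>j\<ge>p. coeff v j = 0" and eq: "v = of_nat p * c + E * d + [:G:] * e"
  shows "coeff v j \<in> pid p G"
proof -
  obtain qc rc where c: "c = E * qc + rc" "rc = 0 \<or> degree rc < p"
    using monic_divmod[OF monic_E, of c] by (auto simp: degree_E)
  obtain qe re where e: "e = E * qe + re" "re = 0 \<or> degree re < p"
    using monic_divmod[OF monic_E, of e] by (auto simp: degree_E)
  define w where "w = d + of_nat p * qc + [:G:] * qe"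
  have *: "v - (of_nat p * rc + [:G:] * re) = E * w"
    by (simp add: eq c(1) e(1) w_def algebra_simps)
  have cf: "coeff (of_nat p * rc + [:G:] * re) j = of_nat p * coeff rc j + G * coeff re j" for j
    by (simp add: of_nat_poly)
  have "coeff (E * w) j = 0" if "j \<ge> p" for j
    using that v c(2) e(2) unfolding *[symmetric] coeff_diff cf by (auto simp: coeff_eq_0)
  then have "coeff (E * w) (degree (E * w)) = 0" if "w \<noteq> 0"
    using that degree_E monic_E by (subst degree_mult_eq) auto
  moreover have "E \<noteq> 0" using monic_E by auto
  ultimately have "w = 0" by (metis leading_coeff_0_iff mult_eq_0_iff)
  then have "v = of_nat p * rc + [:G:] * re" using * by simp
  then have "coeff v j = of_nat p * coeff rc j + G * coeff re j" using cf by simp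
  then show ?thesis by (rule pidI)
qed

lemma mem_pid_0: "u \<in> pid p 0 \<longleftrightarrow> dz p (u :: int poly)"
  by (auto simp: dz_iff pid_def dvd_def)

section \<open>Frobenius on the curve and the auxiliary function\<close>

definition T :: "nat \<Rightarrow> int poly" where "T m = (\<Sum>i<m. f ^ p ^ i)"

lemma y_frob: "y ^ p ^ m \<simeq> y + [:T m:]"
proof (induction m)
  case (Suc m)
  have eqT: "[:f:] + (\<Sum>i<m. [:f ^ p ^ i:] ^ p ^ 1) = [:T (Suc m):]"
    unfolding T_def sum.lessThan_Suc_shift
    by (simp add: poly_const_pow power_mult[symmetric] mult.commute sum_to_poly)
  have "y ^ p ^ Suc m = (y ^ p ^ m) ^ p" by (simp add: power_mult[symmetric] mult.commute)
  also have "\<dots> \<simeq> (y + [:T m:]) ^ p ^ 1" using pid.cg_power[OF Suc.IH, of p] by (simp only: power_one_right)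
  also have "\<dots> \<simeq> y ^ p ^ 1 + [:T m:] ^ p ^ 1" by (rule E.frob_add)
  also have "[:T m:] = (\<Sum>i<m. [:f ^ p ^ i:])" by (simp add: T_def sum_to_poly)
  also have "y ^ p ^ 1 + (\<Sum>i<m. [:f ^ p ^ i:]) ^ p ^ 1 \<simeq> (y + [:f:]) + (\<Sum>i<m. [:f ^ p ^ i:] ^ p ^ 1)"
    using E_cg by (intro pid.cg_add E.frob_sum) simp
  also have "\<dots> = y + [:T (Suc m):]" unfolding eqT[symmetric] by (simp only: add.assoc)
  finally show ?case .
qed (simp add: T_def)

lemma degree_T: "p * degree (T m) \<le> k * p ^ m"
proof -
  have "degree (T m) \<le> k * p ^ (m - 1)"
    unfolding T_def
  proof (rule degree_sum_le)
    fix i assume "i \<in> {..<m}"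
    have "degree f \<le> k" unfolding f_def using k by (intro degree_add_le) (auto intro: order_trans[OF degree_monom_le])
    then have "degree (f ^ p ^ i) \<le> k * p ^ i"
      using degree_power_le[of f "p ^ i"] by (meson le_trans mult_le_mono1)
    also have "\<dots> \<le> k * p ^ (m - 1)"
      using \<open>i \<in> {..<m}\<close> p_gt_1 by (intro mult_le_mono2 power_increasing) auto
    finally show "degree (f ^ p ^ i) \<le> k * p ^ (m - 1)" .
  qed auto
  moreover have "m = 0 \<Longrightarrow> degree (T m) = 0" by (simp add: T_def)
  ultimately show ?thesis by (cases m) (auto simp: algebra_simps)
qed

end

context artin_schreier
begin

interpretation E: char_ideal "pid p E" p by (rule char_ideal_pid[OF p])


text \<open>The nonzero term of largest weight cannot cancel: by \<open>leading_monomial\<close> it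
  yields a reduced monomial of that weight with a coefficient prime to p, and everything else is
  lighter.\<close>

lemma distinct_weights_not_mem:
  assumes S: "finite S" and inj: "inj_on (\<lambda>s. p * g s + k * h s) S"
    and d: "\<And>s. s \<in> S \<Longrightarrow> int p dvd d s \<Longrightarrow> d s = 0" and ex: "\<exists>s\<in>S. d s \<noteq> 0"
  shows "(\<Sum>s\<in>S. of_int (d s) * mo (g s) (h s)) \<notin> pid p E"
proof
  assume mem: "(\<Sum>s\<in>S. of_int (d s) * mo (g s) (h s)) \<in> pid p E"
  define w where "w = (\<lambda>s. p * g s + k * h s)"
  define S' where "S' = {s \<in> S. d s \<noteq> 0}"
  have S': "finite S'" "S' \<noteq> {}" using S ex by (auto simp: S'_def)
  obtain s where s: "s \<in> S'" "w s = Max (w ` S')"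
    using Max_in[of "w ` S'"] S' by (metis (no_types, lifting) finite_imageI image_iff image_is_empty)
  have less: "w s' < w s" if "s' \<in> S' - {s}" for s'
  proof -
    have "w s' \<le> w s" using S' that by (simp add: s(2))
    moreover have "w s' \<noteq> w s" using inj that s(1) by (auto simp: inj_on_def w_def S'_def)
    ultimately show ?thesis by simp
  qed
  define rest where "rest = (\<Sum>s\<in>S'-{s}. of_int (d s) * mo (g s) (h s))"
  have "(\<Sum>s\<in>S. of_int (d s) * mo (g s) (h s)) = (\<Sum>s\<in>S'. of_int (d s) * mo (g s) (h s))"
    using S by (intro sum.mono_neutral_right) (auto simp: S'_def)
  also have "\<dots> = of_int (d s) * mo (g s) (h s) + rest"
    unfolding rest_def using S' s by (intro sum.remove)
  finally have sum: "(\<Sum>s\<in>S. of_int (d s) * mo (g s) (h s)) = of_int (d s) * mo (g s) (h s) + rest" .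
  have rest: "wl (w s) rest"
    unfolding rest_def using less by (intro wl_sum wl_of_int_mult wl_mo) (auto simp: w_def)
  obtain c i' j' r where lm: "mo (g s) (h s) \<simeq> of_int c * mo i' j' + r" "\<not> int p dvd c" "j' < p"
      "p * i' + k * j' = w s" "wl (w s) r"
    using leading_monomial[of "g s" "h s"] by (auto simp: w_def)
  have "wl (w s) (of_int (d s) * r + rest)"
    using lm rest by (intro wl_add wl_of_int_mult)
  then obtain r' q where r': "of_int (d s) * r + rest = r' + E * q" "wl (w s) r'" "\<forall>j\<ge>p. coeff r' j = 0"
    using reduce by blast
  define V where "V = of_int (d s * c) * mo i' j' + r'"
  have "of_int (d s) * mo (g s) (h s) + rest \<simeq> of_int (d s) * (of_int c * mo i' j' + r) + rest"
    by (intro pid.cg_add pid.cg_mult pid.cg_refl lm)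
  also have "\<dots> = V + E * q"
  proof -
    have "of_int (d s) * (of_int c * mo i' j' + r) + rest = of_int (d s * c) * mo i' j' + (of_int (d s) * r + rest)"
      by (simp add: algebra_simps)
    then show ?thesis by (simp only: r'(1) V_def add.assoc)
  qed
  also have "\<dots> \<simeq> V" by (rule mult_E_cg)
  finally have "V \<in> pid p E" using mem sum pid.cg_mem[OF pid.cg_sym] by metis
  then obtain a' b' where V: "V = of_nat p * a' + E * b'" by (elim pidE)
  have "\<forall>j\<ge>p. coeff V j = 0"
    using r'(3) lm(3) by (auto simp: V_def poly_eq_iff cc_of_int_mult cc_mo simp del: of_int_mult)
  then have "coeff V j' \<in> pid p 0"
    by (rule reduced_mem[where c = a' and d = b' and e = 0]) (simp add: V)
  then have "int p dvd cc V i' j'" by (simp add: mem_pid_0 dz_def)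
  moreover have "cc V i' j' = d s * c"
  proof -
    have "cc r' i' j' = 0" using r'(2) lm(4) unfolding wl_def by (metis less_irrefl)
    then show ?thesis unfolding V_def coeff_add cc_of_int_mult cc_mo by simp
  qed
  ultimately have "int p dvd d s" using lm(2) p by (metis prime_dvd_mult_iff prime_nat_int_transfer)
  then show False using d[of s] s(1) by (auto simp: S'_def)
qed

lemma p_dvd_iff: "of_nat p dvd (u :: int poly poly) \<longleftrightarrow> (\<forall>j. dz p (coeff u j))"
  by (simp add: of_nat_poly const_poly_dvd_iff dz_iff)

text \<open>The bound keeps p a1 + k a2 below q, so the two halves of a weight are digits in base q.
  Inside a half, k is prime to p, so the exponent of y, which is less than p, is determined modulo
  p.\<close>

lemma weights_inj:
  assumes "k * p + p * A \<le> q"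
  shows "inj_on (\<lambda>(a1, a2, b1, b2). p * (a1 + q * b1) + k * (a2 + q * b2)) ({..<A} \<times> {..<p} \<times> {..<B} \<times> {..<p})"
proof (rule inj_onI, clarsimp)
  fix a1 a2 b1 b2 a1' a2' b1' b2'
  assume lt: "a1 < A" "a2 < p" "b2 < p" "a1' < A" "a2' < p" "b2' < p"
    and eq: "p * (a1 + q * b1) + k * (a2 + q * b2) = p * (a1' + q * b1') + k * (a2' + q * b2')"
  have key: "i = i' \<and> j = j'" if "p * i + k * j = p * i' + k * j'" "j < p" "j' < p" for i j i' j'
  proof -
    have "[p * i + k * j = p * i' + k * j'] (mod p)" using that by simp
    then have "[k * j = k * j'] (mod p)" by (simp add: Cong.cong_def)
    then have "[j = j'] (mod p)" using kp by (simp add: cong_mult_lcancel_nat)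
    then have "j = j'" using that by (simp add: cong_less_modulus_unique_nat)
    then show ?thesis using that p_gt_1 by simp
  qed
  have bound: "p * i + k * j < q" if "i < A" "j < p" for i j
  proof -
    have "p * i < p * A" "k * j < k * p" using that p_gt_1 k by auto
    then show ?thesis using assms by linarith
  qed
  have "(p * a1 + k * a2) + q * (p * b1 + k * b2) = (p * a1' + k * a2') + q * (p * b1' + k * b2')"
    using eq by (simp add: algebra_simps)
  moreover have "p * a1 + k * a2 < q" and "p * a1' + k * a2' < q" using bound lt by auto
  ultimately have "p * a1 + k * a2 = p * a1' + k * a2' \<and> p * b1 + k * b2 = p * b1' + k * b2'"
  proof -
    have "u = u' \<and> v = v'" if "u + q * v = u' + q * v'" "u < q" "u' < q" for u v u' v' :: nat
    proof -
      have "(u + q * v) mod q = u" using that(2) by simp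
      moreover have "(u' + q * v') mod q = u'" using that(3) by simp
      ultimately have "u = u'" using that(1) by metis
      then show ?thesis using that by auto
    qed
    then show "p * a1 + k * a2 = p * a1' + k * a2' \<and> p * b1 + k * b2 = p * b1' + k * b2'"
      using \<open>(p * a1 + k * a2) + q * (p * b1 + k * b2) = (p * a1' + k * a2') + q * (p * b1' + k * b2')\<close>
        \<open>p * a1 + k * a2 < q\<close> \<open>p * a1' + k * a2' < q\<close> by blast
  qed
  then show "a1 = a1' \<and> a2 = a2' \<and> b1 = b1' \<and> b2 = b2'" using key lt by blast
qed

text \<open>The auxiliary function is the sum of \<open>C s * mo (a1 + p ^ m * b1) (a2 + p ^ m * b2)\<close>. Its \<open>p ^ m\<close>-th
  power equals \<open>U m t A B C\<close> at the points with \<open>x ^ p ^ (2 * m) = x\<close> and \<open>y ^ p ^ (2 * m) = y + t\<close>,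
  because \<open>y ^ p ^ m = y + T m\<close> on the curve.\<close>

definition U :: "nat \<Rightarrow> int \<Rightarrow> nat \<Rightarrow> nat \<Rightarrow> (nat \<times> nat \<times> nat \<times> nat \<Rightarrow> int) \<Rightarrow> int poly poly" where
  "U m t A B C = (\<Sum>(a1, a2, b1, b2)\<in>{..<A} \<times> {..<p} \<times> {..<B} \<times> {..<p}.
     of_int (C (a1, a2, b1, b2)) * (mo (p ^ m * a1 + b1) 0 * (y + [:T m:]) ^ a2 * (y + of_int t) ^ b2))"

lemma U_diff: "U m t A B (\<lambda>s. C s - C' s) = U m t A B C - U m t A B C'"
  unfolding U_def sum_subtractf[symmetric] by (intro sum.cong refl) (auto simp: algebra_simps)

lemma wl_U: "wl (p * (p ^ m * A + B + k * p ^ m + k)) (U m t A B C)"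
  unfolding U_def
proof (intro wl_sum, clarify)
  fix a1 a2 b1 b2 assume lt: "a1 < A" "a2 < p" "b1 < B" "b2 < p"
  let ?q = "p ^ m"
  have w1: "wl (Suc (p * (?q * a1 + b1))) (mo (?q * a1 + b1) 0)" by (intro wl_mo) simp
  have w2: "wl (Suc (k * ?q)) (y + [:T m:])"
    using degree_T[of m] p_gt_1 by (intro wl_add wl_mo) (auto simp: wl_const_iff less_Suc_eq_le)
  have w3: "wl (Suc k) (y + of_int t)"
    by (intro wl_add wl_mo wl_mono[OF wl_of_int]) auto
  have "wl (p * (?q * a1 + b1) + (a2 * (k * ?q) + Suc (b2 * k)))
      (mo (?q * a1 + b1) 0 * ((y + [:T m:]) ^ a2 * (y + of_int t) ^ b2))"
    by (intro wl_mult w1 wl_power w2 w3)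
  moreover have "p * (?q * a1 + b1) + (a2 * (k * ?q) + Suc (b2 * k)) \<le> p * (?q * A + B + k * ?q + k)"
  proof -
    have "?q * a1 \<le> ?q * A" "a2 * (k * ?q) \<le> p * (k * ?q)" using lt by (auto intro!: mult_mono)
    moreover have "Suc (b2 * k) \<le> p * k"
      using mult_le_mono1[of "Suc b2" p k] lt k by simp
    moreover have "?q * a1 + b1 \<le> ?q * A + B" using \<open>?q * a1 \<le> ?q * A\<close> lt by linarith
    then have "p * (?q * a1 + b1) \<le> p * (?q * A + B)" by (rule mult_le_mono2)
    ultimately show ?thesis
      using \<open>a2 * (k * ?q) \<le> p * (k * ?q)\<close> \<open>Suc (b2 * k) \<le> p * k\<close> unfolding distrib_left by linarith
  qed
  ultimately have "wl (p * (?q * A + B + k * ?q + k)) (mo (?q * a1 + b1) 0 * ((y + [:T m:]) ^ a2 * (y + of_int t) ^ b2))"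
    by (rule wl_mono)
  then show "wl (p * (?q * A + B + k * ?q + k))
      (of_int (C (a1, a2, b1, b2)) * (mo (?q * a1 + b1) 0 * (y + [:T m:]) ^ a2 * (y + of_int t) ^ b2))"
    by (intro wl_of_int_mult) (simp only: mult.assoc)
qed

text \<open>A pigeonhole in place of linear algebra over F_p: there are p^(p^2 A B) families of
  coefficients in 0..p-1, but the reduced form of \<open>U\<close> has p coefficients in y, each
  with at most X terms, hence at most p^(p X) values modulo p. The difference d of two families with
  equal values has entries strictly between -p and p.\<close>

lemma auxiliary_function:
  assumes "p ^ m * A + B + k * p ^ m + k < p * A * B"
  shows "\<exists>d. U m t A B d \<in> pid p E \<and>
    (\<forall>s\<in>{..<A} \<times> {..<p} \<times> {..<B} \<times> {..<p}. int p dvd d s \<longrightarrow> d s = 0) \<and>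
    (\<exists>s\<in>{..<A} \<times> {..<p} \<times> {..<B} \<times> {..<p}. d s \<noteq> 0)"
proof -
  define X where "X = p ^ m * A + B + k * p ^ m + k"
  define \<Omega> where "\<Omega> = {..<A} \<times> {..<p} \<times> {..<B} \<times> {..<p}"
  have fin: "finite \<Omega>" by (simp add: \<Omega>_def)
  have "\<forall>C. \<exists>v q. U m t A B C = v + E * q \<and> wl (p * X) v \<and> (\<forall>j\<ge>p. coeff v j = 0)"
    using reduce[OF wl_U] by (simp add: X_def)
  then obtain v q where v: "\<And>C. U m t A B C = v C + E * q C" "\<And>C. wl (p * X) (v C)"
      "\<And>C j. j \<ge> p \<Longrightarrow> coeff (v C) j = 0"
    by metis
  define \<Phi> where "\<Phi> = (\<lambda>C. \<lambda>j\<in>{..<p}. red p (coeff (v C) j))"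
  let ?D = "\<Omega> \<rightarrow>\<^sub>E {0..<int p}" and ?R = "{..<p} \<rightarrow>\<^sub>E small_polys p X"
  have "\<Phi> ` ?D \<subseteq> ?R"
  proof -
    have "red p (coeff (v C) j) \<in> small_polys p X" for C j
    proof -
      have "cc (v C) i j = 0" if "X \<le> i" for i
      proof (rule ccontr)
        assume "cc (v C) i j \<noteq> 0"
        then have "p * i + k * j < p * X" using v(2)[of C] by (auto simp: wl_def)
        then have "p * i < p * X" by linarith
        then show False using that by simp
      qed
      then show ?thesis using p_gt_1 by (auto simp: small_polys_def)
    qed
    then show ?thesis by (auto simp: \<Phi>_def split: if_splits)
  qed
  moreover have "card ?R < card ?D"
  proof -
    have "card \<Omega> = A * p * B * p" by (simp add: \<Omega>_def algebra_simps)
    moreover have "X * p < A * p * B * p" using assms p_gt_1 by (simp add: X_def mult_ac)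
    ultimately have "p ^ (X * p) < p ^ card \<Omega>" using p_gt_1 by (intro power_strict_increasing) auto
    then show ?thesis using small_polys_card(2)[of p X] p_gt_1 fin by (simp add: card_PiE power_mult)
  qed
  moreover have "finite ?R" using small_polys_card(1)[of p X] p_gt_1 by (intro finite_PiE) auto
  ultimately have "\<not> inj_on \<Phi> ?D" by (meson card_inj_on_le leD)
  then obtain C C' where C: "C \<in> ?D" "C' \<in> ?D" "C \<noteq> C'" "\<Phi> C = \<Phi> C'" by (auto simp: inj_on_def)
  define d where "d = (\<lambda>s. C s - C' s)"
  have "dz p (coeff (v C - v C') j)" for j
  proof (cases "j < p")
    case True
    then have "red p (coeff (v C) j) = red p (coeff (v C') j)"
      using C(4) by (auto simp: \<Phi>_def fun_eq_iff restrict_def split: if_splits)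
    then show ?thesis by (simp add: red_eq_iff)
  next
    case False
    then show ?thesis by (simp add: v(3) dz_def)
  qed
  then have "of_nat p dvd v C - v C'" unfolding p_dvd_iff by blast
  then obtain w where "v C - v C' = of_nat p * w" by (elim dvdE)
  then have "U m t A B d = of_nat p * w + E * (q C - q C')"
    unfolding d_def U_diff v(1) by (simp add: algebra_simps)
  then have "U m t A B d \<in> pid p E" by (rule pidI)
  moreover have "d s = 0" if "s \<in> \<Omega>" "int p dvd d s" for s
  proof -
    have "C s \<in> {0..<int p}" "C' s \<in> {0..<int p}" using C that by (auto simp: PiE_iff)
    then have "\<bar>d s\<bar> < int p" by (auto simp: d_def)
    then show ?thesis using that(2) dvd_imp_le_int[of "d s" "int p"] by auto
  qed
  moreover have "\<exists>s\<in>\<Omega>. d s \<noteq> 0"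
    using C(1-3) by (auto simp: d_def fun_eq_iff PiE_iff extensional_def) metis
  ultimately show ?thesis unfolding \<Omega>_def by blast
qed

text \<open>W is nonzero on the curve, since its monomials have distinct weights, but W^q = U = 0
  modulo J = (p, E, G). The iterate of Frobenius of order p^(2 m p) fixes x and y modulo J, hence W,
  so W itself lies in J. Some coefficient of its reduced form is nonzero modulo p and divisible by G
  there, and the weight of W bounds its degree.\<close>

lemma stepanov_degree:
  fixes m A B :: nat and t :: int and G :: "int poly"
  assumes m: "m \<ge> 1" and param: "p ^ m * A + B + k * p ^ m + k < p * A * B" "k * p + p * A \<le> p ^ m"
    and G: "lead_coeff G = 1" "T (2 * m) - of_int t \<in> pid p G"
    and X: "[:0, 1:] ^ p ^ (2 * m) - [:0, 1:] \<in> pid p G"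
  shows "degree G < A + p ^ m * B + k + k * p ^ m"
proof -
  let ?q = "p ^ m" and ?Q = "p ^ (2 * m)"
  define \<Omega> where "\<Omega> = {..<A} \<times> {..<p} \<times> {..<B} \<times> {..<p}"
  have fin: "finite \<Omega>" by (simp add: \<Omega>_def)
  obtain d where d: "U m t A B d \<in> pid p E" "\<And>s. s \<in> \<Omega> \<Longrightarrow> int p dvd d s \<Longrightarrow> d s = 0" "\<exists>s\<in>\<Omega>. d s \<noteq> 0"
    using auxiliary_function[OF param(1), of t] unfolding \<Omega>_def by metis
  define g :: "nat \<times> nat \<times> nat \<times> nat \<Rightarrow> nat" where "g = (\<lambda>(a1, a2, b1, b2). a1 + ?q * b1)"
  define h :: "nat \<times> nat \<times> nat \<times> nat \<Rightarrow> nat" where "h = (\<lambda>(a1, a2, b1, b2). a2 + ?q * b2)"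
  define W where "W = (\<Sum>s\<in>\<Omega>. of_int (d s) * mo (g s) (h s))"
  have "W \<notin> pid p E"
    unfolding W_def
  proof (rule distinct_weights_not_mem)
    have "(\<lambda>s. p * g s + k * h s) = (\<lambda>(a1, a2, b1, b2). p * (a1 + ?q * b1) + k * (a2 + ?q * b2))"
      by (auto simp: g_def h_def)
    then show "inj_on (\<lambda>s. p * g s + k * h s) \<Omega>"
      unfolding \<Omega>_def using weights_inj[OF param(2)] by simp
  qed (use fin d in auto)

  define J where "J = {of_nat p * u + E * v + [:G:] * w | u v w. True}"
  have JI: "of_nat p * u + E * v + [:G:] * w \<in> J" for u v w by (auto simp: J_def)
  interpret J: char_ideal J p
  proof
    show "0 \<in> J" using JI[of 0 0 0] by simp
    show "of_nat p \<in> J" using JI[of 1 0 0] by simp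
    show "prime p" by (rule p)
  next
    fix u v assume "u \<in> J" "v \<in> J"
    then obtain u1 u2 u3 v1 v2 v3 where "u = of_nat p * u1 + E * u2 + [:G:] * u3"
        "v = of_nat p * v1 + E * v2 + [:G:] * v3" by (auto simp: J_def)
    then have "u + v = of_nat p * (u1 + v1) + E * (u2 + v2) + [:G:] * (u3 + v3)"
      by (simp only: algebra_simps)
    then show "u + v \<in> J" by (simp only: JI)
  next
    fix u w assume "u \<in> J"
    then obtain u1 u2 u3 where "u = of_nat p * u1 + E * u2 + [:G:] * u3" by (auto simp: J_def)
    then have "w * u = of_nat p * (w * u1) + E * (w * u2) + [:G:] * (w * u3)"
      by (simp only: algebra_simps)
    then show "w * u \<in> J" by (simp only: JI)
  qed
  have EJ: "J.cg u v" if "u \<simeq> v" for u v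
    using that JI[of _ _ 0] by (auto simp: pid.cg_def J.cg_def elim!: pidE)
  have GJ: "[:u:] \<in> J" if uG: "u \<in> pid p G" for u
  proof -
    obtain c e where u: "u = of_nat p * c + G * e" using uG by (elim pidE)
    have "[:u:] = of_nat p * [:c:] + E * 0 + [:G:] * [:e:]" by (simp add: u of_nat_poly)
    then show ?thesis by (simp only: JI)
  qed
  have x1: "J.cg (mo 1 0 ^ ?Q) (mo 1 0)"
  proof -
    have "mo 1 0 = [:[:0, 1:]:]" by (simp add: mo_def monom_0 monom_Suc)
    then have "mo 1 0 ^ ?Q - mo 1 0 = [:[:0, 1:] ^ ?Q - [:0, 1:]:]" by (simp add: poly_const_pow)
    then show ?thesis unfolding J.cg_def using GJ[OF X] by simp
  qed
  have y1: "J.cg (y ^ ?Q) (y + of_int t)"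
  proof -
    have "(y + [:T (2 * m):]) - (y + of_int t) = [:T (2 * m) - of_int t:]" by (simp add: of_int_poly)
    then have "J.cg (y + [:T (2 * m):]) (y + of_int t)" unfolding J.cg_def using GJ[OF G(2)] by simp
    then show ?thesis using EJ[OF y_frob] J.cg_trans by blast
  qed
  \<comment> \<open>After \<open>p\<close> rounds of Frobenius the translations by \<open>t\<close> cancel.\<close>
  have iter: "J.cg (mo 1 0 ^ p ^ (2 * m * n)) (mo 1 0) \<and> J.cg (y ^ p ^ (2 * m * n)) (y + of_int (int n * t))" for n
  proof (induction n)
    case 0
    show ?case by simp
  next
    case (Suc n)
    have e: "z ^ p ^ (2 * m * Suc n) = (z ^ p ^ (2 * m * n)) ^ ?Q" for z :: "int poly poly"
      by (simp add: power_mult[symmetric] power_add[symmetric] add.commute)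
    have "J.cg (mo 1 0 ^ p ^ (2 * m * Suc n)) (mo 1 0 ^ ?Q)"
      unfolding e using Suc.IH by (intro J.cg_power) simp
    then have 1: "J.cg (mo 1 0 ^ p ^ (2 * m * Suc n)) (mo 1 0)" using x1 J.cg_trans by blast
    have "J.cg (y ^ p ^ (2 * m * Suc n)) ((y + of_int (int n * t)) ^ ?Q)"
      unfolding e using Suc.IH by (intro J.cg_power) simp
    also have "J.cg \<dots> (y ^ ?Q + of_int (int n * t) ^ ?Q)" by (rule J.frob_add)
    also have "J.cg \<dots> ((y + of_int t) + of_int (int n * t))"
      by (intro J.cg_add y1 J.frob_of_int)
    also have "\<dots> = y + of_int (int (Suc n) * t)" by (simp add: algebra_simps)
    finally show ?case using 1 by blast
  qed
  have mo_split: "mo i j = mo 1 0 ^ i * y ^ j" for i j by (simp only: mo_power mo_mult) simp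

  have Wq: "J.cg (W ^ ?q) (U m t A B d)"
  proof -
    have "J.cg (W ^ ?q) (\<Sum>s\<in>\<Omega>. (of_int (d s) * mo (g s) (h s)) ^ ?q)"
      unfolding W_def by (rule J.frob_sum)
    also have "J.cg \<dots> (U m t A B d)"
      unfolding U_def \<Omega>_def[symmetric]
    proof (intro J.cg_sum, clarify)
      fix a1 a2 b1 b2 :: nat
      let ?s = "(a1, a2, b1, b2)"
      have "(of_int (d ?s) * mo (g ?s) (h ?s)) ^ ?q =
          of_int (d ?s) ^ ?q * (mo 1 0 ^ (?q * a1) * (mo 1 0 ^ ?Q) ^ b1 * (y ^ ?q) ^ a2 * (y ^ ?Q) ^ b2)"
        by (simp only: g_def h_def prod.case mo_power mo_mult power_mult_distrib)
          (simp add: algebra_simps mult_2_right power_add)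
      also have "J.cg \<dots> (of_int (d ?s) * (mo 1 0 ^ (?q * a1) * mo 1 0 ^ b1 * (y + [:T m:]) ^ a2 * (y + of_int t) ^ b2))"
        by (intro J.cg_mult J.frob_of_int J.cg_power J.cg_refl x1 y1 EJ[OF y_frob])
      also have "mo 1 0 ^ (?q * a1) * mo 1 0 ^ b1 = mo (?q * a1 + b1) 0"
        by (simp add: mo_power mo_mult)
      finally show "J.cg ((of_int (d ?s) * mo (g ?s) (h ?s)) ^ ?q)
        (of_int (d ?s) * (mo (?q * a1 + b1) 0 * (y + [:T m:]) ^ a2 * (y + of_int t) ^ b2))" .
    qed
    finally show ?thesis .
  qed
  have "U m t A B d \<in> J" using EJ[of "U m t A B d" 0] d(1) by (simp add: J.cg_0_iff pid.cg_0_iff)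
  then have "W ^ ?q \<in> J" using J.cg_mem[OF Wq] by blast
  moreover have "W ^ p ^ (2 * m * p) = W ^ ?q * W ^ (p ^ (2 * m * p) - ?q)"
  proof -
    have "?q \<le> p ^ (2 * m * p)" using p_gt_1 by (intro power_increasing) auto
    then show ?thesis by (simp flip: power_add)
  qed
  ultimately have WQ: "W ^ p ^ (2 * m * p) \<in> J" using J.mult_mem' by metis
  have "J.cg (W ^ p ^ (2 * m * p)) W"
  proof -
    have "J.cg (W ^ p ^ (2 * m * p)) (\<Sum>s\<in>\<Omega>. (of_int (d s) * mo (g s) (h s)) ^ p ^ (2 * m * p))"
      unfolding W_def by (rule J.frob_sum)
    also have "J.cg \<dots> (\<Sum>s\<in>\<Omega>. of_int (d s) * mo (g s) (h s))"
    proof (intro J.cg_sum)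
      fix s
      let ?R = "p ^ (2 * m * p)"
      have "of_int (int p * t) \<in> J" by (rule J.of_int_mem) simp
      then have "J.cg (y + of_int (int p * t)) (y + 0)" by (intro J.cg_add) (auto simp: J.cg_0_iff)
      then have yR: "J.cg (y ^ ?R) y" using iter[of p] J.cg_trans by auto
      have "(of_int (d s) * mo (g s) (h s)) ^ ?R = of_int (d s) ^ ?R * ((mo 1 0 ^ ?R) ^ g s * (y ^ ?R) ^ h s)"
        by (simp only: mo_split[of "g s"] power_mult_distrib power_mult[symmetric] mult.commute)
      also have "J.cg \<dots> (of_int (d s) * (mo 1 0 ^ g s * y ^ h s))"
        using iter[of p] yR by (intro J.cg_mult J.frob_of_int J.cg_power) auto
      finally show "J.cg ((of_int (d s) * mo (g s) (h s)) ^ ?R) (of_int (d s) * mo (g s) (h s))"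
        by (simp only: mo_split[of "g s"])
    qed
    finally show ?thesis by (simp only: W_def)
  qed
  then have WJ: "W \<in> J" using J.cg_mem[OF J.cg_sym] WQ by blast

  define D where "D = p * (A + ?q * B + k + k * ?q)"
  have "wl D W"
    unfolding W_def
  proof (intro wl_sum wl_of_int_mult wl_mo, goal_cases)
    case (1 s)
    then obtain a1 a2 b1 b2 where s: "s = (a1, a2, b1, b2)" "a1 < A" "a2 < p" "b1 < B" "b2 < p"
      by (auto simp: \<Omega>_def)
    have "p * a1 < p * A" "k * a2 \<le> k * p" "p * (?q * b1) \<le> p * (?q * B)" "k * (?q * b2) \<le> k * (?q * p)"
      using s p_gt_1 by auto
    then show ?case unfolding s(1) g_def h_def D_def prod.case distrib_left
      by (simp only: mult_ac)
  qed
  then obtain v c where v: "W = v + E * c" "wl D v" "\<forall>j\<ge>p. coeff v j = 0"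
    using reduce by blast
  obtain u1 u2 u3 where "W = of_nat p * u1 + E * u2 + [:G:] * u3" using WJ by (auto simp: J_def)
  then have "v = of_nat p * u1 + E * (u2 - c) + [:G:] * u3" using v(1) by (simp add: algebra_simps)
  from reduced_mem[OF v(3) this] have vG: "coeff v j \<in> pid p G" for j .
  have "\<exists>j. \<not> dz p (coeff v j)"
  proof (rule ccontr)
    assume "\<not> ?thesis"
    then have "of_nat p dvd v" by (simp only: p_dvd_iff) blast
    then have "v \<in> pid p E" by (auto elim!: dvdE intro: pid.mult_mem')
    then show False using \<open>W \<notin> pid p E\<close> pid.cg_mem[OF mult_E_cg] v(1) by metis
  qed
  then obtain j where j: "\<not> dz p (coeff v j)" ..
  then have nz: "coeff v j \<noteq> 0" by (auto simp: dz_def)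
  have le: "degree G \<le> degree (coeff v j)"
    using pid_small[OF p G(1) vG[of j]] j by (metis not_le)
  have "coeff (coeff v j) (degree (coeff v j)) \<noteq> 0" using nz by simp
  then have "p * degree (coeff v j) + k * j < D" using v(2) unfolding wl_def by blast
  then have "p * degree G < D" using mult_le_mono2[OF le, of p] by linarith
  then show ?thesis by (simp add: D_def)
qed

end

subsection \<open>Additive characters\<close>

definition ee :: "nat \<Rightarrow> int \<Rightarrow> complex"
  where "ee q z = cis (2 * pi * real_of_int z / real q)"

lemma ee_0 [simp]: "ee q 0 = 1"
  by (simp add: ee_def)

lemma ee_add: "ee q (z + w) = ee q z * ee q w"
  by (simp add: ee_def cis_mult[symmetric] algebra_simps add_divide_distrib)

lemma norm_ee [simp]: "norm (ee q z) = 1"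
  by (simp add: ee_def)

lemma ee_uminus: "ee q (- z) = cnj (ee q z)"
  by (simp add: ee_def cis_cnj)

lemma ee_eq_1_iff:
  assumes "q > 0"
  shows "ee q z = 1 \<longleftrightarrow> int q dvd z"
proof -
  have "ee q z = 1 \<longleftrightarrow> cos (2 * pi * real_of_int z / real q) = 1"
    unfolding ee_def complex_eq_iff using sin_squared_eq[of "2 * pi * real_of_int z / real q"] by auto
  also have "\<dots> \<longleftrightarrow> (\<exists>n. 2 * pi * real_of_int z / real q = real_of_int n * 2 * pi)"
    by (simp add: cos_one_2pi_int)
  also have "\<dots> \<longleftrightarrow> (\<exists>n. real_of_int z = real_of_int (int q * n))"
    using assms by (intro ex_cong1) (auto simp: field_simps)
  also have "\<dots> \<longleftrightarrow> int q dvd z" by (simp only: of_int_eq_iff dvd_def)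
  finally show ?thesis .
qed

lemma ee_cong: "q > 0 \<Longrightarrow> [z = w] (mod int q) \<Longrightarrow> ee q z = ee q w"
  using ee_add[of q "z - w" w] by (simp add: ee_eq_1_iff[symmetric] cong_iff_dvd_diff)

lemma ee_of_nat_mult: "ee q (int n * z) = ee q z ^ n"
  by (induction n) (simp_all add: algebra_simps ee_add)

lemma sum_ee:
  assumes "q > 0"
  shows "(\<Sum>z\<in>{0..<int q}. ee q (m * z)) = (if int q dvd m then of_nat q else 0)"
proof -
  have "(\<Sum>z\<in>{0..<int q}. ee q (m * z)) = (\<Sum>j<q. ee q (m * int j))"
    by (rule sum.reindex_bij_witness[of _ int nat]) auto
  also have "\<dots> = (\<Sum>j<q. ee q m ^ j)"
    by (simp add: ee_of_nat_mult[symmetric] mult.commute)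
  also have "\<dots> = (if int q dvd m then of_nat q else 0)"
  proof (cases "int q dvd m")
    case True
    then show ?thesis using ee_eq_1_iff[OF assms, of m] by simp
  next
    case False
    then have "ee q m \<noteq> 1" using ee_eq_1_iff[OF assms] by blast
    moreover have "ee q m ^ q = 1"
      using ee_eq_1_iff[OF assms, of "int q * m"] by (simp add: ee_of_nat_mult)
    ultimately show ?thesis using False geometric_sum[of "ee q m" q] by simp
  qed
  finally show ?thesis .
qed

text \<open>By Dirichlet's simultaneous approximation some power m turns all z_j close to the
  positive real axis. Then no cancellation takes place, and |z_i|^m alone is at most 2 C R^m, which
  fails for large m if |z_i| > R.\<close>

lemma power_sums_bound:
  fixes z :: "nat \<Rightarrow> complex"
  assumes bound: "\<And>m. m \<ge> \<mu> \<Longrightarrow> norm (\<Sum>i<n. z i ^ m) \<le> C * R ^ m" and R: "R > 0" and i: "i < n"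
  shows "norm (z i) \<le> R"
proof (rule ccontr)
  assume "\<not> norm (z i) \<le> R"
  then have "norm (z i) / R > 1" using R by simp
  then obtain K0 where K0: "2 * C < (norm (z i) / R) ^ K0" using real_arch_pow by blast
  \<comment> \<open>A multiple m of \<open>K\<close> is large enough both for the hypothesis, m at
    least \<mu>, and for the contradiction, m at least \<open>K0\<close>.\<close>
  define K where "K = max K0 (max \<mu> 1)"
  have "(norm (z i) / R) ^ K0 \<le> (norm (z i) / R) ^ K"
    using \<open>norm (z i) / R > 1\<close> by (intro power_increasing) (auto simp: K_def)
  define \<theta> where "\<theta> = (\<lambda>i. real K * (Arg (z i) / (2 * pi)))"
  \<comment> \<open>An error of 1/8 of a turn is pi/4, inside the arc of radius pi/3 on which the
    cosine is at least 1/2.\<close>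
  obtain q h where q: "0 < q" "\<And>i. i < n \<Longrightarrow> \<bar>real_of_int q * \<theta> i - real_of_int (h i)\<bar> < 1 / real 8"
  proof -
    have "(8 :: nat) > 0" by simp
    from Dirichlet_approx_simult[OF this, of n \<theta>] show ?thesis using that by (metis of_nat_numeral)
  qed
  define m where "m = nat q * K"
  have rm: "real m = real_of_int q * real K" using q(1) by (simp add: m_def)
  have Re: "Re (z j ^ m) \<ge> norm (z j) ^ m / 2" if "j < n" for j
  proof -
    have "z j = rcis (norm (z j)) (Arg (z j))" by (simp add: rcis_cmod_Arg)
    then have "z j ^ m = rcis (norm (z j) ^ m) (real m * Arg (z j))" by (metis DeMoivre2)
    then have 1: "Re (z j ^ m) = norm (z j) ^ m * cos (real m * Arg (z j))" by simp
    define \<delta> where "\<delta> = real_of_int q * \<theta> j - real_of_int (h j)"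
    have "real m * Arg (z j) = 2 * pi * \<delta> + 2 * pi * real_of_int (h j)"
      by (simp add: \<delta>_def \<theta>_def rm field_simps)
    then have "cos (real m * Arg (z j)) = cos (2 * pi * \<delta>)"
      by (simp only: cos_add cos_int_2pin sin_int_2pin)
    also have "\<dots> \<ge> cos (pi / 3)"
    proof -
      have "\<bar>2 * pi * \<delta>\<bar> \<le> 2 * pi * (1 / 8)"
        using q(2)[OF that] by (simp add: abs_mult \<delta>_def)
      also have "\<dots> \<le> pi / 3" by simp
      finally have "\<bar>2 * pi * \<delta>\<bar> \<le> pi / 3" .
      then have "cos (pi / 3) \<le> cos \<bar>2 * pi * \<delta>\<bar>" by (intro cos_monotone_0_pi_le) auto
      then show ?thesis by simp
    qed
    finally have "cos (real m * Arg (z j)) \<ge> 1 / 2" by (simp add: cos_60)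
    then show ?thesis unfolding 1 using mult_left_mono[of "1/2" _ "norm (z j) ^ m"] by simp
  qed
  have "norm (z i) ^ m / 2 \<le> Re (z i ^ m)" using Re[OF i] .
  also have "\<dots> \<le> (\<Sum>j<n. Re (z j ^ m))"
  proof (rule member_le_sum)
    show "0 \<le> Re (z j ^ m)" if "j \<in> {..<n} - {i}" for j
    proof -
      have "norm (z j) ^ m / 2 \<le> Re (z j ^ m)" using that by (intro Re) simp
      moreover have "0 \<le> norm (z j) ^ m" by simp
      ultimately show ?thesis by linarith
    qed
  qed (use i in auto)
  also have "\<dots> = Re (\<Sum>j<n. z j ^ m)" by simp
  also have "\<dots> \<le> norm (\<Sum>j<n. z j ^ m)" by (rule complex_Re_le_cmod)
  also have "\<dots> \<le> C * R ^ m"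
  proof (rule bound)
    have "1 * K \<le> nat q * K" using q(1) by (intro mult_le_mono1) simp
    then show "\<mu> \<le> m" by (simp add: m_def K_def)
  qed
  finally have "(norm (z i) / R) ^ m \<le> 2 * C" using R by (simp add: power_divide field_simps)
  moreover have "(norm (z i) / R) ^ K0 \<le> (norm (z i) / R) ^ m"
  proof -
    have "1 * K \<le> nat q * K" using q(1) by (intro mult_le_mono1) simp
    then show ?thesis using \<open>norm (z i) / R > 1\<close> by (intro power_increasing) (auto simp: m_def K_def)
  qed
  ultimately show False using K0 by simp
qed

section \<open>The L-function of the character and Weil's bound\<close>

context artin_schreier
begin

text \<open>The sum of f over the roots of a monic h, expressed through power sums.\<close>

definition lam :: "int poly \<Rightarrow> int" where "lam h = a * psum h k + b * psum h 1"

definition ch :: "int poly \<Rightarrow> complex" where "ch h = ee p (lam h)"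

lemma ch_red: "lead_coeff h = 1 \<Longrightarrow> ch (red p h) = ch h"
  unfolding ch_def lam_def using p_gt_1 by (intro ee_cong cong_add cong_mult cong_refl psum_red p) auto

lemma ch_mult:
  assumes "g \<in> mon p d" "h \<in> mon p d'"
  shows "ch (red p (g * h)) = ch g * ch h"
proof -
  have "lead_coeff g = 1" "lead_coeff h = 1" using assms by (auto dest: monD)
  then show ?thesis
    by (simp add: ch_red lead_coeff_mult) (simp add: ch_def lam_def psum_mult algebra_simps flip: ee_add)
qed

lemma ch_1: "ch 1 = 1"
  by (simp add: ch_def lam_def)

text \<open>A permutation of the monic polynomials of degree d multiplies the character by e(- a k /
  p), which is not 1 because p divides neither a nor k; so the sum is 0.\<close>

lemma Lcoeff_vanish:
  assumes "d \<ge> k"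
  shows "Lcoeff p ch d = 0"
proof -
  \<comment> \<open>Adding 1 to this coefficient changes \<open>psum h k\<close> by \<open>- k\<close> and no earlier power sum.\<close>
  define \<tau> where "\<tau> = (\<lambda>h. red p (h + monom 1 (d - k)))"
  have lc: "lead_coeff (h + monom 1 (d - k)) = 1 \<and> degree (h + monom 1 (d - k)) = d" if "h \<in> mon p d" for h
  proof -
    have "degree (monom (1::int) (d - k)) < degree h"
      using monD(1)[OF that] assms k by (intro le_less_trans[OF degree_monom_le]) auto
    moreover have "d - k \<noteq> d" using assms k by simp
    ultimately show ?thesis using monD(1,2)[OF that] by (simp add: degree_add_eq_left lead_coeff_add_le)
  qed
  have mon: "\<tau> h \<in> mon p d" if "h \<in> mon p d" for h
    using red_mon[OF p] lc[OF that] unfolding \<tau>_def by metis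
  have inj: "inj_on \<tau> (mon p d)"
    by (intro inj_onI mon_eqI) (auto simp: \<tau>_def red_eq_iff)
  have "\<tau> ` mon p d = mon p d"
    using mon inj finite_mon by (intro card_subset_eq) (auto simp: card_image)
  then have bij: "bij_betw \<tau> (mon p d) (mon p d)" using inj by (simp add: bij_betw_def)
  have ch: "ch (\<tau> h) = ee p (- a * int k) * ch h" if h: "h \<in> mon p d" for h
  proof -
    let ?h = "h + monom 1 (d - k)"
    have r: "coeff (reflect_poly ?h) i = coeff (reflect_poly h) i + (if i = k then 1 else 0)" for i
      using lc[OF h] monD(1)[OF h] assms by (auto simp: coeff_reflect_poly)
    have small: "psum ?h i = psum h i" if "i < k" for i
      using that
    proof (induction i rule: less_induct)
      case (less i)
      then show ?case by (subst (1 2) psum.simps) (simp add: r)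
    qed
    have "psum ?h k = psum h k - int k"
      by (subst (1 2) psum.simps) (simp add: r small algebra_simps)
    moreover have "psum ?h 1 = psum h 1" using small[of 1] k by simp
    ultimately have "lam ?h = a * (psum h k - int k) + b * psum h 1" by (simp only: lam_def)
    then have "lam ?h = - a * int k + lam h" by (simp add: lam_def algebra_simps)
    moreover have "ch (\<tau> h) = ch ?h" unfolding \<tau>_def using lc[OF h] by (intro ch_red) blast
    ultimately show ?thesis by (simp only: ch_def ee_add)
  qed
  have "Lcoeff p ch d = (\<Sum>h\<in>mon p d. ch (\<tau> h))"
    unfolding Lcoeff_def using bij by (rule sum.reindex_bij_betw[symmetric])
  also have "\<dots> = ee p (- a * int k) * Lcoeff p ch d"
    unfolding Lcoeff_def using ch by (simp add: sum_distrib_left)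
  finally have "(1 - ee p (- a * int k)) * Lcoeff p ch d = 0" by (simp add: algebra_simps)
  moreover have "ee p (- a * int k) \<noteq> 1"
  proof
    assume "ee p (- a * int k) = 1"
    then have "int p dvd a * int k" using p_gt_1 by (simp add: ee_eq_1_iff)
    then have "int p dvd int k" using a p by (metis prime_dvd_mult_iff prime_nat_int_transfer)
    then show False using kp p p_gt_1 by (metis coprime_common_divisor_nat dvd_refl int_dvd_int_iff nat_neq_iff)
  qed
  ultimately show ?thesis by simp
qed

lemma card_mon: "card (mon p d) = p ^ d"
proof -
  have "bij_betw (\<lambda>u. u + monom 1 d) (small_polys p d) (mon p d)"
  proof (rule bij_betwI[where g = "\<lambda>h. h - monom 1 d"])
    show "(\<lambda>u. u + monom 1 d) \<in> small_polys p d \<rightarrow> mon p d"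
    proof
      fix u assume u: "u \<in> small_polys p d"
      then have c: "coeff (u + monom 1 d) i = (if i = d then 1 else coeff u i)" "i > d \<Longrightarrow> coeff u i = 0" for i
        by (auto simp: small_polys_def)
      have "degree (u + monom 1 d) = d"
        by (intro antisym degree_le le_degree) (auto simp only: c, auto)
      then show "u + monom 1 d \<in> mon p d" using u c p_gt_1 by (auto simp: mon_def small_polys_def)
    qed
    show "(\<lambda>h. h - monom 1 d) \<in> mon p d \<rightarrow> small_polys p d"
    proof
      fix h assume h: "h \<in> mon p d"
      have "coeff h i = 0" if "i > d" for i using that monD(1)[OF h] by (simp add: coeff_eq_0)
      then show "h - monom 1 d \<in> small_polys p d"
        using monD(3-5)[OF h] p_gt_1 by (auto simp: small_polys_def le_less)
    qed
  qed auto
  then show ?thesis using small_polys_card[of p d] p_gt_1 by (simp add: bij_betw_same_card[symmetric])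
qed

text \<open>The recurrence for the trivial character, whose coefficient of degree d is p^d.
  Subtracting p times the identity for d - 1 leaves only the last term. The equation counts the
  elements of F_(p^d) by their minimal polynomials.\<close>

lemma sum_degree_irr:
  assumes "d \<ge> 1"
  shows "(\<Sum>P\<in>{P\<in>irr p. degree P dvd d}. degree P) = p ^ d"
proof -
  have rec: "of_nat d * of_nat (p ^ d) = (\<Sum>\<nu>=1..d. Spow p (\<lambda>_. 1) \<nu> * of_nat (p ^ (d - \<nu>)))" for d
    using Lcoeff_recurrence[OF p, of "\<lambda>_. 1" d] by (simp add: Lcoeff_def card_mon)
  obtain e where e: "d = Suc e" using assms by (cases d) auto
  have split: "(\<Sum>\<nu>=1..d. g \<nu>) = (\<Sum>\<nu>=1..e. g \<nu>) + g d" for g :: "nat \<Rightarrow> complex"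
    by (simp add: e)
  have "of_nat d * of_nat (p ^ d) = (\<Sum>\<nu>=1..e. Spow p (\<lambda>_. 1) \<nu> * of_nat (p ^ (d - \<nu>))) + Spow p (\<lambda>_. 1) d"
    unfolding rec[of d] by (subst split) simp
  also have "(\<Sum>\<nu>=1..e. Spow p (\<lambda>_. 1) \<nu> * of_nat (p ^ (d - \<nu>))) = of_nat p * (of_nat e * of_nat (p ^ e))"
    unfolding rec[of e] sum_distrib_left by (intro sum.cong) (auto simp: e Suc_diff_le)
  finally have "Spow p (\<lambda>_. 1) d = of_nat (p ^ d)" by (simp add: e algebra_simps)
  then have "complex_of_nat (\<Sum>P\<in>{P\<in>irr p. degree P dvd d}. degree P) = of_nat (p ^ d)"
    by (simp add: Spow_def)
  then show ?thesis by (simp only: of_nat_eq_iff)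
qed

text \<open>Each P stands for its deg P roots in F_(p^\<nu>), and the condition says that f has
  trace t at them. The degrees thus add up to the number of x with trace t.\<close>

definition fib :: "nat \<Rightarrow> int \<Rightarrow> int poly set"
  where "fib \<nu> t = {P\<in>irr p. degree P dvd \<nu> \<and> int (\<nu> div degree P) * lam P mod int p = t}"

lemma finite_fib: "\<nu> \<ge> 1 \<Longrightarrow> finite (fib \<nu> t)"
  using finite_irr_dvd[of \<nu> p] by (auto simp: fib_def intro: finite_subset[rotated])

lemma fib_bound:
  assumes m: "p * k * (k + 1) + 2 * k + 1 < p ^ (m - 1)" "m \<ge> 1"
  shows "(\<Sum>P\<in>fib (2 * m) t. degree P) \<le> p ^ (2 * m - 1) + (2 * k + 2) * p ^ m"
proof -
  \<comment> \<open>\<open>A\<close> is the largest value that \<open>param2\<close> admits. In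
    \<open>p * A * B\<close> the summand k of \<open>B\<close> makes up for the loss of k in
    \<open>A\<close>, and the summand 1 leaves a surplus p^m, which exceeds the lower order terms by
    \<open>key\<close>.\<close>
  define A where "A = p ^ (m - 1) - k"
  define B where "B = p ^ (m - 1) + k + 1"
  define G where "G = \<Prod>(fib (2 * m) t)"
  obtain n where n: "m = Suc n" using m(2) by (cases m) auto
  have fin: "finite (fib (2 * m) t)" using m by (intro finite_fib) simp
  have irr: "P \<in> irr p" if "P \<in> fib (2 * m) t" for P using that by (simp add: fib_def)
  have kn: "k \<le> p ^ n" using m(1) n by simp
  then have Ak: "A + k = p ^ n" by (simp add: A_def n)
  have key: "p * k * (k + 1) + 2 * k + 1 + p ^ n < p ^ m"
  proof -
    have "p ^ (m - 1) = p ^ n" "2 * p ^ n \<le> p ^ m" using p_gt_1 by (simp_all add: n)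
    then show ?thesis using m(1) by linarith
  qed
  have param1: "p ^ m * A + B + k * p ^ m + k < p * A * B"
  proof -
    have "p * A * B + p * k * B = p * p ^ n * B" by (simp add: Ak[symmetric] algebra_simps)
    also have "\<dots> = p ^ m * (p ^ n + k + 1)" by (simp add: B_def n)
    finally have 1: "p * A * B + p * k * B = p ^ m * p ^ n + p ^ m * k + p ^ m" by (simp add: algebra_simps)
    have 2: "p * k * B = p ^ m * k + p * k * (k + 1)" by (simp add: B_def n algebra_simps)
    have 3: "p ^ m * A + k * p ^ m = p ^ m * p ^ n" by (simp add: Ak[symmetric] algebra_simps)
    have "p * A * B + p * k * (k + 1) = p ^ m * p ^ n + p ^ m" using 1 2 by linarith
    moreover have "p ^ m * A + B + k * p ^ m + k = p ^ m * p ^ n + p ^ n + 2 * k + 1"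
      using 3 by (simp add: B_def n)
    ultimately show ?thesis using key by linarith
  qed
  have param2: "k * p + p * A \<le> p ^ m"
  proof -
    have "k * p + p * A = p * (A + k)" by (simp add: algebra_simps)
    then show ?thesis unfolding Ak n by simp
  qed
  have lc: "lead_coeff G = 1" unfolding G_def lead_coeff_prod using irrD(3)[OF irr] by (simp add: prod.neutral)
  have "degree G = (\<Sum>P\<in>fib (2 * m) t. degree P)"
    unfolding G_def using irrD(2)[OF irr] by (intro degree_prod_eq_sum_degree) fastforce
  moreover have "degree G < A + p ^ m * B + k + k * p ^ m"
  proof (rule stepanov_degree[OF m(2) param1 param2 lc])
    have *: "T (2 * m) - of_int t \<in> pid p P \<and> [:0, 1:] ^ p ^ (2 * m) - [:0, 1:] \<in> pid p P" if Pf: "P \<in> fib (2 * m) t" for P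
    proof -
      interpret irreducible_mod p P using irr[OF Pf] p by unfold_locales
      obtain j where j: "2 * m = degree P * j" using Pf by (auto simp: fib_def)
      then have "2 * m div degree P = j" using irrD(2)[OF irr[OF Pf]] by simp
      then have t: "int j * lam P mod int p = t" using Pf by (simp add: fib_def)
      have "pid.cg p P (T (2 * m)) (of_int (int j * lam P))"
        using trace_psum[of k a b j] k unfolding T_def f_def lam_def j by simp
      moreover have "pid.cg p P (of_int (int j * lam P)) (of_int t)"
        by (rule of_int_cg) (simp add: Cong.cong_def t[symmetric])
      ultimately have "pid.cg p P (T (2 * m)) (of_int t)" by (rule pid.cg_trans)
      moreover have "pid.cg p P (X ^ p ^ (2 * m)) X" unfolding j by (rule frob_degree_fixed)
      ultimately show ?thesis by (simp add: pid.cg_def)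
    qed
    show "T (2 * m) - of_int t \<in> pid p G"
      unfolding G_def using * irr by (intro pid_prod_irr[OF p fin]) auto
    show "[:0, 1:] ^ p ^ (2 * m) - [:0, 1:] \<in> pid p G"
      unfolding G_def using * irr by (intro pid_prod_irr[OF p fin]) auto
  qed
  moreover have "A + p ^ m * B + k + k * p ^ m \<le> p ^ (2 * m - 1) + (2 * k + 2) * p ^ m"
  proof -
    have "p ^ m * B = p ^ (2 * m - 1) + k * p ^ m + p ^ m"
      by (simp add: B_def n algebra_simps mult_2_right power_add)
    moreover have "A + k \<le> p ^ m" unfolding Ak n using p_gt_1 by simp
    ultimately show ?thesis by (simp add: algebra_simps)
  qed
  ultimately show ?thesis by linarith
qed

text \<open>The expected size p^(2m-1) of a fibre drops out, since the character sums to 0 over t.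
  The deviations \<delta> add up to 0 and are at most \<open>M\<close>, which also controls their
  absolute values.\<close>

lemma Spow_bound:
  assumes m: "p * k * (k + 1) + 2 * k + 1 < p ^ (m - 1)" "m \<ge> 1"
  shows "norm (Spow p ch (2 * m)) \<le> 2 * real p * (2 * real k + 2) * real p ^ m"
proof -
  define N where "N = (\<lambda>t. \<Sum>P\<in>fib (2 * m) t. degree P)"
  define \<delta> where "\<delta> = (\<lambda>t. real (N t) - real p ^ (2 * m - 1))"
  define M where "M = (2 * real k + 2) * real p ^ m"
  let ?I = "{P\<in>irr p. degree P dvd 2 * m}"
  have fin: "finite ?I" using m by (intro finite_irr_dvd) simp
  have fib: "fib (2 * m) t = {P\<in>?I. int (2 * m div degree P) * lam P mod int p = t}" for t
    by (auto simp: fib_def)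
  have p0: "int p > 0" using p_gt_1 by simp
  have img: "(\<lambda>P. int (2 * m div degree P) * lam P mod int p) ` ?I \<subseteq> {0..<int p}" using p0 by auto
  have "Spow p ch (2 * m) = (\<Sum>P\<in>?I. of_nat (degree P) * ee p (int (2 * m div degree P) * lam P mod int p))"
    unfolding Spow_def ch_def ee_of_nat_mult[symmetric]
    using p_gt_1 by (intro sum.cong arg_cong2[of _ _ _ _ "(*)"] ee_cong) (auto simp: Cong.cong_def)
  also have "\<dots> = (\<Sum>t\<in>{0..<int p}. \<Sum>P\<in>fib (2 * m) t. of_nat (degree P) * ee p (int (2 * m div degree P) * lam P mod int p))"
    unfolding fib by (rule sum.group[symmetric, OF fin _ img]) simp
  also have "\<dots> = (\<Sum>t\<in>{0..<int p}. of_nat (N t) * ee p t)"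
    by (intro sum.cong) (auto simp: N_def fib sum_distrib_right)
  also have "\<dots> = (\<Sum>t\<in>{0..<int p}. of_real (\<delta> t) * ee p t) + of_real (real p ^ (2 * m - 1)) * (\<Sum>t\<in>{0..<int p}. ee p (1 * t))"
    unfolding sum_distrib_left sum.distrib[symmetric]
    by (intro sum.cong) (simp_all add: \<delta>_def algebra_simps)
  also have "(\<Sum>t\<in>{0..<int p}. ee p (1 * t)) = 0" using sum_ee[of p 1] p_gt_1 by simp
  finally have S: "Spow p ch (2 * m) = (\<Sum>t\<in>{0..<int p}. of_real (\<delta> t) * ee p t)" by simp
  have "(\<Sum>t\<in>{0..<int p}. N t) = (\<Sum>P\<in>?I. degree P)"
    unfolding N_def fib by (rule sum.group[OF fin _ img]) simp
  also have "\<dots> = p ^ (2 * m)" using m by (intro sum_degree_irr) simp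
  finally have "(\<Sum>t\<in>{0..<int p}. real (N t)) = real p ^ (2 * m)"
    by (metis of_nat_power of_nat_sum)
  moreover have "real p * real p ^ (2 * m - 1) = real p ^ (2 * m)" using m by (simp add: power_eq_if)
  ultimately have \<delta>0: "(\<Sum>t\<in>{0..<int p}. \<delta> t) = 0" by (simp add: \<delta>_def sum_subtractf)
  have \<delta>M: "\<delta> t \<le> M" for t
  proof -
    have "real (N t) \<le> real (p ^ (2 * m - 1) + (2 * k + 2) * p ^ m)"
      using fib_bound[OF m, of t] unfolding N_def by (rule of_nat_mono)
    then show ?thesis by (simp add: \<delta>_def M_def algebra_simps)
  qed
  have "norm (Spow p ch (2 * m)) \<le> (\<Sum>t\<in>{0..<int p}. norm (of_real (\<delta> t) * ee p t))"
    unfolding S by (rule norm_sum)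
  also have "\<dots> = (\<Sum>t\<in>{0..<int p}. \<bar>\<delta> t\<bar>)" by (simp add: norm_mult)
  \<comment> \<open>The absolute value of \<delta> is 2 max(\<delta>, 0) - \<delta>.\<close>
  also have "\<dots> \<le> (\<Sum>t\<in>{0..<int p}. 2 * M - \<delta> t)"
    using \<delta>M M_def by (intro sum_mono) (smt (verit) mult_nonneg_nonneg of_nat_0_le_iff zero_le_power)
  also have "\<dots> = 2 * real p * M" using \<delta>0 by (simp add: sum_subtractf)
  finally show ?thesis by (simp add: M_def mult_ac)
qed

text \<open>The exponential sum is \<open>Spow\<close> of order 1, because the monic linear
  polynomials are the x - c. \<open>Q\<close> is the reversed L-function, so its roots are the
  inverse zeros, and Newton's identities match \<open>Lcoeff_recurrence\<close> up to sign.\<close>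

theorem weil_bound: "norm (\<Sum>x\<in>{0..<int p}. ee p (a * x ^ k + b * x)) \<le> (real k - 1) * sqrt (real p)"
proof -
  define c where "c = Lcoeff p ch"
  have c0: "c 0 = 1" by (simp add: c_def Lcoeff_def mon_0[OF p] ch_1)
  have rec: "of_nat d * c d = (\<Sum>\<nu>=1..d. Spow p ch \<nu> * c (d - \<nu>))" for d
    unfolding c_def by (rule Lcoeff_recurrence[where \<xi> = ch]) (auto intro: p ch_1 ch_mult)
  define Q where "Q = (\<Sum>i\<le>k-1. monom (c (k - 1 - i)) i)"
  have cQ: "coeff Q i = (if i \<le> k - 1 then c (k - 1 - i) else 0)" for i
    by (simp add: Q_def coeff_sum)
  have dQ: "degree Q = k - 1"
    by (intro antisym degree_le le_degree) (auto simp: cQ c0)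
  have lQ: "lead_coeff Q = 1" by (simp add: dQ cQ c0)
  have rQ: "coeff (reflect_poly Q) i = c i" for i
  proof (cases "i \<le> k - 1")
    case True
    then have "k - 1 - (k - 1 - i) = i" by simp
    then show ?thesis using True by (simp add: coeff_reflect_poly dQ cQ)
  next
    case False
    then show ?thesis using Lcoeff_vanish[of i] by (simp add: coeff_reflect_poly dQ c_def)
  qed
  have S: "Spow p ch \<nu> = - psum Q \<nu>" if "\<nu> \<ge> 1" for \<nu>
    using that
  proof (induction \<nu> rule: less_induct)
    case (less \<nu>)
    then have "{1..\<nu>} = insert \<nu> {1..<\<nu>}" by auto
    then have "of_nat \<nu> * c \<nu> = Spow p ch \<nu> + (\<Sum>i=1..<\<nu>. Spow p ch i * c (\<nu> - i))"
      using rec[of \<nu>] c0 by simp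
    also have "(\<Sum>i=1..<\<nu>. Spow p ch i * c (\<nu> - i)) = - (\<Sum>i=1..<\<nu>. psum Q i * c (\<nu> - i))"
      using less by (simp add: sum_negf)
    also have "(\<Sum>i=1..<\<nu>. psum Q i * c (\<nu> - i)) = (\<Sum>i=1..<\<nu>. c i * psum Q (\<nu> - i))"
      by (rule sum.reindex_bij_witness[of _ "\<lambda>i. \<nu> - i" "\<lambda>i. \<nu> - i"]) auto
    finally have "Spow p ch \<nu> = of_nat \<nu> * c \<nu> + (\<Sum>i=1..<\<nu>. c i * psum Q (\<nu> - i))" by simp
    then show ?case by (subst psum.simps) (simp add: rQ)
  qed
  obtain R where R: "size R = degree Q" "Q = smult (lead_coeff Q) (\<Prod>x\<in>#R. [:- x, 1:])"
    using alg_closed_imp_factorization[of Q] lQ by fastforce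
  obtain xs where xs: "mset xs = R" using ex_mset by blast
  define \<omega> where "\<omega> = (\<lambda>i. xs ! i)"
  have len: "length xs = k - 1" using R(1) xs dQ by (metis size_mset)
  have "Q = (\<Prod>x\<in>#mset xs. [:- x, 1:])" using R(2) lQ xs by simp
  also have "\<dots> = prod_list (map (\<lambda>x. [:- x, 1:]) xs)" by (simp flip: prod_mset_prod_list)
  also have "\<dots> = (\<Prod>i<k-1. [:- \<omega> i, 1:])"
    by (simp add: prod.list_conv_set_nth \<omega>_def len lessThan_atLeast0)
  finally have Q\<omega>: "psum Q \<nu> = (\<Sum>i<k-1. \<omega> i ^ \<nu>)" if "\<nu> \<ge> 1" for \<nu>
    using that by (simp add: psum_prod_linear)
  obtain m0 where m0: "m0 \<ge> 1" "p * k * (k + 1) + 2 * k + 1 < p ^ (m0 - 1)"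
  proof -
    define n where "n = p * k * (k + 1) + 2 * k + 1"
    have "n < 2 ^ n" by (rule less_exp)
    also have "(2 :: nat) ^ n \<le> p ^ n" using p_gt_1 by (intro power_mono) auto
    finally have "p * k * (k + 1) + 2 * k + 1 < p ^ n" by (simp only: n_def)
    then show ?thesis using that[of "Suc n"] by simp
  qed
  have "norm (\<omega> i) \<le> sqrt (real p)" if i: "i < k - 1" for i
  proof -
    \<comment> \<open>Only even orders have been bounded, so the bound on power sums is applied to
      the squares of the inverse zeros.\<close>
    have "norm (\<omega> i ^ 2) \<le> real p"
    proof (rule power_sums_bound[where \<mu> = m0 and n = "k - 1" and z = "\<lambda>i. \<omega> i ^ 2" and C = "2 * real p * (2 * real k + 2)"])
      fix m assume "m \<ge> m0"
      then have "p ^ (m0 - 1) \<le> p ^ (m - 1)"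
        using p_gt_1 by (intro power_increasing diff_le_mono) auto
      then have m: "p * k * (k + 1) + 2 * k + 1 < p ^ (m - 1)" "m \<ge> 1"
        using m0 \<open>m \<ge> m0\<close> by linarith+
      have "(\<Sum>i<k-1. (\<omega> i ^ 2) ^ m) = - Spow p ch (2 * m)"
        using m S[of "2 * m"] Q\<omega>[of "2 * m"] by (simp add: power_mult[symmetric])
      then show "norm (\<Sum>i<k-1. (\<omega> i ^ 2) ^ m) \<le> 2 * real p * (2 * real k + 2) * real p ^ m"
        using Spow_bound[OF m] by simp
    qed (use p_gt_1 i in auto)
    then show ?thesis by (simp add: norm_power real_le_rsqrt)
  qed
  then have "norm (\<Sum>i<k-1. \<omega> i ^ 1) \<le> (\<Sum>i<k-1. sqrt (real p))"
    by (intro sum_norm_le) auto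
  then have "norm (Spow p ch 1) \<le> (real k - 1) * sqrt (real p)"
    using S[of 1] Q\<omega>[of 1] k by (simp add: of_nat_diff)
  moreover have "Spow p ch 1 = (\<Sum>x\<in>{0..<int p}. ee p (a * x ^ k + b * x))"
  proof -
    have inj: "inj_on (\<lambda>x. red p [:- x, 1:]) {0..<int p}"
    proof (rule inj_onI)
      fix x x' assume x: "x \<in> {0..<int p}" "x' \<in> {0..<int p}" "red p [:- x, 1:] = red p [:- x', 1:]"
      then have "dz p ([:- x, 1:] - [:- x', 1:])" by (simp only: red_eq_iff)
      then have "int p dvd x' - x" by (auto simp: dz_def dest: spec[of _ 0])
      then have "x mod int p = x' mod int p" by (metis mod_eq_dvd_iff)
      then show "x = x'" using x by simp
    qed
    have sub: "(\<lambda>x. red p [:- x, 1:]) ` {0..<int p} \<subseteq> mon p 1"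
      using red_mon[OF p, of "[:- x, 1:]" for x] by auto
    have "bij_betw (\<lambda>x. red p [:- x, 1:]) {0..<int p} (mon p 1)"
      unfolding bij_betw_def using inj sub
      by (intro conjI card_subset_eq finite_mon) (auto simp: card_image card_mon)
    then have "c 1 = (\<Sum>x\<in>{0..<int p}. ch (red p [:- x, 1:]))"
      unfolding c_def Lcoeff_def by (rule sum.reindex_bij_betw[symmetric])
    also have "\<dots> = (\<Sum>x\<in>{0..<int p}. ee p (a * x ^ k + b * x))"
    proof (intro sum.cong refl)
      fix x :: int
      have "psum [:- x, 1:] k = x ^ k" "psum [:- x, 1:] 1 = x ^ 1"
        using k by (intro psum_linear; simp)+
      then show "ch (red p [:- x, 1:]) = ee p (a * x ^ k + b * x)"
        by (simp add: ch_red) (simp add: ch_def lam_def)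
    qed
    finally show ?thesis using rec[of 1] c0 by simp
  qed
  ultimately show ?thesis by simp
qed

end

subsection \<open>Binomial exponential sums modulo prime powers\<close>

lemma sum_residues_split:
  fixes F :: "int \<Rightarrow> 'a::comm_monoid_add"
  assumes "q1 > 0" "q2 > 0"
  shows "(\<Sum>z\<in>{0..<int (q1 * q2)}. F z) = (\<Sum>u\<in>{0..<int q1}. \<Sum>v\<in>{0..<int q2}. F (u + int q1 * v))"
proof -
  have "(\<Sum>u\<in>{0..<int q1}. \<Sum>v\<in>{0..<int q2}. F (u + int q1 * v)) =
      (\<Sum>(u, v)\<in>{0..<int q1} \<times> {0..<int q2}. F (u + int q1 * v))"
    by (simp add: sum.cartesian_product)
  also have "\<dots> = (\<Sum>z\<in>{0..<int (q1 * q2)}. F z)"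
  proof (rule sum.reindex_bij_witness[of _ "\<lambda>z. (z mod int q1, z div int q1)" "\<lambda>(u, v). u + int q1 * v"])
    fix uv assume "uv \<in> {0..<int q1} \<times> {0..<int q2}"
    then obtain u v where uv: "uv = (u, v)" "0 \<le> u" "u < int q1" "0 \<le> v" "v + 1 \<le> int q2" by auto
    have "int q1 * (v + 1) \<le> int q1 * int q2" using uv by (intro mult_left_mono) auto
    then show "(case uv of (u, v) \<Rightarrow> u + int q1 * v) \<in> {0..<int (q1 * q2)}"
      using uv by (auto simp: algebra_simps)
    show "((case uv of (u, v) \<Rightarrow> u + int q1 * v) mod int q1, (case uv of (u, v) \<Rightarrow> u + int q1 * v) div int q1) = uv"
      using uv assms by simp
  next
    fix z assume z: "z \<in> {0..<int (q1 * q2)}"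
    have "z div int q1 < int q2"
    proof (rule ccontr)
      assume "\<not> z div int q1 < int q2"
      then have "int q1 * int q2 \<le> int q1 * (z div int q1)" by (intro mult_left_mono) auto
      moreover have "int q1 * (z div int q1) + z mod int q1 = z" by simp
      moreover have "0 \<le> z mod int q1" using assms by simp
      ultimately show False using z unfolding atLeastLessThan_iff of_nat_mult by linarith
    qed
    then show "(z mod int q1, z div int q1) \<in> {0..<int q1} \<times> {0..<int q2}"
      using z assms by (simp add: pos_imp_zdiv_nonneg_iff)
    show "(case (z mod int q1, z div int q1) of (u, v) \<Rightarrow> u + int q1 * v) = z" by simp
  qed auto
  finally show ?thesis ..
qed

lemma sum_residues_shift:
  fixes F :: "int \<Rightarrow> 'a::comm_monoid_add"
  assumes "q > 0" and F: "\<And>z w. [z = w] (mod int q) \<Longrightarrow> F z = F w"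
  shows "(\<Sum>z\<in>{0..<int q}. F (z + c)) = (\<Sum>z\<in>{0..<int q}. F z)"
proof (rule sum.reindex_bij_witness[of _ "\<lambda>z. (z - c) mod int q" "\<lambda>z. (z + c) mod int q"])
  fix z assume "z \<in> {0..<int q}"
  then show "((z + c) mod int q - c) mod int q = z" "((z - c) mod int q + c) mod int q = z"
    by (auto simp: mod_simps)
  show "F ((z + c) mod int q) = F (z + c)" by (rule F) (simp add: Cong.cong_def)
qed (use assms in auto)

definition gs :: "nat \<Rightarrow> nat \<Rightarrow> int \<Rightarrow> int \<Rightarrow> complex"
  where "gs q k a b = (\<Sum>z\<in>{0..<int q}. ee q (a * z ^ k + b * z))"

lemma ee_scale: "m > 0 \<Longrightarrow> ee (m * q) (int m * z) = ee q z"
  by (simp add: ee_def) (simp add: mult.assoc)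

text \<open>With h = z - w the phase of the squared sum is linear in w; since 2 a is a unit modulo
  q, only h = 0 survives.\<close>

lemma gs_quadratic:
  assumes q: "q > 0" and a: "coprime (2 * a) (int q)"
  shows "norm (gs q 2 a b) ^ 2 = real q"
proof -
  let ?F = "\<lambda>z. ee q (a * z ^ 2 + b * z)"
  have F: "?F z = ?F w" if "[z = w] (mod int q)" for z w
    using that q by (intro ee_cong cong_add cong_mult cong_pow cong_refl) auto
  have "gs q 2 a b * cnj (gs q 2 a b) = (\<Sum>w\<in>{0..<int q}. cnj (?F w) * (\<Sum>z\<in>{0..<int q}. ?F z))"
    unfolding sum_distrib_right[symmetric] gs_def by (simp add: mult.commute)
  also have "\<dots> = (\<Sum>w\<in>{0..<int q}. cnj (?F w) * (\<Sum>h\<in>{0..<int q}. ?F (h + w)))"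
    using sum_residues_shift[OF q, of ?F, OF F] by simp
  also have "\<dots> = (\<Sum>w\<in>{0..<int q}. \<Sum>h\<in>{0..<int q}. ee q (a * h ^ 2 + b * h) * ee q (2 * a * h * w))"
    unfolding sum_distrib_left
    by (intro sum.cong refl) (simp add: ee_uminus[symmetric] ee_add[symmetric] algebra_simps power2_eq_square)
  also have "\<dots> = (\<Sum>h\<in>{0..<int q}. ee q (a * h ^ 2 + b * h) * (\<Sum>w\<in>{0..<int q}. ee q (2 * a * h * w)))"
    by (subst sum.swap) (simp add: sum_distrib_left)
  also have "\<dots> = (\<Sum>h\<in>{0..<int q}. if h = 0 then of_nat q else 0)"
  proof (intro sum.cong refl)
    fix h assume h: "h \<in> {0..<int q}"
    have "int q dvd 2 * a * h \<longleftrightarrow> int q dvd h"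
      using a by (simp add: coprime_dvd_mult_right_iff coprime_commute)
    also have "\<dots> \<longleftrightarrow> h = 0" using h by (auto dest: zdvd_imp_le)
    finally show "ee q (a * h ^ 2 + b * h) * (\<Sum>w\<in>{0..<int q}. ee q (2 * a * h * w)) = (if h = 0 then of_nat q else 0)"
      using sum_ee[OF q, of "2 * a * h"] by auto
  qed
  also have "\<dots> = of_nat q" using q by simp
  finally have "complex_of_real (norm (gs q 2 a b) ^ 2) = of_real (real q)"
    by (simp only: complex_norm_square of_real_of_nat_eq)
  then show ?thesis by (simp only: of_real_eq_iff)
qed

text \<open>Write z = u + p^g v. Since 2 g is at least g + h, the phase is linear in v, and the sum
  over v keeps the u at which p^h divides the derivative.\<close>

lemma gs_stationary:
  assumes p: "p > 0" and gh: "h \<le> g" and k: "k \<ge> 1"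
  shows "gs (p ^ (g + h)) k a b = of_nat (p ^ h) *
    (\<Sum>u\<in>{u\<in>{0..<int (p ^ g)}. int (p ^ h) dvd int k * a * u ^ (k - 1) + b}. ee (p ^ (g + h)) (a * u ^ k + b * u))"
proof -
  let ?q = "p ^ (g + h)"
  have q: "?q > 0" using p by simp
  have taylor: "ee ?q (a * (u + int (p ^ g) * v) ^ k + b * (u + int (p ^ g) * v)) =
      ee ?q (a * u ^ k + b * u) * ee (p ^ h) ((int k * a * u ^ (k - 1) + b) * v)" for u v
  proof -
    let ?x = "int (p ^ g) * v"
    have "?x ^ 2 dvd (u + ?x) ^ k - (u ^ k + int k * u ^ (k - 1) * ?x)" for k
    proof (induction k)
      case (Suc k)
      have "(u + ?x) ^ Suc k - (u ^ Suc k + int (Suc k) * u ^ (Suc k - 1) * ?x) =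
          (u + ?x) * ((u + ?x) ^ k - (u ^ k + int k * u ^ (k - 1) * ?x)) + int k * u ^ (k - 1) * ?x ^ 2"
        by (cases k) (simp_all add: algebra_simps power2_eq_square)
      then show ?case using Suc.IH by (metis dvd_add dvd_mult dvd_refl)
    qed simp
    moreover have "int ?q dvd ?x ^ 2"
    proof -
      have "int (p ^ (g + h)) dvd int (p ^ (g + g))" using gh by (intro of_nat_dvd_iff[THEN iffD2] le_imp_power_dvd) simp
      moreover have "?x ^ 2 = int (p ^ (g + g)) * v ^ 2" by (simp add: power_mult_distrib power_add power2_eq_square)
      ultimately show ?thesis by simp
    qed
    ultimately have "int ?q dvd (u + ?x) ^ k - (u ^ k + int k * u ^ (k - 1) * ?x)" by (rule dvd_trans[rotated])
    then have "[(u + ?x) ^ k = u ^ k + int k * u ^ (k - 1) * ?x] (mod int ?q)" by (simp add: cong_iff_dvd_diff)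
    then have "[a * (u + ?x) ^ k + b * (u + ?x) = a * (u ^ k + int k * u ^ (k - 1) * ?x) + b * (u + ?x)] (mod int ?q)"
      by (intro cong_add cong_mult cong_refl)
    then have "ee ?q (a * (u + ?x) ^ k + b * (u + ?x)) = ee ?q (a * (u ^ k + int k * u ^ (k - 1) * ?x) + b * (u + ?x))"
      by (rule ee_cong[OF q])
    also have "\<dots> = ee ?q (a * u ^ k + b * u) * ee ?q (int (p ^ g) * ((int k * a * u ^ (k - 1) + b) * v))"
      by (simp add: ee_add[symmetric] algebra_simps)
    also have "ee ?q (int (p ^ g) * ((int k * a * u ^ (k - 1) + b) * v)) = ee (p ^ h) ((int k * a * u ^ (k - 1) + b) * v)"
      using ee_scale[of "p ^ g" "p ^ h"] p by (simp add: power_add)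
    finally show ?thesis .
  qed
  have "gs ?q k a b = (\<Sum>u\<in>{0..<int (p ^ g)}. \<Sum>v\<in>{0..<int (p ^ h)}.
      ee ?q (a * (u + int (p ^ g) * v) ^ k + b * (u + int (p ^ g) * v)))"
    unfolding gs_def using sum_residues_split[of "p ^ g" "p ^ h"] p by (simp add: power_add)
  also have "\<dots> = (\<Sum>u\<in>{0..<int (p ^ g)}. ee ?q (a * u ^ k + b * u) *
      (\<Sum>v\<in>{0..<int (p ^ h)}. ee (p ^ h) ((int k * a * u ^ (k - 1) + b) * v)))"
    unfolding taylor sum_distrib_left ..
  also have "\<dots> = (\<Sum>u\<in>{0..<int (p ^ g)}. if int (p ^ h) dvd int k * a * u ^ (k - 1) + b
      then of_nat (p ^ h) * ee ?q (a * u ^ k + b * u) else 0)"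
  proof (intro sum.cong refl)
    fix u
    have "p ^ h > 0" using p by simp
    from sum_ee[OF this, of "int k * a * u ^ (k - 1) + b"]
    show "ee ?q (a * u ^ k + b * u) * (\<Sum>v\<in>{0..<int (p ^ h)}. ee (p ^ h) ((int k * a * u ^ (k - 1) + b) * v)) =
      (if int (p ^ h) dvd int k * a * u ^ (k - 1) + b then of_nat (p ^ h) * ee ?q (a * u ^ k + b * u) else 0)"
      by simp
  qed
  also have "\<dots> = (\<Sum>u\<in>{u\<in>{0..<int (p ^ g)}. int (p ^ h) dvd int k * a * u ^ (k - 1) + b}.
      of_nat (p ^ h) * ee ?q (a * u ^ k + b * u))"
    by (rule sum.inter_filter[symmetric]) simp
  finally show ?thesis by (simp only: sum_distrib_left)
qed

lemma prime_ring_ideal_int: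
  assumes "prime p"
  shows "prime_ring_ideal (pid p (0 :: int))"
proof -
  have p: "prime (int p)" using assms by simp
  have 1: "1 \<notin> pid p (0 :: int)"
    using prime_gt_1_nat[OF assms] by (simp add: mem_pid_int)
  have 2: "u \<in> pid p 0 \<or> v \<in> pid p 0" if "u * v \<in> pid p (0 :: int)" for u v
    using that prime_dvd_multD[OF p, of u v] by (simp only: mem_pid_int)
  show ?thesis
    by (rule prime_ring_ideal.intro[OF ring_ideal_pid], rule prime_ring_ideal_axioms.intro, rule 1, rule 2)
qed

section \<open>Bounds for one-variable sums modulo powers of a prime larger than k\<close>

locale binomial_sum =
  fixes p k :: nat and a :: int
  assumes p: "prime p" and k: "k \<ge> 2" and kp: "k < p" and a: "\<not> int p dvd a"
begin

lemma p0: "p > 0" and p1: "p > 1"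
  by (rule prime_gt_0_nat[OF p], rule prime_gt_1_nat[OF p])

lemma prime_int: "prime (int p)"
  using p by simp

lemma not_dvd_k: "\<not> int p dvd int k" and not_dvd_k1: "\<not> int p dvd int (k - 1)"
proof -
  have "\<not> p dvd k" "\<not> p dvd k - 1" using k kp by (auto dest: dvd_imp_le)
  then show "\<not> int p dvd int k" "\<not> int p dvd int (k - 1)" by (simp_all only: of_nat_dvd_iff not_False_eq_True)
qed

text \<open>As p does not divide b, critical points are units, and as p divides neither a, k nor k -
  1, they are simple roots modulo p. Two that agree modulo p therefore agree modulo p^h, and a
  polynomial of degree k - 1 over F_p bounds their number.\<close>

lemma critical_points_card:
  assumes b: "\<not> int p dvd b" and h: "h \<ge> 1"
  shows "card {u\<in>{0..<int (p ^ h)}. int (p ^ h) dvd int k * a * u ^ (k - 1) + b} \<le> k - 1" (is "card ?Z \<le> _")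
proof (rule ccontr)
  assume *: "\<not> card ?Z \<le> k - 1"
  interpret prime_ring_ideal "pid p (0 :: int)" by (rule prime_ring_ideal_int[OF p])
  define w where "w = monom (int k * a) (k - 1) + [:b:]"
  have pph: "int p dvd int (p ^ h)" using h by (simp add: dvd_power)
  have "coeff w (k - 1) \<in> pid p 0"
  proof (rule poly_many_roots[of ?Z])
    have "finite {0..<int (p ^ h)}" by simp
    then show "finite ?Z" by (rule finite_subset[rotated]) blast
    show "poly w z \<in> pid p 0" if "z \<in> ?Z" for z
      using that pph by (auto simp: w_def poly_monom mem_pid_int intro: dvd_trans)
    show "w = 0 \<or> degree w < card ?Z"
    proof -
      have "degree w \<le> k - 1" unfolding w_def by (intro degree_add_le degree_monom_le) auto
      then show ?thesis using * by linarith
    qed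
    show "u - u' \<notin> pid p 0" if u: "u \<in> ?Z" "u' \<in> ?Z" "u \<noteq> u'" for u u'
    proof
      assume "u - u' \<in> pid p 0"
      then have uu: "[u = u'] (mod int p)" by (simp add: mem_pid_int cong_iff_dvd_diff)
      have pu: "\<not> int p dvd u"
      proof
        assume "int p dvd u"
        then have "int p dvd int k * a * u ^ (k - 1)" using k by (intro dvd_mult) (simp add: dvd_power_iff dvd_trans[OF _ dvd_power])
        moreover have "int p dvd int k * a * u ^ (k - 1) + b" using u(1) pph by (auto intro: dvd_trans)
        ultimately show False using b by (simp add: dvd_add_right_iff)
      qed
      \<comment> \<open>The quotient of u^(k-1) - u'^(k-1) by u - u'. Modulo p it is (k - 1)
        u^(k-2), a unit.\<close>
      define s where "s = (\<Sum>i<k - 1. u' ^ (k - 1 - Suc i) * u ^ i)"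
      have "int (p ^ h) dvd (int k * a * u ^ (k - 1) + b) - (int k * a * u' ^ (k - 1) + b)"
        using u by (intro dvd_diff) auto
      also have "\<dots> = (int k * a) * (u ^ (k - 1) - u' ^ (k - 1))" by (simp add: algebra_simps)
      also have "\<dots> = (int k * a * s) * (u - u')" unfolding s_def by (subst power_diff_sumr2) simp
      finally have dvd: "int (p ^ h) dvd (int k * a * s) * (u - u')" .
      have "[s = (\<Sum>i<k - 1. u ^ (k - 1 - Suc i) * u ^ i)] (mod int p)"
        unfolding s_def using uu by (intro cong_sum cong_mult cong_pow cong_refl) (simp add: cong_sym)
      also have "(\<Sum>i<k - 1. u ^ (k - 1 - Suc i) * u ^ i) = (\<Sum>i<k - 1. u ^ (k - 2))"
        by (intro sum.cong refl) (simp add: power_add[symmetric])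
      also have "\<dots> = int (k - 1) * u ^ (k - 2)" by simp
      finally have s: "[s = int (k - 1) * u ^ (k - 2)] (mod int p)" .
      have "\<not> int p dvd u ^ (k - 2)" using pu prime_dvd_power[OF prime_int] by blast
      then have "\<not> int p dvd int (k - 1) * u ^ (k - 2)"
        using not_dvd_k1 by (simp only: prime_dvd_mult_iff[OF prime_int]) blast
      then have "\<not> int p dvd s" by (simp only: cong_dvd_iff[OF s]) blast
      then have "\<not> int p dvd int k * a * s"
        using a not_dvd_k prime_int by (simp add: prime_dvd_mult_iff)
      then have "coprime (int p) (int k * a * s)" by (rule prime_imp_coprime[OF prime_int])
      then have "coprime (int (p ^ h)) (int k * a * s)"
        by (simp only: of_nat_power coprime_power_left_iff) blast
      then have "int (p ^ h) dvd u - u'" using dvd by (simp add: coprime_dvd_mult_right_iff)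
      moreover have "\<bar>u - u'\<bar> < int (p ^ h)" using u by auto
      ultimately show False using u(3) dvd_imp_le_int[of "u - u'" "int (p ^ h)"] by auto
    qed
  qed
  moreover have "coeff w (k - 1) = int k * a" using k by (simp add: w_def coeff_pCons split: nat.splits)
  ultimately show False using a not_dvd_k prime_int by (simp add: mem_pid_int prime_dvd_mult_iff)
qed

lemma gs_coprime_bound:
  assumes b: "\<not> int p dvd b" and h: "1 \<le> h" "h \<le> g"
  shows "norm (gs (p ^ (g + h)) k a b) \<le> (real k - 1) * real p ^ g"
proof -
  let ?P = "\<lambda>u. int (p ^ h) dvd int k * a * u ^ (k - 1) + b"
  have pg: "p ^ g = p ^ h * p ^ (g - h)" using h by (simp flip: power_add)
  have "card {u\<in>{0..<int (p ^ g)}. ?P u} = (\<Sum>u\<in>{0..<int (p ^ g)}. if ?P u then 1 else 0)"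
    by (subst sum.inter_filter[symmetric]) auto
  also have "\<dots> = (\<Sum>u\<in>{0..<int (p ^ h)}. \<Sum>v\<in>{0..<int (p ^ (g - h))}. if ?P (u + int (p ^ h) * v) then 1 else 0)"
    by (subst pg, rule sum_residues_split) (use p0 in auto)
  also have "\<dots> = (\<Sum>u\<in>{0..<int (p ^ h)}. \<Sum>v\<in>{0..<int (p ^ (g - h))}. if ?P u then 1 else 0)"
  proof (intro sum.cong refl)
    fix u v
    have "[int k * a * (u + int (p ^ h) * v) ^ (k - 1) + b = int k * a * u ^ (k - 1) + b] (mod int (p ^ h))"
      by (intro cong_add cong_mult cong_pow cong_refl) (simp add: cong_iff_dvd_diff)
    then have "?P (u + int (p ^ h) * v) \<longleftrightarrow> ?P u" by (simp add: cong_dvd_iff)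
    then show "(if ?P (u + int (p ^ h) * v) then 1 else 0) = (if ?P u then 1 else (0 :: nat))" by simp
  qed
  also have "\<dots> = (\<Sum>u\<in>{0..<int (p ^ h)}. if ?P u then p ^ (g - h) else 0)"
    by (intro sum.cong) (auto simp: nat_power_eq)
  also have "\<dots> = card {u\<in>{0..<int (p ^ h)}. ?P u} * p ^ (g - h)"
    by (subst sum.inter_filter[symmetric]) auto
  also have "\<dots> \<le> (k - 1) * p ^ (g - h)"
    by (intro mult_le_mono1 critical_points_card b h)
  finally have card: "card {u\<in>{0..<int (p ^ g)}. ?P u} \<le> (k - 1) * p ^ (g - h)" .
  have "norm (gs (p ^ (g + h)) k a b) \<le> real (p ^ h) * real (card {u\<in>{0..<int (p ^ g)}. ?P u})"
    unfolding gs_stationary[OF p0 h(2), of k a b, OF order_trans[OF _ k, OF one_le_numeral]] norm_mult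
    using sum_norm_le[of "{u\<in>{0..<int (p ^ g)}. ?P u}" "\<lambda>u. ee (p ^ (g + h)) (a * u ^ k + b * u)" "\<lambda>_. 1"]
    by (intro mult_mono) (auto simp: norm_power)
  also have "\<dots> \<le> real (p ^ h) * real ((k - 1) * p ^ (g - h))"
    using card by (intro mult_left_mono of_nat_mono) auto
  also have "\<dots> = (real k - 1) * real p ^ g"
    using k unfolding of_nat_power[symmetric, of p g] pg by (simp add: of_nat_diff)
  finally show ?thesis .
qed

text \<open>Stationary phase with h = 1: since p divides the linear coefficient, the critical points
  are exactly the multiples of p.\<close>

lemma gs_dvd:
  assumes k3: "k \<ge> 3"
  shows "gs (p ^ Suc (Suc l)) k a (int p * b) = of_nat p * (\<Sum>w\<in>{0..<int (p ^ l)}. ee (p ^ Suc (Suc l)) (a * int p ^ k * w ^ k + int p ^ 2 * b * w))"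
proof -
  have iff: "int (p ^ 1) dvd int k * a * u ^ (k - 1) + int p * b \<longleftrightarrow> int p dvd u" for u
  proof -
    have "int (p ^ 1) dvd int k * a * u ^ (k - 1) + int p * b \<longleftrightarrow> int p dvd int k * a * u ^ (k - 1)"
      by (simp add: dvd_add_left_iff)
    also have "\<dots> \<longleftrightarrow> int p dvd u"
      using a not_dvd_k prime_int k by (simp add: prime_dvd_mult_iff prime_dvd_power_iff)
    finally show ?thesis .
  qed
  have "gs (p ^ (Suc l + 1)) k a (int p * b) = of_nat (p ^ 1) *
     (\<Sum>u\<in>{u\<in>{0..<int (p ^ Suc l)}. int p dvd u}. ee (p ^ (Suc l + 1)) (a * u ^ k + int p * b * u))"
    using gs_stationary[OF p0, of 1 "Suc l" k a "int p * b"] k unfolding iff by simp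
  also have "(\<Sum>u\<in>{u\<in>{0..<int (p ^ Suc l)}. int p dvd u}. ee (p ^ (Suc l + 1)) (a * u ^ k + int p * b * u)) =
     (\<Sum>w\<in>{0..<int (p ^ l)}. ee (p ^ (Suc l + 1)) (a * int p ^ k * w ^ k + int p ^ 2 * b * w))"
  proof (rule sum.reindex_bij_witness[of _ "\<lambda>w. int p * w" "\<lambda>u. u div int p"])
    fix u assume u: "u \<in> {u\<in>{0..<int (p ^ Suc l)}. int p dvd u}"
    then obtain w where w: "u = int p * w" by (auto elim: dvdE)
    show "int p * (u div int p) = u" using w p0 by simp
    show "u div int p \<in> {0..<int (p ^ l)}" using u p0 unfolding w by (auto simp: zero_le_mult_iff)
    show "ee (p ^ (Suc l + 1)) (a * int p ^ k * (u div int p) ^ k + int p ^ 2 * b * (u div int p)) =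
      ee (p ^ (Suc l + 1)) (a * u ^ k + int p * b * u)"
      using p0 unfolding w by (simp add: power_mult_distrib algebra_simps power2_eq_square)
  next
    fix w assume "w \<in> {0..<int (p ^ l)}"
    then show "int p * w div int p = w" "int p * w \<in> {u\<in>{0..<int (p ^ Suc l)}. int p dvd u}"
      using p0 by auto
  qed
  finally show ?thesis by simp
qed

text \<open>After \<open>gs_dvd\<close> the term p^k w^k depends only on w modulo p^l. Writing w = u
  + p^l v, the sum over the p^(k-2) values of v tests the divisibility of b, and the sum over u is
  one of the same kind modulo p^l.\<close>

lemma gs_recursion:
  assumes k3: "k \<ge> 3" and l: "l \<ge> 1"
  shows "gs (p ^ (k + l)) k a (int p * b) =
    (if int (p ^ (k - 2)) dvd b then of_nat (p ^ (k - 1)) * gs (p ^ l) k a (b div int (p ^ (k - 2))) else 0)"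
proof -
  obtain j where j: "k = Suc (Suc j)" using k by (metis add_2_eq_Suc le_Suc_ex)
  let ?q = "p ^ (k + l)"
  have e: "?q = p ^ Suc (Suc (l + j))" by (simp add: j add.commute)
  have "gs ?q k a (int p * b) = of_nat p * (\<Sum>w\<in>{0..<int (p ^ l * p ^ j)}. ee ?q (a * int p ^ k * w ^ k + int p ^ 2 * b * w))"
    unfolding e gs_dvd[OF k3] by (simp add: power_add)
  also have "(\<Sum>w\<in>{0..<int (p ^ l * p ^ j)}. ee ?q (a * int p ^ k * w ^ k + int p ^ 2 * b * w)) =
      (\<Sum>u\<in>{0..<int (p ^ l)}. \<Sum>v\<in>{0..<int (p ^ j)}.
        ee ?q (a * int p ^ k * (u + int (p ^ l) * v) ^ k + int p ^ 2 * b * (u + int (p ^ l) * v)))"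
    using p0 by (intro sum_residues_split) auto
  also have "\<dots> = (\<Sum>u\<in>{0..<int (p ^ l)}. \<Sum>v\<in>{0..<int (p ^ j)}.
        ee ?q (a * int p ^ k * u ^ k + int p ^ 2 * b * u) * ee (p ^ j) (b * v))"
  proof (intro sum.cong refl)
    fix u v
    have "[int p ^ k * (u + int (p ^ l) * v) ^ k = int p ^ k * u ^ k] (mod int p ^ k * int p ^ l)"
    proof -
      have "[(u + int (p ^ l) * v) ^ k = u ^ k] (mod int p ^ l)"
        by (intro cong_pow) (simp add: cong_iff_dvd_diff)
      then have "int p ^ l dvd (u + int (p ^ l) * v) ^ k - u ^ k" by (simp only: cong_iff_dvd_diff)
      then have "int p ^ k * int p ^ l dvd int p ^ k * ((u + int (p ^ l) * v) ^ k - u ^ k)"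
        by (rule mult_dvd_mono[OF dvd_refl])
      then show ?thesis by (simp only: cong_iff_dvd_diff right_diff_distrib)
    qed
    then have "[a * (int p ^ k * (u + int (p ^ l) * v) ^ k) + int p ^ 2 * b * (u + int (p ^ l) * v) =
        a * (int p ^ k * u ^ k) + int p ^ 2 * b * (u + int (p ^ l) * v)] (mod int ?q)"
      by (intro cong_add[OF cong_mult[OF cong_refl] cong_refl]) (simp only: of_nat_power of_nat_mult power_add)
    then have "ee ?q (a * int p ^ k * (u + int (p ^ l) * v) ^ k + int p ^ 2 * b * (u + int (p ^ l) * v)) =
        ee ?q (a * int p ^ k * u ^ k + int p ^ 2 * b * (u + int (p ^ l) * v))"
      using p0 by (intro ee_cong) (auto simp: mult.assoc)
    also have "\<dots> = ee ?q (a * int p ^ k * u ^ k + int p ^ 2 * b * u) * ee ?q (int (p ^ (l + 2)) * (b * v))"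
      by (simp add: ee_add[symmetric] algebra_simps power_add power2_eq_square)
    also have "ee ?q (int (p ^ (l + 2)) * (b * v)) = ee (p ^ j) (b * v)"
    proof -
      have "?q = p ^ (l + 2) * p ^ j" by (simp add: j power_add)
      then show ?thesis using ee_scale[of "p ^ (l + 2)" "p ^ j" "b * v"] p0 by (simp only:) simp
    qed
    finally show "ee ?q (a * int p ^ k * (u + int (p ^ l) * v) ^ k + int p ^ 2 * b * (u + int (p ^ l) * v)) =
        ee ?q (a * int p ^ k * u ^ k + int p ^ 2 * b * u) * ee (p ^ j) (b * v)" .
  qed
  also have "\<dots> = (\<Sum>u\<in>{0..<int (p ^ l)}. ee ?q (a * int p ^ k * u ^ k + int p ^ 2 * b * u) *
      (\<Sum>v\<in>{0..<int (p ^ j)}. ee (p ^ j) (b * v)))"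
    by (simp only: sum_distrib_left)
  also have "(\<Sum>v\<in>{0..<int (p ^ j)}. ee (p ^ j) (b * v)) = (if int (p ^ j) dvd b then of_nat (p ^ j) else 0)"
    using p0 by (intro sum_ee) simp
  finally have main: "gs ?q k a (int p * b) = of_nat p * (\<Sum>u\<in>{0..<int (p ^ l)}.
      ee ?q (a * int p ^ k * u ^ k + int p ^ 2 * b * u) * (if int (p ^ j) dvd b then of_nat (p ^ j) else 0))" .
  show ?thesis
  proof (cases "int (p ^ j) dvd b")
    case True
    then obtain b2 where b2: "b = int (p ^ j) * b2" by (elim dvdE)
    have "ee ?q (a * int p ^ k * u ^ k + int p ^ 2 * b * u) = ee (p ^ l) (a * u ^ k + b2 * u)" for u
    proof -
      have "a * int p ^ k * u ^ k + int p ^ 2 * b * u = int (p ^ k) * (a * u ^ k + b2 * u)"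
        by (simp add: b2 j algebra_simps power2_eq_square)
      then show ?thesis using ee_scale[of "p ^ k" "p ^ l"] p0 by (simp add: power_add)
    qed
    then have "gs ?q k a (int p * b) = of_nat p * (\<Sum>u\<in>{0..<int (p ^ l)}. ee (p ^ l) (a * u ^ k + b2 * u) * of_nat (p ^ j))"
      using main True by simp
    also have "\<dots> = of_nat (p ^ (k - 1)) * gs (p ^ l) k a b2"
      by (simp add: gs_def sum_distrib_left sum_distrib_right[symmetric] j mult_ac)
    finally show ?thesis using True p0 b2 j by simp
  next
    case False
    then show ?thesis using main j by simp
  qed
qed

text \<open>For k at least 3 and l > 1 there are three cases. If p does not divide b, stationary
  phase with g = l - l div 2 suffices. If p divides b and l is at most k, the trivial estimate after
  \<open>gs_dvd\<close> saves 1, which is at least l/k. For larger l a round of the recursion saves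
  1 more, exactly the growth of l/k when l grows by k; the factor k is passed on unchanged, so no
  constant accumulates.\<close>

lemma gs_bound:
  assumes "l \<ge> 1"
  shows "norm (gs (p ^ l) k a b) \<le> real k * real p powr (real l - max (real l / real k) (1 / 2))"
proof (cases "k = 2")
  case True
  have "odd (int p)" using kp True p prime_odd_nat by auto
  then have "coprime (2 * a) (int (p ^ l))"
    using a prime_int prime_imp_coprime[OF prime_int a] by (simp add: coprime_commute)
  then have "norm (gs (p ^ l) 2 a b) ^ 2 = real (p ^ l)" using p0 by (intro gs_quadratic) auto
  then have "norm (gs (p ^ l) 2 a b) = sqrt (real (p ^ l))" by (metis norm_ge_zero real_sqrt_unique)
  also have "\<dots> = real p powr (real l / 2)"
    using p0 by (simp add: powr_half_sqrt[symmetric] powr_powr flip: powr_realpow)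
  also have "real l / 2 = real l - max (real l / real k) (1 / 2)" using True assms by (simp add: max_def)
  finally show ?thesis using True by simp
next
  case False
  then have k3: "k \<ge> 3" using k by simp
  have pmono: "real p powr x \<le> real p powr y" if "x \<le> y" for x y
    using that p1 by (intro powr_mono) auto
  have pw: "real p ^ i = real p powr real i" for i using p0 by (simp add: powr_realpow)
  have fin: "c * real p ^ i \<le> real k * real p powr y" if "c \<le> real k" "real i \<le> y" for c i y
    unfolding pw using that pmono by (intro mult_mono) auto
  show ?thesis
    using assms
  proof (induction l arbitrary: b rule: less_induct)
    case (less l)
    show ?case
    proof (cases "l = 1")
      case True
      have "coprime p k" using p k kp by (intro prime_imp_coprime) (auto dest: dvd_imp_le)
      then interpret W: artin_schreier p k a b
        using p k a by unfold_locales (auto simp: coprime_commute)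
      have "norm (gs (p ^ l) k a b) \<le> (real k - 1) * sqrt (real p)"
        using W.weil_bound True by (simp add: gs_def)
      also have "\<dots> \<le> real k * real p powr (1 / 2)" by (simp add: powr_half_sqrt mult_right_mono)
      also have "1 / 2 = real l - max (real l / real k) (1 / 2)" using True k by (simp add: max_def)
      finally show ?thesis .
    next
      case False
      then have l2: "l \<ge> 2" using less.prems by simp
      show ?thesis
      proof (cases "int p dvd b")
        case False
        define h where "h = l div 2"
        define g where "g = l - h"
        have gh: "1 \<le> h" "h \<le> g" "l = g + h" using l2 by (auto simp: g_def h_def)
        have g: "2 * g \<le> l + 1" "l = 2 \<Longrightarrow> g = 1" by (auto simp: g_def h_def)
        have "real g \<le> real l - max (real l / real k) (1 / 2)"
        proof -
          have "real l / real k \<le> real l / 3" using k3 by (intro divide_left_mono) auto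
          moreover have "real g \<le> real l - real l / 3"
          \<comment> \<open>For l = 2 the estimate (l + 1)/2 for g exceeds 2 l / 3, but there g is
            1.\<close>
          proof (cases "l = 2")
            case True
            then show ?thesis using g by simp
          next
            case False
            then have "real l \<ge> 3" using l2 by simp
            moreover have "2 * real g \<le> real l + 1" using g(1) by linarith
            ultimately show ?thesis by simp
          qed
          moreover have "real g \<le> real l - 1 / 2" using g(1) l2 by linarith
          ultimately show ?thesis by linarith
        qed
        then show ?thesis
          using gs_coprime_bound[OF False gh(1,2)] fin[of "real k - 1" g] unfolding gh(3)[symmetric] by force
      next
        case True
        then obtain b1 where b1: "b = int p * b1" by (elim dvdE)
        show ?thesis
        proof (cases "l \<le> k")
          case True
          obtain l' where l': "l = Suc (Suc l')" using l2 by (metis add_2_eq_Suc le_Suc_ex)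
          have "norm (gs (p ^ l) k a b) \<le> real p * real p ^ l'"
            unfolding b1 l' gs_dvd[OF k3] norm_mult
            using sum_norm_le[of "{0..<int (p ^ l')}" "\<lambda>w. ee (p ^ Suc (Suc l')) (a * int p ^ k * w ^ k + int p ^ 2 * b1 * w)" "\<lambda>_. 1"]
            by (intro mult_mono) auto
          also have "\<dots> = 1 * real p ^ (l - 1)" by (simp add: l')
          also have "\<dots> \<le> real k * real p powr (real l - max (real l / real k) (1 / 2))"
            using True k l2 by (intro fin) (auto simp: of_nat_diff max_def)
          finally show ?thesis .
        next
          case False
          define j where "j = l - k"
          have j: "l = k + j" "j \<ge> 1" "j < l" using False k by (auto simp: j_def)
          have "norm (gs (p ^ l) k a b) \<le> real p ^ (k - 1) * (real k * real p powr (real j - max (real j / real k) (1 / 2)))"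
          proof (cases "int (p ^ (k - 2)) dvd b1")
            case True
            then show ?thesis
              unfolding b1 j(1) gs_recursion[OF k3 j(2)]
              using less.IH[OF j(3,2)] by (simp add: norm_mult norm_power mult_left_mono)
          next
            case False
            then show ?thesis unfolding b1 j(1) gs_recursion[OF k3 j(2)] by simp
          qed
          also have "\<dots> = real k * real p powr (real (k - 1) + (real j - max (real j / real k) (1 / 2)))"
            by (simp add: pw powr_add)
          also have "\<dots> \<le> real k * real p powr (real l - max (real l / real k) (1 / 2))"
          proof (intro mult_left_mono pmono)
            have "real l / real k = 1 + real j / real k" using k by (simp add: j(1) add_divide_distrib)
            moreover have "0 \<le> real j / real k" by simp
            ultimately have "1 / 2 \<le> real l / real k" "real l / real k = 1 + real j / real k" by linarith+
            then have "max (real l / real k) (1 / 2) = 1 + real j / real k" by (simp only: max_absorb1)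
            moreover have "real j / real k \<le> max (real j / real k) (1 / 2)" by simp
            moreover have "real (k - 1) = real k - 1" "real l = real k + real j" using k j(1) by (simp_all add: of_nat_diff)
            ultimately show "real (k - 1) + (real j - max (real j / real k) (1 / 2)) \<le> real l - max (real l / real k) (1 / 2)"
              by linarith
          qed auto
          finally show ?thesis .
        qed
      qed
    qed
  qed
qed

end

text \<open>The power term has period Q, so writing z = u + Q v separates v into a linear character
  sum. This treats frequencies t divisible by a power of p.\<close>

lemma gs_scale:
  assumes "Q > 0" "m > 0"
  shows "gs (m * Q) k (int m * a) b = (if int m dvd b then of_nat m * gs Q k a (b div int m) else 0)"
proof -
  have tm: "ee (m * Q) (int m * a * (u + int Q * v) ^ k + b * (u + int Q * v)) =
      ee (m * Q) (int m * a * u ^ k + b * u) * ee m (b * v)" for u v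
  proof -
    have "[a * (u + int Q * v) ^ k = a * u ^ k] (mod int Q)"
      by (intro cong_mult cong_pow cong_refl) (simp add: cong_iff_dvd_diff)
    then have "ee Q (a * (u + int Q * v) ^ k) = ee Q (a * u ^ k)" by (rule ee_cong[OF assms(1)])
    then have 1: "ee (m * Q) (int m * (a * (u + int Q * v) ^ k)) = ee (m * Q) (int m * (a * u ^ k))"
      using assms by (simp only: ee_scale)
    have 2: "ee (m * Q) (int Q * (b * v)) = ee m (b * v)"
      using ee_scale[OF assms(1), of m "b * v"] by (simp only: mult.commute[of Q m])
    have "int m * a * (u + int Q * v) ^ k + b * (u + int Q * v) = int m * (a * (u + int Q * v) ^ k) + (b * u + int Q * (b * v))"
      by (simp add: algebra_simps)
    then show ?thesis by (simp only: ee_add 1 2 mult.assoc)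
  qed
  have "gs (m * Q) k (int m * a) b = (\<Sum>u\<in>{0..<int Q}. \<Sum>v\<in>{0..<int m}.
      ee (m * Q) (int m * a * (u + int Q * v) ^ k + b * (u + int Q * v)))"
    unfolding gs_def using sum_residues_split[OF assms] by (subst mult.commute[of m Q]) simp
  also have "\<dots> = (\<Sum>u\<in>{0..<int Q}. ee (m * Q) (int m * a * u ^ k + b * u) * (\<Sum>v\<in>{0..<int m}. ee m (b * v)))"
    unfolding tm sum_distrib_left ..
  also have "(\<Sum>v\<in>{0..<int m}. ee m (b * v)) = (if int m dvd b then of_nat m else 0)"
    by (rule sum_ee[OF assms(2)])
  finally have main: "gs (m * Q) k (int m * a) b = (\<Sum>u\<in>{0..<int Q}. ee (m * Q) (int m * a * u ^ k + b * u) *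
      (if int m dvd b then of_nat m else 0))" .
  show ?thesis
  proof (cases "int m dvd b")
    case True
    then obtain c where c: "b = int m * c" by (elim dvdE)
    have "ee (m * Q) (int m * a * u ^ k + b * u) = ee Q (a * u ^ k + c * u)" for u
    proof -
      have "int m * a * u ^ k + b * u = int m * (a * u ^ k + c * u)" by (simp add: c algebra_simps)
      then show ?thesis by (simp only: ee_scale[OF assms(2)])
    qed
    then show ?thesis using main True assms(2)
      by (simp add: gs_def sum_distrib_left mult.commute c)
  next
    case False
    then show ?thesis using main by simp
  qed
qed

subsection \<open>Fourier analysis on residue vectors\<close>

definition rvec :: "nat \<Rightarrow> nat \<Rightarrow> (nat \<Rightarrow> int) set"
  where "rvec n q = {1..n} \<rightarrow>\<^sub>E {0..<int q}"

lemma residue_vectors_eq: "residue_vectors n (int q) = rvec n q"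
proof -
  have "carrier (residue_ring (int q)) = {0..<int q}" by (auto simp: residue_ring_def)
  then show ?thesis by (simp add: residue_vectors_def rvec_def)
qed

lemma finite_rvec: "finite (rvec n q)"
  unfolding rvec_def by (intro finite_PiE) auto

lemma prod_sum_rvec:
  fixes g :: "nat \<Rightarrow> int \<Rightarrow> complex"
  shows "(\<Prod>i\<in>{1..n}. \<Sum>z\<in>{0..<int q}. g i z) = (\<Sum>m\<in>rvec n q. \<Prod>i\<in>{1..n}. g i (m i))"
  unfolding rvec_def by (rule prod_sum_PiE) auto

definition fch :: "nat \<Rightarrow> nat \<Rightarrow> (nat \<Rightarrow> int) \<Rightarrow> (nat \<Rightarrow> int) \<Rightarrow> complex"
  where "fch n q m x = (\<Prod>i\<in>{1..n}. ee q (m i * x i))"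

lemma dvd_diff_residues: "x \<in> {0..<int q} \<Longrightarrow> y \<in> {0..<int q} \<Longrightarrow> int q dvd x - y \<longleftrightarrow> x = y"
  using mod_eq_dvd_iff[of x "int q" y] by simp

lemma fch_orthogonal:
  assumes "q > 0" "x \<in> rvec n q" "y \<in> rvec n q"
  shows "(\<Sum>m\<in>rvec n q. fch n q m x * cnj (fch n q m y)) = (if x = y then of_nat q ^ n else 0)"
proof -
  have "(\<Sum>m\<in>rvec n q. fch n q m x * cnj (fch n q m y)) = (\<Sum>m\<in>rvec n q. \<Prod>i\<in>{1..n}. ee q ((x i - y i) * m i))"
    unfolding fch_def cnj_prod prod.distrib[symmetric]
    by (intro sum.cong prod.cong refl) (simp add: ee_uminus[symmetric] ee_add[symmetric] algebra_simps)
  also have "\<dots> = (\<Prod>i\<in>{1..n}. \<Sum>z\<in>{0..<int q}. ee q ((x i - y i) * z))"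
    by (rule prod_sum_rvec[symmetric])
  also have "\<dots> = (\<Prod>i\<in>{1..n}. if x i = y i then of_nat q else 0)"
  proof (intro prod.cong refl)
    fix i assume "i \<in> {1..n}"
    then have "x i \<in> {0..<int q}" "y i \<in> {0..<int q}" using assms by (auto simp: rvec_def PiE_iff)
    then have "int q dvd x i - y i \<longleftrightarrow> x i = y i" by (rule dvd_diff_residues)
    then show "(\<Sum>z\<in>{0..<int q}. ee q ((x i - y i) * z)) = (if x i = y i then of_nat q else 0)"
      using sum_ee[OF assms(1)] by simp
  qed
  also have "\<dots> = (if x = y then of_nat q ^ n else 0)"
  proof (cases "x = y")
    case False
    then obtain i where "i \<in> {1..n}" "x i \<noteq> y i"
      using assms(2,3) PiE_ext[of x "{1..n}" "\<lambda>_. {0..<int q}" y] unfolding rvec_def by blast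
    then have "(\<Prod>i\<in>{1..n}. if x i = y i then of_nat q else 0) = (0 :: complex)"
      by (intro prod_zero) auto
    then show ?thesis using False by simp
  qed simp
  finally show ?thesis .
qed

lemma parseval:
  assumes q: "q > 0" and A: "A \<subseteq> rvec n q"
  shows "(\<Sum>m\<in>rvec n q. norm (\<Sum>x\<in>A. fch n q m x) ^ 2) = real q ^ n * real (card A)"
proof -
  have fin: "finite A" using A finite_rvec by (rule finite_subset)
  have "complex_of_real (\<Sum>m\<in>rvec n q. norm (\<Sum>x\<in>A. fch n q m x) ^ 2) =
      (\<Sum>m\<in>rvec n q. \<Sum>x\<in>A. \<Sum>y\<in>A. fch n q m x * cnj (fch n q m y))"
    unfolding of_real_sum complex_norm_square cnj_sum sum_product ..
  also have "\<dots> = (\<Sum>x\<in>A. \<Sum>y\<in>A. \<Sum>m\<in>rvec n q. fch n q m x * cnj (fch n q m y))"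
    by (rule trans[OF sum.swap sum.cong[OF refl sum.swap]])
  also have "\<dots> = (\<Sum>x\<in>A. \<Sum>y\<in>A. if x = y then of_nat q ^ n else 0)"
    using A by (intro sum.cong refl fch_orthogonal q) auto
  also have "\<dots> = of_nat (card A) * of_nat q ^ n" using fin by simp
  finally have "complex_of_real (\<Sum>m\<in>rvec n q. norm (\<Sum>x\<in>A. fch n q m x) ^ 2) = of_real (real q ^ n * real (card A))"
    by simp
  then show ?thesis by (simp only: of_real_eq_iff)
qed

lemma fourier_inversion:
  fixes g :: "int \<Rightarrow> complex"
  assumes q: "q > 0" and g: "\<And>z w. [z = w] (mod int q) \<Longrightarrow> g z = g w"
  shows "of_nat q * g x = (\<Sum>m\<in>{0..<int q}. (\<Sum>z\<in>{0..<int q}. g z * ee q (- m * z)) * ee q (m * x))"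
proof -
  have "(\<Sum>m\<in>{0..<int q}. (\<Sum>z\<in>{0..<int q}. g z * ee q (- m * z)) * ee q (m * x)) =
      (\<Sum>m\<in>{0..<int q}. \<Sum>z\<in>{0..<int q}. g z * ee q ((x - z) * m))"
    unfolding sum_distrib_right
    by (intro sum.cong refl) (simp add: mult.assoc ee_add[symmetric] algebra_simps)
  also have "\<dots> = (\<Sum>z\<in>{0..<int q}. g z * (\<Sum>m\<in>{0..<int q}. ee q ((x - z) * m)))"
    by (subst sum.swap) (simp add: sum_distrib_left)
  also have "\<dots> = (\<Sum>z\<in>{0..<int q}. if z = x mod int q then g x * of_nat q else 0)"
  proof (intro sum.cong refl)
    fix z assume z: "z \<in> {0..<int q}"
    have "int q dvd x - z \<longleftrightarrow> z = x mod int q"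
      using z by (auto simp: mod_eq_dvd_iff[symmetric])
    moreover have "g (x mod int q) = g x" by (rule g) (simp add: Cong.cong_def)
    ultimately show "g z * (\<Sum>m\<in>{0..<int q}. ee q ((x - z) * m)) = (if z = x mod int q then g x * of_nat q else 0)"
      using sum_ee[OF q, of "x - z"] by auto
  qed
  also have "\<dots> = g x * of_nat q" using q by simp
  finally show ?thesis by (simp add: mult.commute)
qed

text \<open>Expanding every factor in characters turns the double sum into a sum of products of
  Fourier transforms. The transform of the kernel is at most the product of the \<open>C i\<close>;
  Cauchy-Schwarz and Parseval handle the other two, and the powers of q cancel.\<close>

lemma convolution_bound:
  fixes g :: "nat \<Rightarrow> int \<Rightarrow> complex"
  assumes q: "q > 0" and A: "A \<subseteq> rvec n q" and B: "B \<subseteq> rvec n q"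
    and g: "\<And>i z w. [z = w] (mod int q) \<Longrightarrow> g i z = g i w"
    and bd: "\<And>i m. i \<in> {1..n} \<Longrightarrow> norm (\<Sum>z\<in>{0..<int q}. g i z * ee q (- m * z)) \<le> C i"
  shows "norm (\<Sum>x\<in>A. \<Sum>y\<in>B. \<Prod>i\<in>{1..n}. g i (x i - y i)) ^ 2 \<le> (\<Prod>i\<in>{1..n}. C i) ^ 2 * (real (card A) * real (card B))"
proof -
  define G where "G = (\<lambda>m. \<Prod>i\<in>{1..n}. \<Sum>z\<in>{0..<int q}. g i z * ee q (- m i * z))"
  define a where "a = (\<lambda>m. \<Sum>x\<in>A. fch n q m x)"
  define b where "b = (\<lambda>m. \<Sum>y\<in>B. fch n q m y)"
  define P where "P = (\<Prod>i\<in>{1..n}. C i)"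
  define S where "S = (\<Sum>x\<in>A. \<Sum>y\<in>B. \<Prod>i\<in>{1..n}. g i (x i - y i))"
  have G: "norm (G m) \<le> P" for m
    unfolding G_def P_def prod_norm[symmetric] by (intro prod_mono conjI norm_ge_zero bd)
  have "of_nat q ^ n * (\<Prod>i\<in>{1..n}. g i (x i - y i)) = (\<Sum>m\<in>rvec n q. G m * (fch n q m x * cnj (fch n q m y)))" for x y
  proof -
    have "of_nat q ^ n * (\<Prod>i\<in>{1..n}. g i (x i - y i)) = (\<Prod>i\<in>{1..n}. of_nat q * g i (x i - y i))"
      by (simp add: prod.distrib)
    also have "\<dots> = (\<Prod>i\<in>{1..n}. \<Sum>m\<in>{0..<int q}. (\<Sum>z\<in>{0..<int q}. g i z * ee q (- m * z)) * ee q (m * (x i - y i)))"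
      by (intro prod.cong refl fourier_inversion q g)
    also have "\<dots> = (\<Sum>m\<in>rvec n q. \<Prod>i\<in>{1..n}. (\<Sum>z\<in>{0..<int q}. g i z * ee q (- m i * z)) * ee q (m i * (x i - y i)))"
      by (rule prod_sum_rvec)
    also have "\<dots> = (\<Sum>m\<in>rvec n q. G m * (fch n q m x * cnj (fch n q m y)))"
      unfolding G_def fch_def cnj_prod prod.distrib[symmetric]
      by (intro sum.cong prod.cong refl) (simp add: ee_uminus[symmetric] ee_add[symmetric] algebra_simps)
    finally show ?thesis .
  qed
  then have "of_nat q ^ n * S = (\<Sum>x\<in>A. \<Sum>y\<in>B. \<Sum>m\<in>rvec n q. G m * (fch n q m x * cnj (fch n q m y)))"
    unfolding S_def sum_distrib_left by simp
  also have "\<dots> = (\<Sum>m\<in>rvec n q. \<Sum>x\<in>A. \<Sum>y\<in>B. G m * (fch n q m x * cnj (fch n q m y)))"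
    by (rule trans[OF sum.cong[OF refl sum.swap] sum.swap])
  also have "\<dots> = (\<Sum>m\<in>rvec n q. G m * (a m * cnj (b m)))"
    unfolding a_def b_def cnj_sum sum_product unfolding sum_distrib_left ..
  finally have eq: "of_nat q ^ n * S = (\<Sum>m\<in>rvec n q. G m * (a m * cnj (b m)))" .
  have "real q ^ n * norm S = norm (of_nat q ^ n * S)" by (simp add: norm_mult norm_power)
  also have "\<dots> \<le> (\<Sum>m\<in>rvec n q. norm (G m * (a m * cnj (b m))))" unfolding eq by (rule norm_sum)
  also have "\<dots> \<le> (\<Sum>m\<in>rvec n q. P * (norm (a m) * norm (b m)))"
    using G by (intro sum_mono) (simp add: norm_mult mult_right_mono)
  also have "\<dots> = P * (\<Sum>m\<in>rvec n q. norm (a m) * norm (b m))" by (simp add: sum_distrib_left)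
  finally have "(real q ^ n * norm S) ^ 2 \<le> (P * (\<Sum>m\<in>rvec n q. norm (a m) * norm (b m))) ^ 2"
    by (intro power_mono) auto
  also have "\<dots> \<le> P ^ 2 * ((\<Sum>m\<in>rvec n q. norm (a m) ^ 2) * (\<Sum>m\<in>rvec n q. norm (b m) ^ 2))"
    unfolding power_mult_distrib by (intro mult_left_mono Cauchy_Schwarz_ineq_sum) auto
  also have "\<dots> = (real q ^ n) ^ 2 * (P ^ 2 * (real (card A) * real (card B)))"
    unfolding a_def b_def parseval[OF q A] parseval[OF q B] by (simp add: power2_eq_square algebra_simps)
  finally have "(real q ^ n) ^ 2 * norm S ^ 2 \<le> (real q ^ n) ^ 2 * (P ^ 2 * (real (card A) * real (card B)))"
    by (simp add: power_mult_distrib)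
  then show ?thesis using q by (simp add: S_def P_def)
qed

text \<open>Cauchy--Schwarz for the sizes of the fibres of \<open>f\<close> modulo \<open>q\<close>.\<close>

lemma card_image_lower_bound:
  fixes f :: "'a \<Rightarrow> int"
  assumes q: "q > 0" and S: "finite S"
  shows "real q * real (card S) ^ 2 \<le>
    real (card ((\<lambda>s. f s mod int q) ` S)) * (\<Sum>t\<in>{0..<int q}. norm (\<Sum>s\<in>S. ee q (t * f s)) ^ 2)"
proof -
  define D where "D = (\<lambda>s. f s mod int q) ` S"
  define N where "N = (\<lambda>d. real (card {s\<in>S. f s mod int q = d}))"
  have D: "finite D" "D \<subseteq> {0..<int q}" using S q by (auto simp: D_def)
  have fib: "(\<Sum>s\<in>S. g (f s mod int q)) = (\<Sum>d\<in>D. of_real (N d) * g d)" for g :: "int \<Rightarrow> complex"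
  proof -
    have "(\<Sum>s\<in>S. g (f s mod int q)) = (\<Sum>d\<in>D. \<Sum>s\<in>{s\<in>S. f s mod int q = d}. g (f s mod int q))"
      by (rule sum.group[symmetric, OF S D(1)]) (auto simp: D_def)
    also have "\<dots> = (\<Sum>d\<in>D. of_real (N d) * g d)" by (intro sum.cong) (auto simp: N_def)
    finally show ?thesis .
  qed
  have S1: "real (card S) = (\<Sum>d\<in>D. N d * 1)"
    using fib[of "\<lambda>_. 1"] by (simp flip: of_real_sum) (metis of_real_eq_iff of_real_of_nat_eq)
  have "complex_of_real (\<Sum>t\<in>{0..<int q}. norm (\<Sum>s\<in>S. ee q (t * f s)) ^ 2) =
      (\<Sum>t\<in>{0..<int q}. \<Sum>d\<in>D. \<Sum>d'\<in>D. of_real (N d * N d') * ee q ((d - d') * t))"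
    unfolding of_real_sum
  proof (intro sum.cong refl)
    fix t
    have "(\<Sum>s\<in>S. ee q (t * f s)) = (\<Sum>s\<in>S. ee q (t * (f s mod int q)))"
      using q by (intro sum.cong refl ee_cong) (auto simp: Cong.cong_def mod_mult_right_eq)
    also have "\<dots> = (\<Sum>d\<in>D. of_real (N d) * ee q (t * d))" by (rule fib)
    finally have *: "(\<Sum>s\<in>S. ee q (t * f s)) = (\<Sum>d\<in>D. of_real (N d) * ee q (t * d))" .
    show "complex_of_real (norm (\<Sum>s\<in>S. ee q (t * f s)) ^ 2) = (\<Sum>d\<in>D. \<Sum>d'\<in>D. of_real (N d * N d') * ee q ((d - d') * t))"
      unfolding * complex_norm_square cnj_sum sum_product
      by (intro sum.cong refl) (simp add: ee_uminus[symmetric] ee_add[symmetric] algebra_simps)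
  qed
  also have "\<dots> = (\<Sum>d\<in>D. \<Sum>d'\<in>D. of_real (N d * N d') * (\<Sum>t\<in>{0..<int q}. ee q ((d - d') * t)))"
    unfolding sum_distrib_left by (rule trans[OF sum.swap sum.cong[OF refl sum.swap]])
  also have "\<dots> = (\<Sum>d\<in>D. \<Sum>d'\<in>D. if d = d' then of_real (N d ^ 2 * real q) else 0)"
  proof (intro sum.cong refl)
    fix d d' assume "d \<in> D" "d' \<in> D"
    then have "d \<in> {0..<int q}" "d' \<in> {0..<int q}" using D(2) by auto
    then have "int q dvd d - d' \<longleftrightarrow> d = d'" by (rule dvd_diff_residues)
    then show "of_real (N d * N d') * (\<Sum>t\<in>{0..<int q}. ee q ((d - d') * t)) = (if d = d' then of_real (N d ^ 2 * real q) else 0)"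
      using sum_ee[OF q, of "d - d'"] by (simp add: power2_eq_square)
  qed
  also have "\<dots> = of_real ((\<Sum>d\<in>D. N d ^ 2) * real q)" using D(1) by (simp add: sum_distrib_right)
  finally have eq: "(\<Sum>t\<in>{0..<int q}. norm (\<Sum>s\<in>S. ee q (t * f s)) ^ 2) = (\<Sum>d\<in>D. N d ^ 2) * real q"
    by (simp only: of_real_eq_iff)
  have "real (card S) ^ 2 \<le> (\<Sum>d\<in>D. N d ^ 2) * (\<Sum>d\<in>D. 1 ^ 2)"
    unfolding S1 by (rule Cauchy_Schwarz_ineq_sum)
  then have "real q * real (card S) ^ 2 \<le> real q * ((\<Sum>d\<in>D. N d ^ 2) * real (card D))"
    by (intro mult_left_mono) auto
  then show ?thesis unfolding eq D_def[symmetric] by (simp add: mult_ac)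
qed

subsection \<open>Second moment of the distance counting function\<close>

lemma ee_sum: "ee q (sum f S) = (\<Prod>i\<in>S. ee q (f i))"
  by (induction S rule: infinite_finite_induct) (auto simp: ee_add)

text \<open>The exponent of p gained over the trivial bound by the sum in the i-th variable modulo
  p^l.\<close>

definition saving :: "(nat \<Rightarrow> nat) \<Rightarrow> nat \<Rightarrow> nat \<Rightarrow> real"
  where "saving k l i = max (real l / real (k i)) (1 / 2)"

locale diagonal_form =
  fixes n :: nat and a :: "nat \<Rightarrow> int" and k :: "nat \<Rightarrow> nat" and p r :: nat
  assumes n: "n \<ge> 2" and k: "\<And>i. i \<in> {1..n} \<Longrightarrow> k i \<ge> 2"
    and p: "prime p" and kp: "\<And>i. i \<in> {1..n} \<Longrightarrow> k i < p" and a: "\<And>i. i \<in> {1..n} \<Longrightarrow> \<not> int p dvd a i"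
    and r: "r \<ge> 1"
begin

lemma p_pos: "p > 0" and p_gt_1: "p > 1"
  by (rule prime_gt_0_nat[OF p], rule prime_gt_1_nat[OF p])

text \<open>Bounds the square of \<open>S A B t\<close>, relative to the product of the two
  cardinalities, when t / p^r has denominator p^l in lowest terms.\<close>

definition H :: "nat \<Rightarrow> real"
  where "H l = (\<Prod>i\<in>{1..n}. real (k i)) ^ 2 * real p powr (2 * (real n * real r - (\<Sum>i\<in>{1..n}. saving k l i)))"

definition S :: "(nat \<Rightarrow> int) set \<Rightarrow> (nat \<Rightarrow> int) set \<Rightarrow> int \<Rightarrow> complex"
  where "S A B t = (\<Sum>(x, y)\<in>A \<times> B. ee (p ^ r) (t * diag_poly n a k (\<lambda>i. x i - y i)))"

text \<open>F is diagonal, so the kernel is a product over the variables. Each Fourier transform is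
  a binomial sum whose leading coefficient contains p^j, and \<open>gs_scale\<close> lowers its
  modulus to p^l.\<close>

lemma S_bound:
  assumes AB: "A \<subseteq> rvec n (p ^ r)" "B \<subseteq> rvec n (p ^ r)"
    and t: "t = int (p ^ j) * t'" "\<not> int p dvd t'" "j < r"
  shows "norm (S A B t) ^ 2 \<le> H (r - j) * (real (card A) * real (card B))"
proof -
  define l where "l = r - j"
  have l: "l \<ge> 1" "p ^ r = p ^ j * p ^ l" "real r = real j + real l"
    using t(3) by (auto simp: l_def simp flip: power_add)
  let ?q = "p ^ r"
  define g where "g = (\<lambda>i z. ee ?q (t * a i * z ^ k i))"
  have "S A B t = (\<Sum>x\<in>A. \<Sum>y\<in>B. \<Prod>i\<in>{1..n}. g i (x i - y i))"
    unfolding S_def sum.cartesian_product[symmetric] diag_poly_def sum_distrib_left ee_sum g_def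
    by (simp only: mult.assoc)
  moreover have "norm (\<Sum>x\<in>A. \<Sum>y\<in>B. \<Prod>i\<in>{1..n}. g i (x i - y i)) ^ 2 \<le>
      (\<Prod>i\<in>{1..n}. real (k i) * real p powr (real r - saving k l i)) ^ 2 * (real (card A) * real (card B))"
  proof (rule convolution_bound[OF _ AB])
    show "?q > 0" using p_pos by simp
    show "g i z = g i w" if "[z = w] (mod int ?q)" for i z w
      unfolding g_def using that p_pos by (intro ee_cong cong_mult cong_pow cong_refl) auto
  next
    fix i m assume i: "i \<in> {1..n}"
    interpret binomial_sum p "k i" "t' * a i"
      using p k[OF i] kp[OF i] a[OF i] t(2) prime_dvd_mult_iff[of "int p" t' "a i"]
      by unfold_locales auto
    have "(\<Sum>z\<in>{0..<int ?q}. g i z * ee ?q (- m * z)) = gs (p ^ j * p ^ l) (k i) (int (p ^ j) * (t' * a i)) (- m)"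
      unfolding gs_def g_def ee_add l(2)[symmetric] t(1) by (simp only: mult.assoc)
    also have "norm \<dots> \<le> real p ^ j * (real (k i) * real p powr (real l - saving k l i))"
      using gs_scale[of "p ^ l" "p ^ j" "k i" "t' * a i" "- m"] p_pos gs_bound[OF l(1)]
      by (simp add: saving_def norm_mult norm_power mult_left_mono)
    also have "\<dots> = real (k i) * real p powr (real r - saving k l i)"
      using p_pos by (simp add: l(3) powr_realpow[symmetric] powr_add[symmetric] algebra_simps)
    finally show "norm (\<Sum>z\<in>{0..<int ?q}. g i z * ee ?q (- m * z)) \<le> real (k i) * real p powr (real r - saving k l i)" .
  qed
  moreover have "(\<Prod>i\<in>{1..n}. real (k i) * real p powr (real r - saving k l i)) ^ 2 = H l"
  proof -
    have "(\<Prod>i\<in>{1..n}. real p powr (real r - saving k l i)) = real p powr (\<Sum>i\<in>{1..n}. real r - saving k l i)"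
      using p_pos by (intro powr_sum[symmetric]) auto
    also have "\<dots> ^ 2 = real p powr (2 * (real n * real r - (\<Sum>i\<in>{1..n}. saving k l i)))"
      using p_pos by (simp add: sum_subtractf power2_eq_square flip: powr_add)
    finally show ?thesis by (simp add: prod.distrib power_mult_distrib H_def)
  qed
  ultimately show ?thesis by (simp add: l_def)
qed

lemma H_nonneg: "H l \<ge> 0"
  by (simp add: H_def)

text \<open>The frequency 0 gives the square of the product of cardinalities. The others are sorted
  by their power of p, and at most p^l of them are multiples of p^(r-l).\<close>

lemma second_moment:
  assumes AB: "A \<subseteq> rvec n (p ^ r)" "B \<subseteq> rvec n (p ^ r)"
  shows "(\<Sum>t\<in>{0..<int (p ^ r)}. norm (S A B t) ^ 2) \<le>
    (real (card A) * real (card B)) ^ 2 + (\<Sum>l=1..r. real p ^ l * H l) * (real (card A) * real (card B))"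
proof -
  define M where "M = real (card A) * real (card B)"
  have M0: "M \<ge> 0" by (simp add: M_def)
  have q0: "p ^ r > 0" using p_pos by simp
  have "{0..<int (p ^ r)} = insert 0 {1..<int (p ^ r)}" using q0 by (auto simp del: of_nat_power)
  then have split: "(\<Sum>t\<in>{0..<int (p ^ r)}. norm (S A B t) ^ 2) = norm (S A B 0) ^ 2 + (\<Sum>t\<in>{1..<int (p ^ r)}. norm (S A B t) ^ 2)"
    by simp
  have "S A B 0 = of_real M" by (simp add: S_def M_def card_cartesian_product case_prod_unfold)
  then have zero: "norm (S A B 0) = M" using M0 by simp
  \<comment> \<open>Admitting every l with p^(r-l) dividing t, not only the exact one, adds
    nonnegative terms and makes the two sums independent after exchange.\<close>
  have "(\<Sum>t\<in>{1..<int (p ^ r)}. norm (S A B t) ^ 2) \<le>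
      (\<Sum>t\<in>{1..<int (p ^ r)}. \<Sum>l=1..r. if int (p ^ (r - l)) dvd t then H l * M else 0)"
  proof (rule sum_mono)
    fix t assume t: "t \<in> {1..<int (p ^ r)}"
    then have "t \<noteq> 0" "\<not> is_unit (int p)" using p_gt_1 by auto
    then obtain t' where t': "t = int p ^ multiplicity (int p) t * t'" "\<not> int p dvd t'"
      by (rule multiplicity_decompose')
    define j where "j = multiplicity (int p) t"
    have tj: "t = int (p ^ j) * t'" using t'(1) by (simp add: j_def)
    have "j < r"
    proof (rule ccontr)
      assume "\<not> j < r"
      then have "int (p ^ r) dvd int (p ^ j)" by (simp only: of_nat_dvd_iff le_imp_power_dvd not_less)
      then have "int (p ^ r) dvd t" by (simp only: tj dvd_mult2)
      then show False using t zdvd_imp_le[of "int (p ^ r)" t] by auto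
    qed
    then have "norm (S A B t) ^ 2 \<le> (if int (p ^ (r - (r - j))) dvd t then H (r - j) * M else 0)"
      using S_bound[OF AB tj t'(2)] by (simp add: M_def tj)
    also have "\<dots> \<le> (\<Sum>l=1..r. if int (p ^ (r - l)) dvd t then H l * M else 0)"
      using \<open>j < r\<close> H_nonneg M0 by (intro member_le_sum) auto
    finally show "norm (S A B t) ^ 2 \<le> (\<Sum>l=1..r. if int (p ^ (r - l)) dvd t then H l * M else 0)" .
  qed
  also have "\<dots> = (\<Sum>l=1..r. \<Sum>t\<in>{1..<int (p ^ r)}. if int (p ^ (r - l)) dvd t then H l * M else 0)"
    by (rule sum.swap)
  also have "\<dots> \<le> (\<Sum>l=1..r. real p ^ l * H l * M)"
  proof (rule sum_mono)
    fix l assume l: "l \<in> {1..r}"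
    let ?D = "{t\<in>{1..<int (p ^ r)}. int (p ^ (r - l)) dvd t}"
    have "p ^ r = p ^ (r - l) * p ^ l" using l by (simp flip: power_add)
    then have pr: "int (p ^ r) = int (p ^ (r - l)) * int (p ^ l)" by (simp only: of_nat_mult)
    have "?D \<subseteq> (\<lambda>w. int (p ^ (r - l)) * w) ` {0..<int (p ^ l)}"
    proof
      fix t assume t: "t \<in> ?D"
      then obtain w where w: "t = int (p ^ (r - l)) * w" by (auto elim: dvdE)
      have pos: "int (p ^ (r - l)) > 0" using p_pos by simp
      have "0 < int (p ^ (r - l)) * w" "int (p ^ (r - l)) * w < int (p ^ (r - l)) * int (p ^ l)"
        using t unfolding w pr by auto
      then have "w \<in> {0..<int (p ^ l)}" using pos by (simp only: zero_less_mult_iff mult_less_cancel_left_pos) auto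
      then show "t \<in> (\<lambda>w. int (p ^ (r - l)) * w) ` {0..<int (p ^ l)}" using w by blast
    qed
    then have "card ?D \<le> card {0..<int (p ^ l)}" by (rule surj_card_le[rotated]) simp
    then have "real (card ?D) \<le> real p ^ l" by (simp add: nat_power_eq flip: of_nat_power)
    then have "real (card ?D) * (H l * M) \<le> real p ^ l * (H l * M)"
      using H_nonneg M0 by (intro mult_right_mono) auto
    moreover have "(\<Sum>t\<in>{1..<int (p ^ r)}. if int (p ^ (r - l)) dvd t then H l * M else 0) = real (card ?D) * (H l * M)"
      by (subst sum.inter_filter[symmetric]) auto
    ultimately show "(\<Sum>t\<in>{1..<int (p ^ r)}. if int (p ^ (r - l)) dvd t then H l * M else 0) \<le> real p ^ l * H l * M"
      by (simp only: mult.assoc)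
  qed
  also have "\<dots> = (\<Sum>l=1..r. real p ^ l * H l) * M" by (simp add: sum_distrib_right)
  finally show ?thesis unfolding split zero M_def by (rule add_left_mono)
qed

definition D :: real
  where "D = real p powr (real r * (2 * real n - 2 / real (min_exponent n k)) - real n + 1)"

text \<open>One variable of smallest exponent contributes l divided by it; each of the n - 1 others
  contributes at least \<mu>. The excess of \<mu> over 1/2 is kept once, which is possible since n
  is at least 2. This excess yields decay in l when the smallest exponent is 2 and the main term is
  the same for all l; without it the sum would cost a factor r.\<close>

lemma saving_lower:
  assumes "l \<le> r"
  shows "real l - 2 * (\<Sum>i\<in>{1..n}. saving k l i) \<le>
    real r * (1 - 2 / real (min_exponent n k)) - (real n - 1) - max 0 (2 * real l / real (Max (k ` {1..n})) - 1)"
proof -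
  define K where "K = Max (k ` {1..n})"
  define \<mu> where "\<mu> = max (real l / real K) (1 / 2)"
  have ne: "finite (k ` {1..n})" "k ` {1..n} \<noteq> {}" using n by auto
  obtain i0 where i0: "i0 \<in> {1..n}" "k i0 = min_exponent n k"
    using Min_in[OF ne] by (auto simp: min_exponent_def)
  have \<mu>: "saving k l i \<ge> \<mu>" if i: "i \<in> {1..n}" for i
  proof -
    have "k i \<le> K" unfolding K_def using i ne(1) by (intro Max_ge) auto
    then have "real l / real K \<le> real l / real (k i)" using k[OF i] by (intro divide_left_mono) auto
    then show ?thesis unfolding \<mu>_def saving_def by (intro max.mono) auto
  qed
  have "(\<Sum>i\<in>{1..n}. saving k l i) = saving k l i0 + (\<Sum>i\<in>{1..n}-{i0}. saving k l i)"
    using i0 by (intro sum.remove) auto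
  moreover have "saving k l i0 \<ge> real l / real (min_exponent n k)" by (simp add: saving_def i0(2))
  moreover have "(\<Sum>i\<in>{1..n}-{i0}. saving k l i) \<ge> (real n - 1) * \<mu>"
  proof -
    have "(real n - 1) * \<mu> = (\<Sum>i\<in>{1..n}-{i0}. \<mu>)"
      using i0 n by (simp add: card_Diff_singleton of_nat_diff)
    also have "\<dots> \<le> (\<Sum>i\<in>{1..n}-{i0}. saving k l i)" using \<mu> by (intro sum_mono) auto
    finally show ?thesis .
  qed
  moreover have "(real n - 1) * \<mu> \<ge> (real n - 1) / 2 + (\<mu> - 1 / 2)"
  proof -
    have "(real n - 2) * (\<mu> - 1 / 2) \<ge> 0" using n by (intro mult_nonneg_nonneg) (auto simp: \<mu>_def)
    then show ?thesis by (simp add: field_simps)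
  qed
  moreover have "2 * s \<ge> 2 * x + N + (2 * \<mu> - 1)"
    if "s = s1 + s2" "s1 \<ge> x" "s2 \<ge> t" "t \<ge> N / 2 + (\<mu> - 1 / 2)" for s s1 s2 x t N :: real
    using that by linarith
  ultimately have "2 * (\<Sum>i\<in>{1..n}. saving k l i) \<ge> 2 * (real l / real (min_exponent n k)) + (real n - 1) + (2 * \<mu> - 1)"
    by blast
  moreover have "2 * \<mu> - 1 = max 0 (2 * real l / real K - 1)"
  proof -
    have "2 * max x (1 / 2) - 1 = max 0 (2 * x - 1)" for x :: real by (simp add: max_def)
    then show ?thesis unfolding \<mu>_def by (simp only: times_divide_eq_right)
  qed
  moreover have "real l - 2 * (real l / real (min_exponent n k)) \<le> real r * (1 - 2 / real (min_exponent n k))"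
  proof -
    have "real (min_exponent n k) \<ge> 2" using k[OF i0(1)] i0(2) by simp
    then have "0 \<le> 1 - 2 / real (min_exponent n k)" by simp
    then have "real l * (1 - 2 / real (min_exponent n k)) \<le> real r * (1 - 2 / real (min_exponent n k))"
      using assms by (intro mult_right_mono) auto
    then show ?thesis by (simp add: algebra_simps)
  qed
  ultimately show ?thesis unfolding K_def by linarith
qed

text \<open>The decay per step of l, taken at p = 2 as the worst case, so that the geometric series
  does not depend on p.\<close>

definition \<rho> :: real where "\<rho> = 2 powr (- 2 / real (Max (k ` {1..n})))"

lemma moment_term:
  assumes "l \<le> r"
  shows "real p ^ l * H l \<le> (\<Prod>i\<in>{1..n}. real (k i)) ^ 2 * (2 * \<rho> ^ l) * (real p ^ r * D)"
proof -
  define \<delta> where "\<delta> = max 0 (2 * real l / real (Max (k ` {1..n})) - 1)"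
  have pw: "real p ^ i = real p powr real i" for i using p_pos by (simp add: powr_realpow)
  have "real p ^ l * real p powr (2 * (real n * real r - (\<Sum>i\<in>{1..n}. saving k l i))) =
      real p powr (real l - 2 * (\<Sum>i\<in>{1..n}. saving k l i) + 2 * real n * real r)"
    by (simp add: pw powr_add[symmetric] algebra_simps)
  also have "\<dots> \<le> real p powr ((real r + (real r * (2 * real n - 2 / real (min_exponent n k)) - real n + 1)) + - \<delta>)"
    using saving_lower[OF assms] p_gt_1 by (intro powr_mono) (auto simp: \<delta>_def algebra_simps)
  also have "\<dots> = real p ^ r * D * real p powr (- \<delta>)"
    by (simp only: powr_add pw D_def)
  \<comment> \<open>The factor 2 pays for the -1 in \<delta>, that is, for the small l at which the
    excess is still 0.\<close>
  also have "real p powr (- \<delta>) \<le> 2 * \<rho> ^ l"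
  proof -
    have "real p powr (- \<delta>) \<le> 2 powr (- \<delta>)"
      using p_gt_1 by (intro powr_mono2') (auto simp: \<delta>_def)
    also have "\<dots> \<le> 2 powr (1 + real l * (- 2 / real (Max (k ` {1..n}))))"
    proof (rule powr_mono)
      have "2 * real l / real (Max (k ` {1..n})) - 1 \<le> \<delta>" unfolding \<delta>_def by (rule max.cobounded2)
      then show "- \<delta> \<le> 1 + real l * (- 2 / real (Max (k ` {1..n})))" by (simp add: mult.commute)
    qed simp
    also have "\<dots> = 2 * \<rho> ^ l"
    proof -
      have "\<rho> ^ l = 2 powr (real l * (- 2 / real (Max (k ` {1..n}))))"
        by (simp add: \<rho>_def powr_realpow[symmetric] powr_powr mult.commute)
      moreover have "2 powr (1 + x) = 2 * 2 powr x" for x :: real by (simp add: powr_add)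
      ultimately show ?thesis by (simp only:)
    qed
    finally show ?thesis .
  qed
  finally have "real p ^ l * real p powr (2 * (real n * real r - (\<Sum>i\<in>{1..n}. saving k l i))) \<le>
      real p ^ r * D * (2 * \<rho> ^ l)"
    by (simp add: D_def mult_left_mono)
  then have "(\<Prod>i\<in>{1..n}. real (k i)) ^ 2 * (real p ^ l * real p powr (2 * (real n * real r - (\<Sum>i\<in>{1..n}. saving k l i)))) \<le>
      (\<Prod>i\<in>{1..n}. real (k i)) ^ 2 * (real p ^ r * D * (2 * \<rho> ^ l))"
    by (intro mult_left_mono) auto
  then show ?thesis by (simp add: H_def mult_ac)
qed

definition C :: real where "C = (\<Prod>i\<in>{1..n}. real (k i)) ^ 2 * (2 / (1 - \<rho>))"

lemma \<rho>_bounds: "0 < \<rho>" "\<rho> < 1"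
proof -
  have "Max (k ` {1..n}) \<in> k ` {1..n}" using n by (intro Max_in) auto
  then have "real (Max (k ` {1..n})) > 0" using k by fastforce
  then show "0 < \<rho>" "\<rho> < 1" by (auto simp: \<rho>_def powr_less_one)
qed

lemma C_nonneg: "C \<ge> 0"
  using \<rho>_bounds by (simp add: C_def)

lemma D_pos: "D > 0"
  using p_pos by (simp add: D_def)

lemma moment_sum: "(\<Sum>l=1..r. real p ^ l * H l) \<le> C * (real p ^ r * D)"
proof -
  have "(\<Sum>l=1..r. \<rho> ^ l) \<le> (\<Sum>l<Suc r. \<rho> ^ l)"
    using \<rho>_bounds by (intro sum_mono2) auto
  also have "\<dots> = (1 - \<rho> ^ Suc r) / (1 - \<rho>)"
    using \<rho>_bounds sum_gp_strict[of \<rho> "Suc r"] by simp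
  also have "\<dots> \<le> 1 / (1 - \<rho>)"
    using \<rho>_bounds by (intro divide_right_mono) auto
  finally have geo: "(\<Sum>l=1..r. \<rho> ^ l) \<le> 1 / (1 - \<rho>)" .
  have "(\<Sum>l=1..r. real p ^ l * H l) \<le> (\<Sum>l=1..r. (\<Prod>i\<in>{1..n}. real (k i)) ^ 2 * (2 * \<rho> ^ l) * (real p ^ r * D))"
    by (intro sum_mono moment_term) auto
  also have "\<dots> = (\<Prod>i\<in>{1..n}. real (k i)) ^ 2 * (2 * (\<Sum>l=1..r. \<rho> ^ l)) * (real p ^ r * D)"
    by (simp add: sum_distrib_left sum_distrib_right)
  also have "\<dots> \<le> (\<Prod>i\<in>{1..n}. real (k i)) ^ 2 * (2 * (1 / (1 - \<rho>))) * (real p ^ r * D)"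
    using geo D_pos by (intro mult_right_mono mult_left_mono) auto
  finally show ?thesis by (simp add: C_def)
qed

text \<open>With N the number of distances, \<open>card_image_lower_bound\<close> and the second
  moment give q M \<le> N (M + C q D); the first term of the bracket dominates for large sets, the
  second for small ones.\<close>

lemma distance_set_lower_bound:
  assumes AB: "A \<subseteq> rvec n (p ^ r)" "B \<subseteq> rvec n (p ^ r)"
  shows "real (card (distance_set n a k (int p ^ r) A B)) \<ge>
    1 / (1 + C) * min (real p ^ r) (real (card A) * real (card B) / D)"
proof -
  define M where "M = real (card A) * real (card B)"
  define q where "q = real p ^ r"
  define N where "N = real (card (distance_set n a k (int p ^ r) A B))"
  have fin: "finite A" "finite B" using AB finite_rvec finite_subset by blast+
  have q0: "q > 0" using p_pos by (simp add: q_def)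
  show ?thesis
  proof (cases "M = 0")
    case True
    then show ?thesis by (auto simp: M_def)
  next
    case False
    then have M0: "M > 0" by (simp add: M_def)
    have "distance_set n a k (int p ^ r) A B =
        (\<lambda>s. (case s of (x, y) \<Rightarrow> diag_poly n a k (\<lambda>i. x i - y i)) mod int (p ^ r)) ` (A \<times> B)"
      by (auto simp: distance_set_def image_def)
    then have "real (p ^ r) * real (card (A \<times> B)) ^ 2 \<le> N *
        (\<Sum>t\<in>{0..<int (p ^ r)}. norm (\<Sum>s\<in>A \<times> B. ee (p ^ r) (t * (case s of (x, y) \<Rightarrow> diag_poly n a k (\<lambda>i. x i - y i)))) ^ 2)"
      unfolding N_def using p_pos fin by (simp only:) (intro card_image_lower_bound; simp)
    also have "(\<Sum>t\<in>{0..<int (p ^ r)}. norm (\<Sum>s\<in>A \<times> B. ee (p ^ r) (t * (case s of (x, y) \<Rightarrow> diag_poly n a k (\<lambda>i. x i - y i)))) ^ 2) =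
        (\<Sum>t\<in>{0..<int (p ^ r)}. norm (S A B t) ^ 2)"
      by (simp add: S_def case_prod_unfold)
    also have "N * \<dots> \<le> N * (M ^ 2 + C * (q * D) * M)"
    proof (rule mult_left_mono)
      have "(\<Sum>l=1..r. real p ^ l * H l) * M \<le> C * (q * D) * M"
        using moment_sum M0 by (intro mult_right_mono) (auto simp: q_def)
      then show "(\<Sum>t\<in>{0..<int (p ^ r)}. norm (S A B t) ^ 2) \<le> M ^ 2 + C * (q * D) * M"
        using second_moment[OF AB] by (simp add: M_def)
    qed (simp add: N_def)
    finally have "M * (q * M) \<le> M * (N * (M + C * (q * D)))"
      by (simp add: card_cartesian_product M_def q_def power2_eq_square algebra_simps)
    then have main: "q * M \<le> N * (M + C * (q * D))" using M0 by simp
    \<comment> \<open>This minimum is at most q and at most M / D, so its products with the two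
      terms of the bracket are at most q M and C q M; both regimes are settled without a case
      split.\<close>
    define \<mu> where "\<mu> = min q (M / D)"
    have "\<mu> * (M + C * (q * D)) = \<mu> * M + C * q * (\<mu> * D)" by (simp add: algebra_simps)
    also have "\<dots> \<le> q * M + C * q * M"
    proof (intro add_mono mult_right_mono mult_left_mono)
      show "\<mu> * D \<le> M" using D_pos by (simp add: \<mu>_def min_def field_simps)
    qed (use M0 C_nonneg q0 in \<open>auto simp: \<mu>_def\<close>)
    also have "\<dots> = (1 + C) * (q * M)" by (simp add: algebra_simps)
    also have "\<dots> \<le> (1 + C) * (N * (M + C * (q * D)))"
      using main C_nonneg by (intro mult_left_mono) auto
    finally have "\<mu> * (M + C * (q * D)) \<le> ((1 + C) * N) * (M + C * (q * D))" by (simp add: mult.assoc)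
    moreover have "M + C * (q * D) > 0" using M0 C_nonneg q0 D_pos by (intro add_pos_nonneg) auto
    ultimately have "\<mu> \<le> (1 + C) * N" by simp
    then show ?thesis using C_nonneg by (simp add: \<mu>_def N_def M_def q_def field_simps)
  qed
qed

text \<open>Squaring the hypothesis and multiplying by p^(2 r n) produces exactly the exponent of
  p^r D.\<close>

lemma density_condition:
  assumes K: "K > 0" and dens: "sqrt M / real p ^ (r * n) \<ge>
      K * real p powr (real r * (1/2 - 1 / real (min_exponent n k)) - (real n - 1) / 2)" and M: "M \<ge> 0"
  shows "K ^ 2 * real p ^ r \<le> M / D"
proof -
  define e where "e = real r * (1/2 - 1 / real (min_exponent n k)) - (real n - 1) / 2"
  have pw: "real p ^ i = real p powr real i" for i using p_pos by (simp add: powr_realpow)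
  have "K * real p powr e * real p ^ (r * n) \<le> sqrt M"
    using dens p_pos by (simp add: e_def pos_le_divide_eq)
  then have "(K * real p powr e * real p ^ (r * n)) ^ 2 \<le> sqrt M ^ 2"
    using K by (intro power_mono) auto
  then have "(K * real p powr e * real p ^ (r * n)) ^ 2 \<le> M" using M by simp
  also have "(K * real p powr e * real p ^ (r * n)) ^ 2 = K ^ 2 * (real p powr (2 * (e + real (r * n))))"
    by (simp add: pw power2_eq_square mult_ac flip: powr_add)
  also have "2 * (e + real (r * n)) = real r + (real r * (2 * real n - 2 / real (min_exponent n k)) - real n + 1)"
    by (simp add: e_def field_simps)
  finally have "K ^ 2 * (real p ^ r * D) \<le> M" by (simp only: powr_add pw D_def)
  then show ?thesis using D_pos by (simp add: field_simps)
qed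

end

theorem mainTheorem3:
  fixes n :: nat and a :: "nat \<Rightarrow> int" and k :: "nat \<Rightarrow> nat"
  assumes "n \<ge> 2"
    and "\<And>i. i \<in> {1..n} \<Longrightarrow> k i \<ge> 2"
    and "\<And>i. i \<in> {1..n} \<Longrightarrow> a i \<noteq> 0"
  shows "\<exists>(p0::nat) (c::real). c > 0 \<and>
    (\<forall>(p::nat) (r::nat) E1 E2.
       prime p \<and> p > p0 \<and> r \<ge> 1 \<and>
       E1 \<subseteq> residue_vectors n (int p ^ r) \<and> E2 \<subseteq> residue_vectors n (int p ^ r) \<longrightarrow>
       real (card (distance_set n a k (int p ^ r) E1 E2)) \<ge>
         c * min (real p ^ r)
               (real (card E1) * real (card E2) /
                real p powr (real r * (2 * real n - 2 / real (min_exponent n k)) - real n + 1))) \<and>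
    (\<forall>K::real. K > 0 \<longrightarrow>
       (\<exists>c'::real. c' > 0 \<and>
         (\<forall>(p::nat) (r::nat) E1 E2.
            prime p \<and> p > p0 \<and> r \<ge> 1 \<and>
            E1 \<subseteq> residue_vectors n (int p ^ r) \<and> E2 \<subseteq> residue_vectors n (int p ^ r) \<and>
            sqrt (real (card E1) * real (card E2)) / real p ^ (r * n) \<ge>
              K * real p powr (real r * (1/2 - 1 / real (min_exponent n k)) - (real n - 1) / 2) \<longrightarrow>
            real (card (distance_set n a k (int p ^ r) E1 E2)) \<ge> c' * real p ^ r)))"
proof -
  \<comment> \<open>A prime above this sum exceeds every k i and every |a i|, hence divides no
    coefficient.\<close>
  define p0 where "p0 = (\<Sum>i\<in>{1..n}. k i + nat \<bar>a i\<bar>)"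
  \<comment> \<open>\<open>diagonal_form.C\<close> written out, which shows that the constant is
    free of p and r.\<close>
  define c where "c = 1 / (1 + (\<Prod>i\<in>{1..n}. real (k i)) ^ 2 * (2 / (1 - 2 powr (- 2 / real (Max (k ` {1..n}))))))"
  have form: "diagonal_form n a k p r" if "prime p" "p > p0" "r \<ge> 1" for p r
  proof
    fix i assume i: "i \<in> {1..n}"
    have "k i + nat \<bar>a i\<bar> \<le> p0" unfolding p0_def using i by (intro member_le_sum) auto
    then have le: "k i + nat \<bar>a i\<bar> < p" using that by simp
    then show "k i < p" by simp
    show "\<not> int p dvd a i" using le assms(3)[OF i] dvd_imp_le_int[of "a i" "int p"] by auto
  qed (use assms that in auto)
  have c_eq: "c = 1 / (1 + diagonal_form.C n k)" if "diagonal_form n a k p r" for p r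
    using that by (simp add: c_def diagonal_form.C_def diagonal_form.\<rho>_def)
  \<comment> \<open>The sign of \<open>C\<close> is known only inside the locale, so some prime must
    be supplied to instantiate it.\<close>
  obtain p1 :: nat where "prime p1" "p1 > p0" using bigger_prime by blast
  then have "diagonal_form n a k p1 1" by (intro form) auto
  then have c0: "c > 0" using c_eq diagonal_form.C_nonneg by (metis add_pos_nonneg zero_less_divide_1_iff zero_less_one)
  have main: "real (card (distance_set n a k (int p ^ r) E1 E2)) \<ge>
         c * min (real p ^ r) (real (card E1) * real (card E2) /
                real p powr (real r * (2 * real n - 2 / real (min_exponent n k)) - real n + 1))"
    if *: "prime p" "p > p0" "r \<ge> 1" "E1 \<subseteq> residue_vectors n (int p ^ r)" "E2 \<subseteq> residue_vectors n (int p ^ r)" for p r E1 E2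
  proof -
    interpret diagonal_form n a k p r using form * by blast
    have "E1 \<subseteq> rvec n (p ^ r)" "E2 \<subseteq> rvec n (p ^ r)"
      using *(4,5) residue_vectors_eq[of n "p ^ r"] by auto
    from distance_set_lower_bound[OF this] show ?thesis
      using c_eq[OF diagonal_form_axioms] by (simp only: D_def)
  qed
  have dense: "\<exists>c'>0. \<forall>(p::nat) (r::nat) E1 E2.
            prime p \<and> p > p0 \<and> r \<ge> 1 \<and>
            E1 \<subseteq> residue_vectors n (int p ^ r) \<and> E2 \<subseteq> residue_vectors n (int p ^ r) \<and>
            sqrt (real (card E1) * real (card E2)) / real p ^ (r * n) \<ge>
              K * real p powr (real r * (1/2 - 1 / real (min_exponent n k)) - (real n - 1) / 2) \<longrightarrow>
            real (card (distance_set n a k (int p ^ r) E1 E2)) \<ge> c' * real p ^ r" if K: "K > 0" for K :: real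
  \<comment> \<open>By \<open>density_condition\<close> the second entry of the minimum is at least
    K^2 p^r, so the minimum is at least \<open>min 1 (K ^ 2)\<close> times p^r.\<close>
  proof (intro exI[of _ "c * min 1 (K ^ 2)"] conjI allI impI)
    show "c * min 1 (K ^ 2) > 0" using c0 K by simp
  next
    fix p r E1 E2
    assume *: "prime p \<and> p > p0 \<and> r \<ge> 1 \<and>
            E1 \<subseteq> residue_vectors n (int p ^ r) \<and> E2 \<subseteq> residue_vectors n (int p ^ r) \<and>
            sqrt (real (card E1) * real (card E2)) / real p ^ (r * n) \<ge>
              K * real p powr (real r * (1/2 - 1 / real (min_exponent n k)) - (real n - 1) / 2)"
    interpret diagonal_form n a k p r using form * by blast
    have "K ^ 2 * real p ^ r \<le> real (card E1) * real (card E2) / D"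
      using * by (intro density_condition K) auto
    then have "min 1 (K ^ 2) * real p ^ r \<le> min (real p ^ r) (real (card E1) * real (card E2) / D)"
    proof (intro min.boundedI)
      show "min 1 (K ^ 2) * real p ^ r \<le> real p ^ r"
        by (rule mult_left_le_one_le) (use K in auto)
      have "min 1 (K ^ 2) * real p ^ r \<le> K ^ 2 * real p ^ r" by (intro mult_right_mono) auto
      then show "min 1 (K ^ 2) * real p ^ r \<le> real (card E1) * real (card E2) / D"
        using \<open>K ^ 2 * real p ^ r \<le> real (card E1) * real (card E2) / D\<close> by (rule order_trans)
    qed
    then have "c * (min 1 (K ^ 2) * real p ^ r) \<le> c * min (real p ^ r) (real (card E1) * real (card E2) / D)"
      using c0 by (intro mult_left_mono) auto
    also have "\<dots> \<le> real (card (distance_set n a k (int p ^ r) E1 E2))"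
      using main[of p r E1 E2] * by (simp add: D_def)
    finally show "real (card (distance_set n a k (int p ^ r) E1 E2)) \<ge> c * min 1 (K ^ 2) * real p ^ r"
      by (simp only: mult.assoc)
  qed
  show ?thesis
    by (rule exI[of _ p0], rule exI[of _ c], intro conjI allI impI c0)
      (elim conjE, rule main, assumption+, rule dense, assumption)
qed

end
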